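(* (a) $\bigoplus_{n\ge0}\mathrm{scf}(\mathcal N_n(\nu))$, with product $\mathbf m$ and coproduct $\blacktriangle$, has a Hopf algebra structure. (b) The characteristic map $\mathrm{ch}_\nu:\bigoplus_{n\ge0}\mathrm{scf}(\mathcal N_n(\nu))\to\mathsf{QSym}$, $\dot\chi^I(\nu)\mapsto L_{\mathrm{comp}(I)}$ ($I\subseteq[n-1]$, $n\ge0$), is an isomorphism of Hopf algebras.
   Context: Fix an integer $\nu>1$; $C_\nu$ is the additive cyclic group of order $\nu$. $[a,b]=\{t\in\mathbb Z:a\le t\le b\}$ (empty if $a>b$), $[n]=[1,n]$. $Q_S(\nu)=\bigoplus_{s\in S}C_\nu$ for finite $S\subset\mathbb Z_{>0}$; $Q_n(\nu)=Q_{[n-1]}(\nu)$ (trivial for $n\le1$). $\psi_\nu(0)=1$, $\psi_\nu(g)=-1/(\nu-1)$ for $g\neq0$. For $I\subseteq[n-1]$, $\dot\chi^I(\nu)(\mathbf g)=\prod_{i\in[n-1]\setminus I}\psi_\nu(g_i)$ (the supercharacter, normalized to take value $1$ at the identity, of the normal supercharacter theory of $Q_n(\nu)$ given by the lattice $\{Q_I(\nu):I\subseteq[n-1]\}$). $\mathrm{scf}(\mathcal N_n(\nu))$ is the space of functions on $Q_n(\nu)$ whose value depends only on $\{i:g_i\neq0\}$; it has basis $\{\dot\chi^I(\nu):I\subseteq[n-1]\}$ and is $\mathbb C$ for $n\le1$. Compositions: for $n\ge1$, $\mathrm{comp}(\{s_1<\dots<s_i\})=(s_1,s_2-s_1,\dots,n-s_i)$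 for subsets of $[n-1]$; for $n=0$, $\mathrm{comp}(\emptyset)$ is the empty composition. $\mathsf{QSym}$: the Hopf algebra of quasisymmetric functions, basis $M_\alpha$, coproduct $\triangle M_\alpha=\sum_{\beta\cdot\gamma=\alpha}M_\beta\otimes M_\gamma$; $L_{\mathrm{comp}(I)}=\sum_{I\subseteq J\subseteq[n-1]}M_{\mathrm{comp}(J)}$ (fundamental quasisymmetric functions; $L$ of empty composition is $1$). Connectivity: for $A\subseteq[N]$, $\mathrm{conn}(A)$ = maximal subsets of consecutive integers of $A$; $A^c=[N]\setminus A$; $c_1(A)=\{\max B:B\in\mathrm{conn}(A)\}\setminus\{N\}$, $c_2(A)=\{\max B:B\in\mathrm{conn}(A^c)\}\setminus\{N\}$, $c(A)=c_1(A)\cup c_2(A)$. Product $\mathbf m$: for $m,n\ge0$, $A\subseteq[m+n]$ with $|A|=n$, $A=\{b_1<\dots<b_n\}$, $[m+n]\setminus A=\{a_1<\dots<a_m\}$ ($N=m+n$), functions $\phi$ on $Q_m(\nu)$, $\psi$ on $Q_n(\nu)$: if $m=0$ or $n=0$, $\mathbf m_A(\phi,\psi)=\phi\psi$; otherwise $\mathbf m_A(\phi,\psi)(\mathbf g)=\prod_{i\in c_2(A)}\psi_\nu(g_i)\cdot s_A(\phi,\psi)(\mathbf g')$ for $\mathbf g\in Q_{m+n}(\nu)$, with $s_A(\phi,\psi)(\mathbf h)=\phi(h_{a_1},\dots,h_{a_{m-1}})\psi_\nu(h_{a_m})\psi(h_{b_1},\dots,h_{b_{n-1}})\psi_\nu(h_{b_n})$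 on $Q_{[m+n]}(\nu)$ and $\mathbf g'$ equal to $\mathbf g$ on $[m+n-1]\setminus c(A)$ and $0$ on $c(A)\cup\{m+n\}$. $\mathbf m=\sum_A\mathbf m_A$ over all $n$-subsets $A$ of $[m+n]$, extended bilinearly. Coproduct $\blacktriangle$: for $\phi$ on $Q_n(\nu)$, $\blacktriangle_0(\phi)=1\otimes\phi$, $\blacktriangle_n(\phi)=\phi\otimes1$, and for $1\le k\le n-1$, $\blacktriangle_k(\phi)\in\mathrm{Fun}(Q_k(\nu))\otimes\mathrm{Fun}(Q_{n-k}(\nu))$ corresponds to the function $(\mathbf a,\mathbf b)\mapsto\phi(a_1,\dots,a_{k-1},0,b_1,\dots,b_{n-k-1})$; $\blacktriangle=\sum_{k=0}^n\blacktriangle_k$, extended linearly. *)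

theory Defs
  imports Complex_Main
begin

text \<open>C_nu is modelled by {0..<nu} (only whether an entry is 0 matters below).
  An element g = (g_1,...,g_{n-1}) of Q_n(nu) is the list [g_1,...,g_{n-1}].
  The graded space (direct sum over n) lives inside the functions on the
  disjoint union of the Q_n(nu): a point is a pair (n, g) with g in Q_n(nu).\<close>

type_synonym pt = "nat \<times> nat list"

definition Qn :: "nat \<Rightarrow> nat \<Rightarrow> nat list set" where
  "Qn \<nu> n = {xs. length xs = n - 1 \<and> (\<forall>x\<in>set xs. x < \<nu>)}"

definition pts :: "nat \<Rightarrow> pt set" where
  "pts \<nu> = {(n, xs). xs \<in> Qn \<nu> n}"

definition gat :: "nat list \<Rightarrow> nat \<Rightarrow> nat" where
  "gat g i = (if 1 \<le> i \<and> i \<le> length g then g ! (i - 1) else 0)"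

definition suppl :: "nat list \<Rightarrow> nat set" where
  "suppl g = {i. 1 \<le> i \<and> i \<le> length g \<and> g ! (i - 1) \<noteq> 0}"

definition psiv :: "nat \<Rightarrow> nat \<Rightarrow> complex" where
  "psiv \<nu> g = (if g = 0 then 1 else - 1 / (of_nat \<nu> - 1))"

definition chi :: "nat \<Rightarrow> nat \<Rightarrow> nat set \<Rightarrow> pt \<Rightarrow> complex" where
  "chi \<nu> n I = (\<lambda>(m, xs). if m = n \<and> xs \<in> Qn \<nu> n
      then (\<Prod>i\<in>{1..n-1} - I. psiv \<nu> (xs ! (i - 1))) else 0)"

text \<open>The direct sum of scf(N_n(nu)) over n \<ge> 0: finitely supported functions
  on the points, whose degree-n part depends only on {i. g_i \<noteq> 0}.\<close>
definition scfV :: "nat \<Rightarrow> (pt \<Rightarrow> complex) set" where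
  "scfV \<nu> = {F. finite {p. F p \<noteq> 0} \<and> (\<forall>p. F p \<noteq> 0 \<longrightarrow> p \<in> pts \<nu>) \<and>
      (\<forall>n xs ys. xs \<in> Qn \<nu> n \<longrightarrow> ys \<in> Qn \<nu> n \<longrightarrow> suppl xs = suppl ys \<longrightarrow> F (n, xs) = F (n, ys))}"

text \<open>Algebraic tensor square: V \<otimes> V as the finite sums of simple tensors
  phi \<otimes> psi, realised as functions (x,y) \<mapsto> phi x * psi y (Fun(X)\<otimes>Fun(Y) = Fun(X\<times>Y)).\<close>
definition scfVV :: "nat \<Rightarrow> (pt \<times> pt \<Rightarrow> complex) set" where
  "scfVV \<nu> = {\<Phi>. \<exists>fs. set fs \<subseteq> scfV \<nu> \<times> scfV \<nu> \<and>
      \<Phi> = (\<lambda>(x, y). \<Sum>(f, g)\<leftarrow>fs. f x * g y)}"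

definition lin_on :: "nat \<Rightarrow> ((pt \<Rightarrow> complex) \<Rightarrow> 'b \<Rightarrow> complex) \<Rightarrow> bool" where
  "lin_on \<nu> S \<longleftrightarrow>
     (\<forall>x\<in>scfV \<nu>. \<forall>y\<in>scfV \<nu>. S (\<lambda>p. x p + y p) = (\<lambda>q. S x q + S y q)) \<and>
     (\<forall>c. \<forall>x\<in>scfV \<nu>. S (\<lambda>p. c * x p) = (\<lambda>q. c * S x q))"

definition is_interval :: "nat set \<Rightarrow> bool" where
  "is_interval B \<longleftrightarrow> (\<exists>a b. B = {a..b})"

definition conn :: "nat set \<Rightarrow> nat set set" where
  "conn A = {B. B \<noteq> {} \<and> B \<subseteq> A \<and> is_interval B \<and>
      (\<forall>C. B \<subseteq> C \<longrightarrow> C \<subseteq> A \<longrightarrow> is_interval C \<longrightarrow> C = B)}"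

definition c1 :: "nat \<Rightarrow> nat set \<Rightarrow> nat set" where
  "c1 N A = (Max ` conn A) - {N}"

definition c2 :: "nat \<Rightarrow> nat set \<Rightarrow> nat set" where
  "c2 N A = (Max ` conn ({1..N} - A)) - {N}"

definition cc :: "nat \<Rightarrow> nat set \<Rightarrow> nat set" where
  "cc N A = c1 N A \<union> c2 N A"

text \<open>The summand m_A, written for an arbitrary element Phi of Fun(Q_m) \<otimes> Fun(Q_n)
  = Fun(Q_m \<times> Q_n) (its bilinear extension); for Phi = phi \<otimes> psi it is literally
  m_A(phi, psi)(g).  Here N = m + n, g \<in> Q_N(nu).\<close>
definition mA :: "nat \<Rightarrow> nat \<Rightarrow> nat \<Rightarrow> nat set \<Rightarrow> (pt \<times> pt \<Rightarrow> complex) \<Rightarrow> nat list \<Rightarrow> complex" where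
  "mA \<nu> m n A \<Phi> g =
    (if m = 0 then \<Phi> ((0, []), (n, g))
     else if n = 0 then \<Phi> ((m, g), (0, []))
     else
       (let N = m + n;
            as = sorted_list_of_set ({1..N} - A);
            bs = sorted_list_of_set A;
            g' = (\<lambda>i. if i \<in> cc N A then 0 else gat g i)
        in (\<Prod>i\<in>c2 N A. psiv \<nu> (gat g i)) *
           (\<Phi> ((m, map g' (butlast as)), (n, map g' (butlast bs))) *
            psiv \<nu> (g' (last as)) * psiv \<nu> (g' (last bs)))))"

definition multT :: "nat \<Rightarrow> (pt \<times> pt \<Rightarrow> complex) \<Rightarrow> pt \<Rightarrow> complex" where
  "multT \<nu> \<Phi> = (\<lambda>(N, g). if g \<in> Qn \<nu> N then
      (\<Sum>n\<in>{0..N}. \<Sum>A\<in>{A. A \<subseteq> {1..N} \<and> card A = n}. mA \<nu> (N - n) n A \<Phi> g)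
      else 0)"

definition mult :: "nat \<Rightarrow> (pt \<Rightarrow> complex) \<Rightarrow> (pt \<Rightarrow> complex) \<Rightarrow> pt \<Rightarrow> complex" where
  "mult \<nu> \<phi> \<psi> = multT \<nu> (\<lambda>(x, y). \<phi> x * \<psi> y)"

definition unitV :: "pt \<Rightarrow> complex" where
  "unitV = (\<lambda>p. if p = (0, []) then 1 else 0)"

definition counitV :: "(pt \<Rightarrow> complex) \<Rightarrow> complex" where
  "counitV F = F (0, [])"

definition comult :: "nat \<Rightarrow> (pt \<Rightarrow> complex) \<Rightarrow> pt \<times> pt \<Rightarrow> complex" where
  "comult \<nu> F = (\<lambda>((k, a), (l, b)).
     if (k, a) \<in> pts \<nu> \<and> (l, b) \<in> pts \<nu> then
       (if k = 0 then F (l, b) else if l = 0 then F (k, a) else F (k + l, a @ 0 # b))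
     else 0)"

definition tens_left :: "((pt \<Rightarrow> complex) \<Rightarrow> 'b \<Rightarrow> complex) \<Rightarrow> (pt \<times> pt \<Rightarrow> complex) \<Rightarrow> 'b \<times> pt \<Rightarrow> complex" where
  "tens_left f \<Phi> = (\<lambda>(x, y). f (\<lambda>x'. \<Phi> (x', y)) x)"

definition tens_right :: "((pt \<Rightarrow> complex) \<Rightarrow> 'b \<Rightarrow> complex) \<Rightarrow> (pt \<times> pt \<Rightarrow> complex) \<Rightarrow> pt \<times> 'b \<Rightarrow> complex" where
  "tens_right f \<Phi> = (\<lambda>(x, y). f (\<lambda>y'. \<Phi> (x, y')) y)"

text \<open>(m \<otimes> m) \<circ> (id \<otimes> tau \<otimes> id) applied to Delta x \<otimes> Delta y\<close>
definition mm_twist :: "nat \<Rightarrow> (pt \<times> pt \<Rightarrow> complex) \<Rightarrow> (pt \<times> pt \<Rightarrow> complex) \<Rightarrow> pt \<times> pt \<Rightarrow> complex" where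
  "mm_twist \<nu> \<Phi> \<Psi> = (\<lambda>(u, v).
     multT \<nu> (\<lambda>(a, c). multT \<nu> (\<lambda>(b, d). \<Phi> (a, b) * \<Psi> (c, d)) v) u)"

definition hopf_scf :: "nat \<Rightarrow> bool" where
  "hopf_scf \<nu> \<longleftrightarrow>
    unitV \<in> scfV \<nu> \<and>
    (\<forall>x\<in>scfV \<nu>. \<forall>y\<in>scfV \<nu>. mult \<nu> x y \<in> scfV \<nu>) \<and>
    (\<forall>x\<in>scfV \<nu>. comult \<nu> x \<in> scfVV \<nu>) \<and>
    (\<forall>x\<in>scfV \<nu>. \<forall>y\<in>scfV \<nu>. \<forall>z\<in>scfV \<nu>. mult \<nu> (mult \<nu> x y) z = mult \<nu> x (mult \<nu> y z)) \<and>
    (\<forall>x\<in>scfV \<nu>. mult \<nu> unitV x = x \<and> mult \<nu> x unitV = x) \<and>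
    (\<forall>x\<in>scfV \<nu>. (\<lambda>(a, b, c). comult \<nu> (\<lambda>a'. comult \<nu> x (a', c)) (a, b))
                 = (\<lambda>(a, b, c). comult \<nu> (\<lambda>b'. comult \<nu> x (a, b')) (b, c))) \<and>
    (\<forall>x\<in>scfV \<nu>. (\<lambda>y. counitV (\<lambda>a. comult \<nu> x (a, y))) = x \<and>
                 (\<lambda>y. counitV (\<lambda>b. comult \<nu> x (y, b))) = x) \<and>
    (\<forall>x\<in>scfV \<nu>. \<forall>y\<in>scfV \<nu>. comult \<nu> (mult \<nu> x y) = mm_twist \<nu> (comult \<nu> x) (comult \<nu> y)) \<and>
    comult \<nu> unitV = (\<lambda>(a, b). unitV a * unitV b) \<and>
    (\<forall>x\<in>scfV \<nu>. \<forall>y\<in>scfV \<nu>. counitV (mult \<nu> x y) = counitV x * counitV y) \<and>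
    counitV unitV = 1 \<and>
    (\<exists>S. lin_on \<nu> S \<and> (\<forall>x\<in>scfV \<nu>. S x \<in> scfV \<nu>) \<and>
       (\<forall>x\<in>scfV \<nu>.
          multT \<nu> (tens_left S (comult \<nu> x)) = (\<lambda>p. counitV x * unitV p) \<and>
          multT \<nu> (tens_right S (comult \<nu> x)) = (\<lambda>p. counitV x * unitV p)))"

text \<open>Formal power series in variables x_0, x_1, ...: a coefficient function on
  exponent vectors e :: nat \<Rightarrow> nat (only finitely supported e carry coefficients).\<close>

definition fsupp :: "(nat \<Rightarrow> nat) \<Rightarrow> bool" where
  "fsupp e \<longleftrightarrow> finite {i. e i \<noteq> 0}"

definition compof :: "(nat \<Rightarrow> nat) \<Rightarrow> nat list" where
  "compof e = map e (sorted_list_of_set {i. e i \<noteq> 0})"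

definition QSym :: "((nat \<Rightarrow> nat) \<Rightarrow> complex) set" where
  "QSym = {f. (\<forall>e. f e \<noteq> 0 \<longrightarrow> fsupp e) \<and>
      (\<exists>d. \<forall>e. f e \<noteq> 0 \<longrightarrow> (\<Sum>i\<in>{i. e i \<noteq> 0}. e i) \<le> d) \<and>
      (\<forall>e e'. fsupp e \<longrightarrow> fsupp e' \<longrightarrow> compof e = compof e' \<longrightarrow> f e = f e')}"

definition qmult :: "((nat \<Rightarrow> nat) \<Rightarrow> complex) \<Rightarrow> ((nat \<Rightarrow> nat) \<Rightarrow> complex) \<Rightarrow> (nat \<Rightarrow> nat) \<Rightarrow> complex" where
  "qmult f g = (\<lambda>e. \<Sum>e1\<in>{e1. \<forall>i. e1 i \<le> e i}. f e1 * g (\<lambda>i. e i - e1 i))"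

definition qunit :: "(nat \<Rightarrow> nat) \<Rightarrow> complex" where
  "qunit = (\<lambda>e. if e = (\<lambda>_. 0) then 1 else 0)"

definition qcounit :: "((nat \<Rightarrow> nat) \<Rightarrow> complex) \<Rightarrow> complex" where
  "qcounit f = f (\<lambda>_. 0)"

definition is_comp :: "nat list \<Rightarrow> bool" where
  "is_comp \<alpha> \<longleftrightarrow> (\<forall>a\<in>set \<alpha>. 0 < a)"

text \<open>the monomial x_0^{a_1} x_1^{a_2} ... ; for a quasisymmetric f and a composition
  alpha, f (mono alpha) is the coefficient of M_alpha in f\<close>
definition mono :: "nat list \<Rightarrow> nat \<Rightarrow> nat" where
  "mono \<alpha> = (\<lambda>i. if i < length \<alpha> then \<alpha> ! i else 0)"

definition Mfun :: "nat list \<Rightarrow> (nat \<Rightarrow> nat) \<Rightarrow> complex" where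
  "Mfun \<alpha> = (\<lambda>e. if fsupp e \<and> compof e = \<alpha> then 1 else 0)"

text \<open>QSym \<otimes> QSym is represented by coefficient functions c(beta, gamma) on pairs
  of compositions (the element sum c(beta,gamma) M_beta \<otimes> M_gamma).
  Coproduct: Delta M_alpha = sum over beta.gamma = alpha of M_beta \<otimes> M_gamma.\<close>
definition qcomult :: "((nat \<Rightarrow> nat) \<Rightarrow> complex) \<Rightarrow> nat list \<times> nat list \<Rightarrow> complex" where
  "qcomult f = (\<lambda>(\<beta>, \<gamma>). if is_comp \<beta> \<and> is_comp \<gamma> then f (mono (\<beta> @ \<gamma>)) else 0)"

definition compI :: "nat \<Rightarrow> nat set \<Rightarrow> nat list" where
  "compI n J = (if n = 0 then [] else
     (let s = sorted_list_of_set J in map2 (\<lambda>a b. b - a) (0 # s) (s @ [n])))"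

definition Lfun :: "nat \<Rightarrow> nat set \<Rightarrow> (nat \<Rightarrow> nat) \<Rightarrow> complex" where
  "Lfun n I = (\<lambda>e. \<Sum>J\<in>{J. I \<subseteq> J \<and> J \<subseteq> {1..n-1}}. Mfun (compI n J) e)"

definition chidx :: "(nat \<times> nat set) set" where
  "chidx = {(n, I). I \<subseteq> {1..n-1}}"

definition chcoef :: "nat \<Rightarrow> (pt \<Rightarrow> complex) \<Rightarrow> nat \<times> nat set \<Rightarrow> complex" where
  "chcoef \<nu> F = (THE c. (\<forall>q. c q \<noteq> 0 \<longrightarrow> q \<in> chidx) \<and> finite {q. c q \<noteq> 0} \<and>
      F = (\<lambda>p. \<Sum>q\<in>{q. c q \<noteq> 0}. c q * chi \<nu> (fst q) (snd q) p))"

definition ch :: "nat \<Rightarrow> (pt \<Rightarrow> complex) \<Rightarrow> (nat \<Rightarrow> nat) \<Rightarrow> complex" where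
  "ch \<nu> F = (\<lambda>e. \<Sum>q\<in>{q. chcoef \<nu> F q \<noteq> 0}. chcoef \<nu> F q * Lfun (fst q) (snd q) e)"

text \<open>ch \<otimes> ch : V \<otimes> V \<rightarrow> QSym \<otimes> QSym (in M \<otimes> M coordinates)\<close>
definition chT :: "nat \<Rightarrow> (pt \<times> pt \<Rightarrow> complex) \<Rightarrow> nat list \<times> nat list \<Rightarrow> complex" where
  "chT \<nu> \<Phi> = (\<lambda>(\<beta>, \<gamma>). if is_comp \<beta> \<and> is_comp \<gamma> then
      ch \<nu> (\<lambda>x. ch \<nu> (\<lambda>y. \<Phi> (x, y)) (mono \<gamma>)) (mono \<beta>) else 0)"

end

theory Submission
  imports Defs
begin

text \<open>Append a last entry 0 to g in Q_n, for n \<ge> 1, and encode the only element of Q_0 by the empty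
  list. In this encoding the coproduct is dual to concatenation, F \<mapsto> F (x @ y), and the product becomes
  a sum over all words in two letters (which positions lie in A) that can be processed from left to
  right. Cutting a word at an entry 0 gives the bialgebra axiom, words in three letters give
  associativity, and Takeuchi's formula gives the antipode.

  The coefficient of M_alpha in ch F is obtained from F by evaluating at 0 the positions that are
  partial sums of alpha and applying f \<mapsto> (f 0 - f 1) / (1 - q), with q = -1/(nu - 1), to the others.
  This functional sends 1 to 0 and psi to 1, so inside a block of alpha only words in which all
  positions outside A precede those in A survive. Hence the product is sent to the product of power
  series, and ch is bijective because these functionals form a basis of the dual.\<close>

section \<open>Shuffle sums\<close>

text \<open>The definition of the product singles out the changes of side, the last positions of A
  and of its complement, and position m + n. With a final 0 stored in the word one rule covers them
  all: a position followed by a position on the other side is cleared, every other letter is kept. A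
  letter 0 is immune to this rule, since clearing does not alter it and its weight is psi(0) = 1, so
  the sides before and after it are chosen independently. The sums are therefore studied for any
  weight \<open>p\<close>, with \<open>p 0 = 1\<close> where a letter is cleared twice or a word is
  cut. The divisor 1 - q comes from the characteristic map. A change from A to its complement clears
  a letter without a weight, so the summand is constant in that letter and the difference of the
  values at 0 and 1 removes it. A change into A leaves only the weight, and (p 0 - p 1) / (1 - q) =
  1. Superclass functions see only which letters vanish. Hence words in 0 and 1 determine them, and
  closure of \<open>scfV\<close> under the operations is obtained by running the same sum on two
  words related letter by letter.\<close>

text \<open>The flag c tells whether the first position lies in A. A change of side after an entry h replaces
  h by 0; a change into A contributes the weight p h.\<close>

primrec shuf :: "(nat \<Rightarrow> complex) \<Rightarrow> bool \<Rightarrow> nat list \<Rightarrow> (nat list \<Rightarrow> nat list \<Rightarrow> complex) \<Rightarrow> complex" where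
  "shuf p c [] \<Phi> = 0"
| "shuf p c (h # hs) \<Phi> =
    (if hs = [] then (if c then \<Phi> [] [h] else \<Phi> [h] [])
     else if c then shuf p True hs (\<lambda>x y. \<Phi> x (h # y)) + shuf p False hs (\<lambda>x y. \<Phi> x (0 # y))
     else shuf p False hs (\<lambda>x y. \<Phi> (h # x) y) + p h * shuf p True hs (\<lambda>x y. \<Phi> (0 # x) y))"

definition shsum :: "(nat \<Rightarrow> complex) \<Rightarrow> nat list \<Rightarrow> (nat list \<Rightarrow> nat list \<Rightarrow> complex) \<Rightarrow> complex" where
  "shsum p h \<Phi> = (if h = [] then \<Phi> [] [] else shuf p True h \<Phi> + shuf p False h \<Phi>)"

text \<open>Encodings of points have this form: a closing 0, or no letter at all in degree
  0.\<close>

definition lz :: "nat list \<Rightarrow> bool" where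
  "lz l \<longleftrightarrow> l = [] \<or> last l = 0"

lemma lz_append: "lz u \<Longrightarrow> lz v \<Longrightarrow> lz (u @ v)"
  by (cases "v = []") (auto simp: lz_def)

text \<open>Relational congruence: clearing introduces 0, so \<open>R\<close> has to relate 0 to
  itself. Equality restricted to suitable letters gives congruence rules, and equality of vanishing
  gives invariance on superclasses. The information on \<open>lz\<close> holds because the last
  letter of either part is the last letter of \<open>h\<close> or a cleared one; the nonempty part
  is the one that receives the first letter.\<close>

lemma shuf_rel:
  assumes "\<And>a b. R a b \<Longrightarrow> p a = p b" "R 0 0"
  assumes "list_all2 R h h'" "h \<noteq> []"
    "\<And>u v u' v'. list_all2 R u u' \<Longrightarrow> list_all2 R v v' \<Longrightarrow> length u + length v = length h
      \<Longrightarrow> (lz h \<Longrightarrow> lz u \<and> lz v) \<Longrightarrow> (if c then v \<noteq> [] else u \<noteq> []) \<Longrightarrow> \<Phi> u v = \<Psi> u' v'"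
  shows "shuf p c h \<Phi> = shuf p c h' \<Psi>"
  using assms(3-)
proof (induction h arbitrary: h' c \<Phi> \<Psi>)
  case Nil
  then show ?case by simp
next
  case (Cons a h)
  obtain b k where h': "h' = b # k" and ab: "R a b" and hk: "list_all2 R h k"
    using Cons.prems(1) by (auto simp: list_all2_Cons1)
  show ?case
  proof (cases "h = []")
    case True
    then show ?thesis using Cons.prems(3)[of "[]" "[]" "[a]" "[b]"] Cons.prems(3)[of "[a]" "[b]" "[]" "[]"] hk ab
      by (cases c) (auto simp: h' lz_def)
  next
    case False
    then have k: "k \<noteq> []" using hk by auto
    have pab: "p a = p b" using assms(1) ab by auto
    have lzc: "lz (a # h) = lz h" using False by (simp add: lz_def)
    have lz0: "lz u \<Longrightarrow> lz (0 # u)" for u by (auto simp: lz_def)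
    have lzh: "lz u \<Longrightarrow> u \<noteq> [] \<Longrightarrow> lz (a # u)" for u by (auto simp: lz_def)
    note IH = Cons.IH[OF hk False]
    show ?thesis
    proof (cases c)
      case True
      have 1: "shuf p True h (\<lambda>x y. \<Phi> x (a # y)) = shuf p True k (\<lambda>x y. \<Psi> x (b # y))"
        by (rule IH) (rule Cons.prems(3), auto simp: ab True lzc lzh)
      have 2: "shuf p False h (\<lambda>x y. \<Phi> x (0 # y)) = shuf p False k (\<lambda>x y. \<Psi> x (0 # y))"
        by (rule IH) (rule Cons.prems(3), auto simp: assms(2) True lzc lz0)
      show ?thesis using 1 2 True False k h' by simp
    next
      case False2: False
      have 1: "shuf p False h (\<lambda>x y. \<Phi> (a # x) y) = shuf p False k (\<lambda>x y. \<Psi> (b # x) y)"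
        by (rule IH) (rule Cons.prems(3), auto simp: ab False2 lzc lzh)
      have 2: "shuf p True h (\<lambda>x y. \<Phi> (0 # x) y) = shuf p True k (\<lambda>x y. \<Psi> (0 # x) y)"
        by (rule IH) (rule Cons.prems(3), auto simp: assms(2) False2 lzc lz0)
      show ?thesis using 1 2 False2 False k h' pab by simp
    qed
  qed
qed

lemma shsum_rel:
  assumes "\<And>a b. R a b \<Longrightarrow> p a = p b" "R 0 0" "list_all2 R h h'"
    "\<And>u v u' v'. list_all2 R u u' \<Longrightarrow> list_all2 R v v' \<Longrightarrow> length u + length v = length h
      \<Longrightarrow> (lz h \<Longrightarrow> lz u \<and> lz v) \<Longrightarrow> \<Phi> u v = \<Psi> u' v'"
  shows "shsum p h \<Phi> = shsum p h' \<Psi>"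
proof (cases "h = []")
  case True
  then show ?thesis using assms(3) assms(4)[of "[]" "[]" "[]" "[]"] by (auto simp: shsum_def lz_def)
next
  case False
  then have "h' \<noteq> []" using assms(3) by auto
  moreover have "shuf p c h \<Phi> = shuf p c h' \<Psi>" for c
    by (rule shuf_rel[of R, OF assms(1,2,3) False]; (rule assms(4); blast)?)
  ultimately show ?thesis using False by (simp add: shsum_def)
qed

lemma shuf_cong:
  assumes "\<And>u v. length u + length v = length h \<Longrightarrow> (if c then v \<noteq> [] else u \<noteq> []) \<Longrightarrow> \<Phi> u v = \<Psi> u v"
  shows "shuf p c h \<Phi> = shuf p c h \<Psi>"
proof (cases "h = []")
  case False
  show ?thesis
    by (rule shuf_rel[of "(=)"]) (use assms False in \<open>auto simp: list.rel_eq\<close>)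
qed auto

text \<open>The relation is equality on 0 and the letters of \<open>h\<close>, the only letters that
  can occur in the parts.\<close>

lemma shsum_cong:
  assumes "\<And>u v. length u + length v = length h \<Longrightarrow> (lz h \<Longrightarrow> lz u \<and> lz v)
    \<Longrightarrow> set u \<subseteq> insert 0 (set h) \<Longrightarrow> set v \<subseteq> insert 0 (set h) \<Longrightarrow> \<Phi> u v = \<Psi> u v"
  shows "shsum p h \<Phi> = shsum p h \<Psi>"
proof -
  let ?R = "\<lambda>a b. a = b \<and> a \<in> insert 0 (set h)"
  have R: "list_all2 ?R u u' \<longleftrightarrow> u = u' \<and> set u \<subseteq> insert 0 (set h)" for u u'
    by (induction u arbitrary: u') (auto simp: list_all2_Cons1)
  show ?thesis
    by (rule shsum_rel[of ?R]) (use assms in \<open>auto simp: R simp del: insert_iff\<close>)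
qed

lemma shuf_add: "shuf p c h (\<lambda>x y. \<Phi> x y + \<Psi> x y) = shuf p c h \<Phi> + shuf p c h \<Psi>"
  by (induction h arbitrary: c \<Phi> \<Psi>) (auto simp: algebra_simps)

lemma shuf_cmult: "shuf p c h (\<lambda>x y. k * \<Phi> x y) = k * shuf p c h \<Phi>"
  by (induction h arbitrary: c \<Phi>) (auto simp: algebra_simps)

lemma shsum_add: "shsum p h (\<lambda>x y. \<Phi> x y + \<Psi> x y) = shsum p h \<Phi> + shsum p h \<Psi>"
  by (simp add: shsum_def shuf_add)

lemma shsum_cmult: "shsum p h (\<lambda>x y. k * \<Phi> x y) = k * shsum p h \<Phi>"
  by (simp add: shsum_def shuf_cmult algebra_simps)

lemma shsum_cmult_right: "shsum p h (\<lambda>x y. \<Phi> x y * k) = shsum p h \<Phi> * k"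
  using shsum_cmult[of p h k \<Phi>] by (simp add: mult.commute)

lemma shuf_0 [simp]: "shuf p c h (\<lambda>x y. 0) = 0"
  using shuf_cmult[of p c h 0] by simp

lemma shsum_0 [simp]: "shsum p h (\<lambda>x y. 0) = 0"
  using shsum_cmult[of p h 0] by simp

lemma shsum_sum: "shsum p h (\<lambda>x y. \<Sum>i\<in>I. \<Phi> i x y) = (\<Sum>i\<in>I. shsum p h (\<Phi> i))"
  by (induction I rule: infinite_finite_induct) (simp_all add: shsum_add)

text \<open>After a letter 0 both continuations have weight 1 and leave the letter 0, so the side of
  the next position is free.\<close>

lemma shuf_False_0: "p 0 = 1 \<Longrightarrow> shuf p False (0 # x) \<Phi> = shsum p x (\<lambda>a b. \<Phi> (0 # a) b)"
  by (simp add: shsum_def)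

lemma shuf_True_0: "shuf p True (0 # x) \<Phi> = shsum p x (\<lambda>a b. \<Phi> a (0 # b))"
  by (simp add: shsum_def)

text \<open>An empty first part forces every position into A. That word has no change of side, so
  \<open>h\<close> comes back whole and without a weight.\<close>

lemma shsum_unit_left: "shsum p h (\<lambda>x y. if x = [] then \<Psi> y else 0) = \<Psi> h"
proof -
  have 1: "shuf p False h (\<lambda>x y. if x = [] then \<Psi> y else 0) = 0" for \<Psi>
    using shuf_cong[of h False "\<lambda>x y. if x = [] then \<Psi> y else 0" "\<lambda>x y. 0" p] by simp
  have "h \<noteq> [] \<Longrightarrow> shuf p True h (\<lambda>x y. if x = [] then \<Psi> y else 0) = \<Psi> h"
  proof (induction h arbitrary: \<Psi>)
    case (Cons a h)
    have "shuf p False h (\<lambda>x y. if x = [] then \<Psi> (0 # y) else 0) = 0"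
      using shuf_cong[of h False "\<lambda>x y. if x = [] then \<Psi> (0#y) else 0" "\<lambda>x y. 0" p] by simp
    then show ?case using Cons.IH[of "\<lambda>y. \<Psi> (a # y)"] by auto
  qed auto
  then show ?thesis using 1 by (auto simp: shsum_def)
qed

lemma shsum_unit_right: "shsum p h (\<lambda>x y. if y = [] then \<Psi> x else 0) = \<Psi> h"
proof -
  have 1: "shuf p True h (\<lambda>x y. if y = [] then \<Psi> x else 0) = 0" for \<Psi>
    using shuf_cong[of h True "\<lambda>x y. if y = [] then \<Psi> x else 0" "\<lambda>x y. 0" p] by simp
  have "h \<noteq> [] \<Longrightarrow> shuf p False h (\<lambda>x y. if y = [] then \<Psi> x else 0) = \<Psi> h"
  proof (induction h arbitrary: \<Psi>)
    case (Cons a h)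
    have "shuf p True h (\<lambda>x y. if y = [] then \<Psi> (0 # x) else 0) = 0"
      using shuf_cong[of h True "\<lambda>x y. if y = [] then \<Psi> (0#x) else 0" "\<lambda>x y. 0" p] by simp
    then show ?case using Cons.IH[of "\<lambda>y. \<Psi> (a # y)"] by auto
  qed auto
  then show ?thesis using 1 by (auto simp: shsum_def)
qed

text \<open>The induction runs over the letters before the 0. The 0 itself is the base case, in
  which the side of the following letter becomes free.\<close>

lemma shuf_append:
  assumes "p 0 = 1"
  shows "shuf p c (h @ 0 # k) \<Phi> = shuf p c (h @ [0]) (\<lambda>u v. shsum p k (\<lambda>u' v'. \<Phi> (u @ u') (v @ v')))"
proof (induction h arbitrary: c \<Phi>)
  case Nil
  then show ?case using assms by (cases c) (simp_all add: shsum_def)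
qed simp

lemma shsum_append:
  assumes "p 0 = 1" "lz h"
  shows "shsum p (h @ k) \<Phi> = shsum p h (\<lambda>u v. shsum p k (\<lambda>u' v'. \<Phi> (u @ u') (v @ v')))"
proof (cases "h = []")
  case False
  then obtain h' where "h = h' @ [0]" using assms(2) by (metis append_butlast_last_id lz_def)
  then show ?thesis using shuf_append[of p, OF assms(1)] by (simp add: shsum_def)
qed (simp add: shsum_def)

text \<open>Sums over words in three letters, to which both bracketings of a triple product reduce.\<close>

primrec shuf3 :: "(nat \<Rightarrow> complex) \<Rightarrow> nat \<Rightarrow> nat list \<Rightarrow> (nat list \<Rightarrow> nat list \<Rightarrow> nat list \<Rightarrow> complex) \<Rightarrow> complex" where
  "shuf3 p c [] \<Psi> = 0"
| "shuf3 p c (h # hs) \<Psi> =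
    (if hs = [] then (if c = 0 then \<Psi> [h] [] [] else if c = 1 then \<Psi> [] [h] [] else \<Psi> [] [] [h])
     else if c = 0 then shuf3 p 0 hs (\<lambda>x y z. \<Psi> (h # x) y z) + p h * shuf3 p 1 hs (\<lambda>x y z. \<Psi> (0 # x) y z)
        + p h * shuf3 p 2 hs (\<lambda>x y z. \<Psi> (0 # x) y z)
     else if c = 1 then shuf3 p 0 hs (\<lambda>x y z. \<Psi> x (0 # y) z) + shuf3 p 1 hs (\<lambda>x y z. \<Psi> x (h # y) z)
        + p h * shuf3 p 2 hs (\<lambda>x y z. \<Psi> x (0 # y) z)
     else shuf3 p 0 hs (\<lambda>x y z. \<Psi> x y (0 # z)) + shuf3 p 1 hs (\<lambda>x y z. \<Psi> x y (0 # z))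
        + shuf3 p 2 hs (\<lambda>x y z. \<Psi> x y (h # z)))"

text \<open>The outer sum separates the letter 2 from 0 and 1, the inner sum separates 0 from 1; in
  \<open>shuf3\<close> exactly the ascents carry a weight. A position of letter 0 or 1 before a 2 is
  weighted and cleared by the outer sum, so the inner sum finds an entry 0 there and adds no further
  weight. A word that starts with 2 leaves the first inner letter open, whence \<open>shsum\<close>
  in the third clause.\<close>

lemma shuf3_left:
  assumes p: "p 0 = 1"
  assumes "h \<noteq> []"
  shows "shuf p False h (\<lambda>x y. shuf p False x (\<lambda>a b. \<Psi> a b y)) = shuf3 p 0 h \<Psi>
    \<and> shuf p False h (\<lambda>x y. shuf p True x (\<lambda>a b. \<Psi> a b y)) = shuf3 p 1 h \<Psi>
    \<and> shuf p True h (\<lambda>x y. shsum p x (\<lambda>a b. \<Psi> a b y)) = shuf3 p 2 h \<Psi>"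
  using assms(2)
proof (induction h arbitrary: \<Psi>)
  case (Cons h hs)
  show ?case
  proof (cases "hs = []")
    case True
    then show ?thesis by (simp add: shsum_def)
  next
    case False
    note IH = Cons.IH[OF False]
    have I0: "shuf p False hs (\<lambda>x y. shuf p False x (\<lambda>a b. \<Psi> a b y)) = shuf3 p 0 hs \<Psi>" for \<Psi> using IH by blast
    have I1: "shuf p False hs (\<lambda>x y. shuf p True x (\<lambda>a b. \<Psi> a b y)) = shuf3 p 1 hs \<Psi>" for \<Psi> using IH by blast
    have I2: "shuf p True hs (\<lambda>x y. shsum p x (\<lambda>a b. \<Psi> a b y)) = shuf3 p 2 hs \<Psi>" for \<Psi> using IH by blast
    have I01: "shuf p False hs (\<lambda>x y. shsum p x (\<lambda>a b. \<Psi> a b y)) = shuf3 p 0 hs \<Psi> + shuf3 p 1 hs \<Psi>" for \<Psi>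
    proof -
      have "shuf p False hs (\<lambda>x y. shsum p x (\<lambda>a b. \<Psi> a b y))
        = shuf p False hs (\<lambda>x y. shuf p False x (\<lambda>a b. \<Psi> a b y) + shuf p True x (\<lambda>a b. \<Psi> a b y))"
        by (rule shuf_cong) (simp add: shsum_def)
      then show ?thesis by (simp add: shuf_add I0 I1)
    qed
    have A: "shuf p False hs (\<lambda>x y. shuf p False (h # x) (\<lambda>a b. \<Psi> a b y))
       = shuf3 p 0 hs (\<lambda>x y z. \<Psi> (h # x) y z) + p h * shuf3 p 1 hs (\<lambda>x y z. \<Psi> (0 # x) y z)"
    proof -
      have "shuf p False hs (\<lambda>x y. shuf p False (h # x) (\<lambda>a b. \<Psi> a b y))
        = shuf p False hs (\<lambda>x y. shuf p False x (\<lambda>a b. \<Psi> (h # a) b y) + p h * shuf p True x (\<lambda>a b. \<Psi> (0 # a) b y))"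
        by (rule shuf_cong) simp
      then show ?thesis by (simp add: shuf_add shuf_cmult I0 I1)
    qed
    have B: "shuf p False hs (\<lambda>x y. shuf p True (h # x) (\<lambda>a b. \<Psi> a b y))
       = shuf3 p 1 hs (\<lambda>x y z. \<Psi> x (h # y) z) + shuf3 p 0 hs (\<lambda>x y z. \<Psi> x (0 # y) z)"
    proof -
      have "shuf p False hs (\<lambda>x y. shuf p True (h # x) (\<lambda>a b. \<Psi> a b y))
        = shuf p False hs (\<lambda>x y. shuf p True x (\<lambda>a b. \<Psi> a (h # b) y) + shuf p False x (\<lambda>a b. \<Psi> a (0 # b) y))"
        by (rule shuf_cong) simp
      then show ?thesis by (simp add: shuf_add I0 I1)
    qed
    show ?thesis
      using False by (simp add: A B I01 I2 shuf_False_0[of p, OF p] shuf_True_0 del: shuf.simps(2)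
        add: shuf.simps(2)[of p _ h hs])
  qed
qed simp

text \<open>Mirror image: the outer sum separates 0 from 1 and 2. A position of letter 1 or 2 before
  a 0 is cleared without a weight, and an inner change after it then has weight
  \<open>p 0 = 1\<close>.\<close>

lemma shuf3_right:
  assumes p: "p 0 = 1"
  assumes "h \<noteq> []"
  shows "shuf p False h (\<lambda>x y. shsum p y (\<Psi> x)) = shuf3 p 0 h \<Psi>
    \<and> shuf p True h (\<lambda>x y. shuf p False y (\<Psi> x)) = shuf3 p 1 h \<Psi>
    \<and> shuf p True h (\<lambda>x y. shuf p True y (\<Psi> x)) = shuf3 p 2 h \<Psi>"
  using assms(2)
proof (induction h arbitrary: \<Psi>)
  case (Cons h hs)
  show ?case
  proof (cases "hs = []")
    case True
    then show ?thesis by (simp add: shsum_def)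
  next
    case False
    note IH = Cons.IH[OF False]
    have I0: "shuf p False hs (\<lambda>x y. shsum p y (\<Psi> x)) = shuf3 p 0 hs \<Psi>" for \<Psi> using IH by blast
    have I1: "shuf p True hs (\<lambda>x y. shuf p False y (\<Psi> x)) = shuf3 p 1 hs \<Psi>" for \<Psi> using IH by blast
    have I2: "shuf p True hs (\<lambda>x y. shuf p True y (\<Psi> x)) = shuf3 p 2 hs \<Psi>" for \<Psi> using IH by blast
    have I12: "shuf p True hs (\<lambda>x y. shsum p y (\<Psi> x)) = shuf3 p 1 hs \<Psi> + shuf3 p 2 hs \<Psi>" for \<Psi>
    proof -
      have "shuf p True hs (\<lambda>x y. shsum p y (\<Psi> x))
        = shuf p True hs (\<lambda>x y. shuf p False y (\<Psi> x) + shuf p True y (\<Psi> x))"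
        by (rule shuf_cong) (simp add: shsum_def)
      then show ?thesis by (simp add: shuf_add I1 I2)
    qed
    have A: "shuf p True hs (\<lambda>x y. shuf p False (h # y) (\<Psi> x))
       = shuf3 p 1 hs (\<lambda>x y z. \<Psi> x (h # y) z) + p h * shuf3 p 2 hs (\<lambda>x y z. \<Psi> x (0 # y) z)"
    proof -
      have "shuf p True hs (\<lambda>x y. shuf p False (h # y) (\<Psi> x))
        = shuf p True hs (\<lambda>x y. shuf p False y (\<lambda>a b. \<Psi> x (h # a) b) + p h * shuf p True y (\<lambda>a b. \<Psi> x (0 # a) b))"
        by (rule shuf_cong) simp
      then show ?thesis by (simp add: shuf_add shuf_cmult I1[of "\<lambda>x y z. \<Psi> x (h # y) z"] I2[of "\<lambda>x y z. \<Psi> x (0 # y) z"])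
    qed
    have B: "shuf p True hs (\<lambda>x y. shuf p True (h # y) (\<Psi> x))
       = shuf3 p 2 hs (\<lambda>x y z. \<Psi> x y (h # z)) + shuf3 p 1 hs (\<lambda>x y z. \<Psi> x y (0 # z))"
    proof -
      have "shuf p True hs (\<lambda>x y. shuf p True (h # y) (\<Psi> x))
        = shuf p True hs (\<lambda>x y. shuf p True y (\<lambda>a b. \<Psi> x a (h # b)) + shuf p False y (\<lambda>a b. \<Psi> x a (0 # b)))"
        by (rule shuf_cong) simp
      then show ?thesis by (simp add: shuf_add I2[of "\<lambda>x y z. \<Psi> x y (h # z)"] I1[of "\<lambda>x y z. \<Psi> x y (0 # z)"])
    qed
    show ?thesis
      using False by (simp add: A B I12 I0[of "\<lambda>x. \<Psi> (h # x)"] I0[of "\<lambda>x y z. \<Psi> x (0 # y) z"]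
        I0[of "\<lambda>x y z. \<Psi> x y (0 # z)"] I12[of "\<lambda>x. \<Psi> (0 # x)"] shuf_False_0[of p, OF p] shuf_True_0 algebra_simps
        del: shuf.simps(2) add: shuf.simps(2)[of p _ h hs])
  qed
qed simp

lemma shsum_assoc:
  assumes p: "p 0 = 1"
  shows "shsum p h (\<lambda>x y. shsum p x (\<lambda>a b. \<Psi> a b y)) = shsum p h (\<lambda>x y. shsum p y (\<Psi> x))"
proof (cases "h = []")
  case False
  have "shuf p False h (\<lambda>x y. shsum p x (\<lambda>a b. \<Psi> a b y))
      = shuf p False h (\<lambda>x y. shuf p False x (\<lambda>a b. \<Psi> a b y) + shuf p True x (\<lambda>a b. \<Psi> a b y))"
    by (rule shuf_cong) (simp add: shsum_def)
  moreover have "shuf p True h (\<lambda>x y. shsum p y (\<Psi> x))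
      = shuf p True h (\<lambda>x y. shuf p False y (\<Psi> x) + shuf p True y (\<Psi> x))"
    by (rule shuf_cong) (simp add: shsum_def)
  ultimately show ?thesis
    using shuf3_left[of p h \<Psi>, OF p False] shuf3_right[of p h \<Psi>, OF p False] False
    by (simp add: shsum_def[of p h] shuf_add)
qed (simp add: shsum_def)

section \<open>Convolution and the antipode\<close>

text \<open>An operator f \<mapsto> U f on functions is stored as h \<mapsto> f \<mapsto> (U f) h.\<close>

type_synonym oper = "nat list \<Rightarrow> (nat list \<Rightarrow> complex) \<Rightarrow> complex"

text \<open>This is m (U tensor V) Delta: the coproduct turns f into (u, v) \<mapsto>
  \<open>f (u @ v)\<close>, the operators act on the two variables, and the product takes the value
  at h. Storing operators as functionals at a word turns tensor products of operators into
  nesting.\<close>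

definition convol :: "(nat \<Rightarrow> complex) \<Rightarrow> oper \<Rightarrow> oper \<Rightarrow> oper" where
  "convol p U V = (\<lambda>h f. shsum p h (\<lambda>x y. U x (\<lambda>u. V y (\<lambda>v. f (u @ v)))))"

definition op_lin :: "oper \<Rightarrow> bool" where
  "op_lin U \<longleftrightarrow> (\<forall>h f g. U h (\<lambda>l. f l + g l) = U h f + U h g) \<and> (\<forall>h c f. U h (\<lambda>l. c * f l) = c * U h f)"

text \<open>\<open>op_eval\<close> is the identity, \<open>op_eps\<close> the unit of convolution
  (unit after counit), and \<open>op_aug\<close> their difference, the projection to positive
  degree.\<close>

definition op_eval :: oper where "op_eval h f = f h"

definition op_eps :: oper where "op_eps h f = (if h = [] then f [] else 0)"

definition op_aug :: oper where "op_aug h f = (if h = [] then 0 else f h)"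

lemma op_eval_split: "op_eval h f = op_aug h f + op_eps h f"
  by (simp add: op_eval_def op_aug_def op_eps_def)

lemma op_lin_0:
  assumes "op_lin U"
  shows "U h (\<lambda>l. 0) = 0"
  using assms[unfolded op_lin_def, THEN conjunct2, rule_format, of h 0 "\<lambda>l. 0"] by simp

text \<open>\<open>shuf\<close> is a finite linear combination of values of its argument, with
  coefficients and words that depend on \<open>k\<close> alone.\<close>

lemma op_lin_shuf:
  assumes "op_lin U"
  shows "U h (\<lambda>l. shuf p c k (\<Phi> l)) = shuf p c k (\<lambda>x y. U h (\<lambda>l. \<Phi> l x y))"
proof (induction k arbitrary: c \<Phi>)
  case Nil
  show ?case using op_lin_0[OF assms] by simp
qed (use assms in \<open>auto simp: op_lin_def\<close>)

lemma op_lin_shsum: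
  assumes "op_lin U"
  shows "U h (\<lambda>l. shsum p k (\<Phi> l)) = shsum p k (\<lambda>x y. U h (\<lambda>l. \<Phi> l x y))"
proof (cases "k = []")
  case False
  have "U h (\<lambda>l. shuf p True k (\<Phi> l) + shuf p False k (\<Phi> l))
    = U h (\<lambda>l. shuf p True k (\<Phi> l)) + U h (\<lambda>l. shuf p False k (\<Phi> l))"
    by (rule assms[unfolded op_lin_def, THEN conjunct1, rule_format])
  then show ?thesis using False by (simp add: shsum_def op_lin_shuf[OF assms])
qed (simp add: shsum_def)

text \<open>Coassociativity is associativity of \<open>@\<close>, and associativity of the product
  is \<open>shsum_assoc\<close>. Linearity of \<open>U\<close> serves to pull the inner sum through
  it.\<close>

lemma convol_assoc:
  assumes "p 0 = 1" "op_lin U"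
  shows "convol p (convol p U V) W = convol p U (convol p V W)"
proof (intro ext)
  fix h f
  have "convol p (convol p U V) W h f
    = shsum p h (\<lambda>x y. shsum p x (\<lambda>a b. U a (\<lambda>u. V b (\<lambda>v. W y (\<lambda>w. f ((u @ v) @ w))))))"
    by (simp add: convol_def)
  also have "\<dots> = shsum p h (\<lambda>a z. shsum p z (\<lambda>b y. U a (\<lambda>u. V b (\<lambda>v. W y (\<lambda>w. f ((u @ v) @ w))))))"
    by (rule shsum_assoc[of p, OF assms(1)])
  also have "\<dots> = convol p U (convol p V W) h f"
    by (simp add: convol_def op_lin_shsum[OF assms(2)])
  finally show "convol p (convol p U V) W h f = convol p U (convol p V W) h f" .
qed

lemma convol_eps_left: "convol p op_eps V = V"
  by (intro ext) (simp add: convol_def op_eps_def shsum_unit_left)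

lemma convol_eps_right:
  assumes "op_lin U"
  shows "convol p U op_eps = U"
proof (intro ext)
  fix h f
  have "(\<lambda>x y. U x (\<lambda>u. op_eps y (\<lambda>v. f (u @ v)))) = (\<lambda>x y. if y = [] then U x f else 0)"
    by (intro ext) (simp add: op_eps_def op_lin_0[OF assms])
  then show "convol p U op_eps h f = U h f" by (simp add: convol_def shsum_unit_right)
qed

lemma op_lin_convol:
  assumes "op_lin U" "op_lin V"
  shows "op_lin (convol p U V)"
  using assms unfolding op_lin_def convol_def by (simp add: shsum_add shsum_cmult)

lemma op_lin_eps: "op_lin op_eps" by (simp add: op_lin_def op_eps_def)
lemma op_lin_aug: "op_lin op_aug" by (simp add: op_lin_def op_aug_def)

primrec aug_pow :: "(nat \<Rightarrow> complex) \<Rightarrow> nat \<Rightarrow> oper" where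
  "aug_pow p 0 = op_eps"
| "aug_pow p (Suc k) = convol p op_aug (aug_pow p k)"

lemma op_lin_aug_pow: "op_lin (aug_pow p k)"
  by (induction k) (simp_all add: op_lin_eps op_lin_aug op_lin_convol)

text \<open>The recursion for \<open>aug_pow\<close> multiplies on the left; the proof of the left
  inverse needs the new factor on the right.\<close>

lemma aug_pow_commute:
  assumes "p 0 = 1"
  shows "convol p (aug_pow p k) op_aug = aug_pow p (Suc k)"
proof (induction k)
  case 0
  then show ?case by (simp add: convol_eps_left convol_eps_right op_lin_aug)
next
  case (Suc k)
  then show ?case using convol_assoc[of p, OF assms op_lin_aug] by simp
qed

text \<open>Each factor \<open>op_aug\<close> consumes at least one letter. This local nilpotency
  makes the geometric series for the inverse finite on every word.\<close>

lemma aug_pow_eq_0: "length h < k \<Longrightarrow> aug_pow p k h f = 0"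
proof (induction k arbitrary: h f)
  case (Suc k)
  have "aug_pow p (Suc k) h f = shsum p h (\<lambda>x y. 0)"
    unfolding aug_pow.simps convol_def
  proof (rule shsum_cong)
    fix x y :: "nat list"
    assume "length x + length y = length h"
    then have "x \<noteq> [] \<Longrightarrow> length y < k" using Suc.prems by (cases x) auto
    then show "op_aug x (\<lambda>u. aug_pow p k y (\<lambda>v. f (u @ v))) = 0" by (simp add: op_aug_def Suc.IH)
  qed
  then show ?case by simp
qed simp

lemma aug_pow_rel:
  assumes "\<And>a b. R a b \<Longrightarrow> p a = p b" "R 0 0" "list_all2 R h h'"
    "\<And>u u'. list_all2 R u u' \<Longrightarrow> length u = length h \<Longrightarrow> (lz h \<Longrightarrow> lz u) \<Longrightarrow> f u = f' u'"
  shows "aug_pow p k h f = aug_pow p k h' f'"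
  using assms(3-)
proof (induction k arbitrary: h h' f f')
  case 0
  then show ?case using "0.prems"(2)[of "[]" "[]"] by (auto simp: op_eps_def lz_def)
next
  case (Suc k)
  show ?case unfolding aug_pow.simps convol_def
  proof (rule shsum_rel[of R, OF assms(1,2) Suc.prems(1)])
    fix x y x' y'
    assume x: "list_all2 R x x'" and y: "list_all2 R y y'" and l: "length x + length y = length h"
      and z: "lz h \<Longrightarrow> lz x \<and> lz y"
    have "aug_pow p k y (\<lambda>v. f (x @ v)) = aug_pow p k y' (\<lambda>v. f' (x' @ v))"
    proof (rule Suc.IH[OF y])
      fix v v' assume "list_all2 R v v'" "length v = length y" "lz y \<Longrightarrow> lz v"
      then show "f (x @ v) = f' (x' @ v')"
        by (intro Suc.prems(2)) (use x l z in \<open>auto intro: list_all2_appendI lz_append\<close>)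
    qed
    then show "op_aug x (\<lambda>u. aug_pow p k y (\<lambda>v. f (u @ v))) = op_aug x' (\<lambda>u. aug_pow p k y' (\<lambda>v. f' (u @ v)))"
      using x by (auto simp: op_aug_def)
  qed
qed

text \<open>Takeuchi's formula for the convolution inverse of the identity.\<close>

definition antip :: "(nat \<Rightarrow> complex) \<Rightarrow> oper" where
  "antip p h f = (\<Sum>k\<le>length h. (- 1) ^ k * aug_pow p k h f)"

text \<open>The parts of a word have different lengths; a common range for k allows the sum to be
  moved out of \<open>shsum\<close>.\<close>

lemma antip_bound: "length h \<le> n \<Longrightarrow> antip p h f = (\<Sum>k\<le>n. (- 1) ^ k * aug_pow p k h f)"
  unfolding antip_def by (rule sum.mono_neutral_left) (auto simp: aug_pow_eq_0)

lemma alternating_telescope: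
  "(\<Sum>k\<le>n. (- 1) ^ k * (a (Suc k) + a k)) = a 0 + (- 1) ^ n * (a (Suc n) :: complex)"
  by (induction n) (auto simp: algebra_simps)

lemma op_lin_antip: "op_lin (antip p)"
  using op_lin_aug_pow[of p] unfolding op_lin_def antip_def
  by (simp add: sum.distrib[symmetric] sum_distrib_left algebra_simps)

text \<open>Since the identity is the unit plus \<open>op_aug\<close>, multiplying a power by it
  gives two consecutive powers. With alternating signs only the power 0 and the power
  \<open>Suc ?n\<close> remain, and the latter vanishes on a word of length
  \<open>?n\<close>.\<close>

lemma convol_antip_left:
  assumes "p 0 = 1"
  shows "convol p (antip p) op_eval = op_eps"
proof (intro ext)
  fix h :: "nat list" and f
  let ?n = "length h"
  have split: "convol p (aug_pow p k) op_eval h f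
      = convol p (aug_pow p k) op_aug h f + convol p (aug_pow p k) op_eps h f" for k
    using op_lin_aug_pow[of p] unfolding convol_def op_eval_split op_lin_def by (simp add: shsum_add)
  have "convol p (antip p) op_eval h f
    = shsum p h (\<lambda>x y. \<Sum>k\<le>?n. (- 1) ^ k * aug_pow p k x (\<lambda>u. f (u @ y)))"
    unfolding convol_def op_eval_def by (rule shsum_cong) (simp add: antip_bound)
  also have "\<dots> = (\<Sum>k\<le>?n. (- 1) ^ k * convol p (aug_pow p k) op_eval h f)"
    by (simp add: shsum_sum shsum_cmult convol_def op_eval_def)
  also have "\<dots> = (\<Sum>k\<le>?n. (- 1) ^ k * (aug_pow p (Suc k) h f + aug_pow p k h f))"
    by (simp only: split aug_pow_commute[of p, OF assms] convol_eps_right[OF op_lin_aug_pow])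
  also have "\<dots> = op_eps h f"
    using aug_pow_eq_0[of h "Suc ?n" p f] alternating_telescope[of "\<lambda>k. aug_pow p k h f" ?n] by simp
  finally show "convol p (antip p) op_eval h f = op_eps h f" .
qed

lemma convol_antip_right: "convol p op_eval (antip p) = op_eps"
proof (intro ext)
  fix h :: "nat list" and f
  let ?n = "length h"
  have split: "convol p op_eval (aug_pow p k) h f
      = convol p op_aug (aug_pow p k) h f + convol p op_eps (aug_pow p k) h f" for k
    unfolding convol_def op_eval_split by (simp add: shsum_add)
  have "convol p op_eval (antip p) h f
    = shsum p h (\<lambda>x y. \<Sum>k\<le>?n. (- 1) ^ k * aug_pow p k y (\<lambda>v. f (x @ v)))"
    unfolding convol_def op_eval_def by (rule shsum_cong) (simp add: antip_bound)
  also have "\<dots> = (\<Sum>k\<le>?n. (- 1) ^ k * convol p op_eval (aug_pow p k) h f)"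
    by (simp add: shsum_sum shsum_cmult convol_def op_eval_def)
  also have "\<dots> = (\<Sum>k\<le>?n. (- 1) ^ k * (aug_pow p (Suc k) h f + aug_pow p k h f))"
    by (simp only: split aug_pow.simps convol_eps_left)
  also have "\<dots> = op_eps h f"
    using aug_pow_eq_0[of h "Suc ?n" p f] alternating_telescope[of "\<lambda>k. aug_pow p k h f" ?n] by simp
  finally show "convol p op_eval (antip p) h f = op_eps h f" .
qed

lemma antip_rel:
  assumes "\<And>a b. R a b \<Longrightarrow> p a = p b" "R 0 0" "list_all2 R h h'"
    "\<And>u u'. list_all2 R u u' \<Longrightarrow> length u = length h \<Longrightarrow> (lz h \<Longrightarrow> lz u) \<Longrightarrow> f u = f' u'"
  shows "antip p h f = antip p h' f'"
proof -
  have "aug_pow p k h f = aug_pow p k h' f'" for k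
    by (rule aug_pow_rel[of R, OF assms(1,2,3)]; (rule assms(4); blast)?)
  then show ?thesis using list_all2_lengthD[OF assms(3)] by (simp add: antip_def)
qed

section \<open>The product as a shuffle sum\<close>

text \<open>The right end of a component is recognised locally, by the absence of its successor.
  This turns c1 and c2 into conditions on two neighbouring positions, as a recursion along the word
  requires.\<close>

lemma Max_conn: "Max ` conn A = {i \<in> A. Suc i \<notin> A}"
proof (intro equalityI subsetI)
  fix i assume "i \<in> Max ` conn A"
  then obtain B where B: "B \<in> conn A" and i: "i = Max B" by blast
  then obtain a b where ab: "B = {a..b}" "a \<le> b" "B \<subseteq> A" by (auto simp: conn_def is_interval_def)
  have mx: "\<And>C. B \<subseteq> C \<Longrightarrow> C \<subseteq> A \<Longrightarrow> is_interval C \<Longrightarrow> C = B" using B by (simp add: conn_def)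
  have ib: "i = b" using ab i by (simp add: Max_eq_iff)
  have "Suc b \<notin> A"
  proof
    assume "Suc b \<in> A"
    then have "{a..Suc b} \<subseteq> A" using ab by (auto simp: le_Suc_eq)
    then have "{a..Suc b} = B" using B ab by (intro mx) (auto simp: is_interval_def)
    then have "Suc b \<in> {a..b}" using ab by auto
    then show False by simp
  qed
  then show "i \<in> {i \<in> A. Suc i \<notin> A}" using ab ib by auto
next
  fix i assume i: "i \<in> {i \<in> A. Suc i \<notin> A}"
  \<comment> \<open>Left end of the component that ends in \<open>i\<close>.\<close>
  define a where "a = (LEAST a. {a..i} \<subseteq> A)"
  have ai: "{a..i} \<subseteq> A" unfolding a_def by (rule LeastI[of _ i]) (use i in auto)
  have a_le: "a \<le> a'" if "{a'..i} \<subseteq> A" for a' unfolding a_def using that by (rule Least_le)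
  have "a \<le> i" using i by (intro a_le) auto
  have "{a..i} \<in> conn A" unfolding conn_def
  proof (intro CollectI conjI allI impI)
    show "{a..i} \<noteq> {}" using \<open>a \<le> i\<close> by auto
    show "is_interval {a..i}" by (auto simp: is_interval_def)
    fix C assume C: "{a..i} \<subseteq> C" "C \<subseteq> A" "is_interval C"
    then obtain c d where cd: "C = {c..d}" by (auto simp: is_interval_def)
    have "i \<in> C" using C \<open>a \<le> i\<close> by auto
    have "\<not> i < d"
    proof
      assume "i < d"
      then have "Suc i \<in> C" using \<open>i \<in> C\<close> cd by auto
      then show False using C i by auto
    qed
    then have "d = i" using \<open>i \<in> C\<close> cd by auto
    moreover have "a \<le> c" using C cd \<open>d = i\<close> by (intro a_le) auto
    ultimately show "C = {a..i}" using C cd \<open>a \<le> i\<close> by auto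
  qed (use ai in auto)
  moreover have "Max {a..i} = i" using \<open>a \<le> i\<close> by (simp add: Max_eq_iff)
  ultimately show "i \<in> Max ` conn A" by (metis image_eqI)
qed

lemma c1_eq: "A \<subseteq> {1..N} \<Longrightarrow> c1 N A = {i. 1 \<le> i \<and> i < N \<and> i \<in> A \<and> Suc i \<notin> A}"
  unfolding c1_def Max_conn by force

lemma c2_eq: "A \<subseteq> {1..N} \<Longrightarrow> c2 N A = {i. 1 \<le> i \<and> i < N \<and> i \<notin> A \<and> Suc i \<in> A}"
  unfolding c2_def Max_conn by force

lemma cc_eq: "A \<subseteq> {1..N} \<Longrightarrow> cc N A = {i. 1 \<le> i \<and> i < N \<and> (i \<in> A) \<noteq> (Suc i \<in> A)}"
  by (auto simp: cc_def c1_eq c2_eq)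

text \<open>The summand of the product for A, restricted to the positions j, ..., E - 1; for j = 1 and
  E = N + 1 it is the full summand. The factors psi at the last positions of A and of its complement
  equal 1, because the argument there is 0, and are omitted.\<close>

definition blk_wt :: "(nat \<Rightarrow> complex) \<Rightarrow> (nat \<Rightarrow> nat) \<Rightarrow> nat \<Rightarrow> nat \<Rightarrow> nat set \<Rightarrow> complex" where
  "blk_wt p H j E A = (\<Prod>i\<in>{i. j \<le> i \<and> Suc i < E \<and> i \<notin> A \<and> Suc i \<in> A}. p (H i))"

definition blk_res :: "(nat \<Rightarrow> nat) \<Rightarrow> nat \<Rightarrow> nat set \<Rightarrow> nat \<Rightarrow> nat" where
  "blk_res H E A i = (if Suc i < E \<and> (i \<in> A) \<noteq> (Suc i \<in> A) then 0 else H i)"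

definition blk_term :: "(nat \<Rightarrow> complex) \<Rightarrow> (nat \<Rightarrow> nat) \<Rightarrow> nat \<Rightarrow> nat \<Rightarrow> (nat list \<Rightarrow> nat list \<Rightarrow> complex) \<Rightarrow> nat set \<Rightarrow> complex" where
  "blk_term p H j E \<Phi> A = blk_wt p H j E A *
     \<Phi> (map (blk_res H E A) (filter (\<lambda>i. i \<notin> A) [j..<E])) (map (blk_res H E A) (filter (\<lambda>i. i \<in> A) [j..<E]))"

lemma blk_wt_insert:
  "blk_wt p H (Suc j) E (insert j A) = blk_wt p H (Suc j) E A"
  unfolding blk_wt_def by (rule prod.cong) auto

lemma blk_wt_Suc:
  assumes "Suc j < E"
  shows "blk_wt p H j E A = (if j \<notin> A \<and> Suc j \<in> A then p (H j) else 1) * blk_wt p H (Suc j) E A"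
proof -
  have fin: "finite {i. Suc j \<le> i \<and> Suc i < E \<and> i \<notin> A \<and> Suc i \<in> A}"
    by (rule finite_subset[of _ "{..<E}"]) auto
  show ?thesis
  proof (cases "j \<notin> A \<and> Suc j \<in> A")
    case True
    then have "{i. j \<le> i \<and> Suc i < E \<and> i \<notin> A \<and> Suc i \<in> A}
      = insert j {i. Suc j \<le> i \<and> Suc i < E \<and> i \<notin> A \<and> Suc i \<in> A}"
      using assms by (auto simp: le_less Suc_le_eq)
    then show ?thesis using True fin by (simp add: blk_wt_def)
  next
    case False
    then have "{i. j \<le> i \<and> Suc i < E \<and> i \<notin> A \<and> Suc i \<in> A}
      = {i. Suc j \<le> i \<and> Suc i < E \<and> i \<notin> A \<and> Suc i \<in> A}"
      by (auto simp: le_less Suc_le_eq)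
    then have "blk_wt p H j E A = blk_wt p H (Suc j) E A" by (simp add: blk_wt_def)
    then show ?thesis using False by auto
  qed
qed

lemma map_blk_res_insert:
  "map (blk_res H E (insert j A)) (filter P [Suc j..<E]) = map (blk_res H E A) (filter P [Suc j..<E])"
  by (rule map_cong) (auto simp: blk_res_def)

text \<open>Only the sides of \<open>j\<close> and \<open>Suc j\<close> decide about weight and
  clearing at \<open>j\<close>, and later positions do not see \<open>j\<close>. For a fixed set
  these are the recursion equations of \<open>shuf\<close>.\<close>

lemma blk_term_Suc:
  assumes "Suc j < E" "A \<subseteq> {Suc j..<E}"
  shows "blk_term p H j E \<Phi> (insert j A) =
      blk_term p H (Suc j) E (\<lambda>x y. \<Phi> x ((if Suc j \<in> A then H j else 0) # y)) A"
    and "blk_term p H j E \<Phi> A = (if Suc j \<in> A then p (H j) else 1) *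
      blk_term p H (Suc j) E (\<lambda>x y. \<Phi> ((if Suc j \<in> A then 0 else H j) # x) y) A"
proof -
  have j: "j \<notin> A" using assms by auto
  have u: "[j..<E] = j # [Suc j..<E]" using assms by (simp add: upt_conv_Cons)
  have r1: "blk_res H E (insert j A) j = (if Suc j \<in> A then H j else 0)"
    using assms by (simp add: blk_res_def)
  have r2: "blk_res H E A j = (if Suc j \<in> A then 0 else H j)"
    using assms j by (simp add: blk_res_def)
  have f: "filter (\<lambda>i. i = j \<or> i \<in> A) [Suc j..<E] = filter (\<lambda>i. i \<in> A) [Suc j..<E]"
       "filter (\<lambda>i. i \<noteq> j \<and> i \<notin> A) [Suc j..<E] = filter (\<lambda>i. i \<notin> A) [Suc j..<E]"
    by (auto intro!: filter_cong)
  show "blk_term p H j E \<Phi> (insert j A) =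
      blk_term p H (Suc j) E (\<lambda>x y. \<Phi> x ((if Suc j \<in> A then H j else 0) # y)) A"
    by (simp add: blk_term_def blk_wt_Suc[OF assms(1)] blk_wt_insert u f r1 map_blk_res_insert del: upt_Suc)
  show "blk_term p H j E \<Phi> A = (if Suc j \<in> A then p (H j) else 1) *
      blk_term p H (Suc j) E (\<lambda>x y. \<Phi> ((if Suc j \<in> A then 0 else H j) # x) y) A"
    using j by (simp add: blk_term_def blk_wt_Suc[OF assms(1)] u r2 del: upt_Suc)
qed

lemma sum_blk_term_shuf:
  assumes "j < E"
  shows "(\<Sum>A\<in>{A. A \<subseteq> {j..<E} \<and> (j \<in> A) = c}. blk_term p H j E \<Phi> A) = shuf p c (map H [j..<E]) \<Phi>"
  using assms
proof (induction "E - j" arbitrary: j c \<Phi>)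
  case (Suc k)
  show ?case
  proof (cases "Suc j < E")
    case False
    then have E: "E = Suc j" using Suc.prems by simp
    have S: "{A. A \<subseteq> {j..<E} \<and> (j \<in> A) = c} = {if c then {j} else {}}"
      unfolding E by auto
    have "blk_wt p H j E A = 1" for A
      unfolding blk_wt_def E by (rule prod.neutral) auto
    then show ?thesis unfolding S by (cases c) (simp_all add: E blk_term_def blk_res_def)
  next
    case True
    let ?F = "blk_term p H j E \<Phi>"
    let ?S = "\<lambda>d. {A. A \<subseteq> {Suc j..<E} \<and> (Suc j \<in> A) = d}"
    have IH: "(\<Sum>A\<in>?S d. blk_term p H (Suc j) E \<Psi> A) = shuf p d (map H [Suc j..<E]) \<Psi>" for d \<Psi>
      by (rule Suc.hyps(1)) (use Suc.hyps True in auto)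
    have fin: "finite (?S d)" for d by (rule finite_subset[of _ "Pow {Suc j..<E}"]) auto
    \<comment> \<open>Once the side of \<open>j\<close> is fixed, the set is determined by an
      arbitrary subset of the later positions. These subsets are then divided by the side of
      \<open>Suc j\<close>, the flag of the recursive call.\<close>
    have "(\<Sum>A\<in>{A. A \<subseteq> {j..<E} \<and> (j \<in> A) = c}. ?F A)
      = (\<Sum>A\<in>{A. A \<subseteq> {Suc j..<E}}. ?F (if c then insert j A else A))"
    proof (rule sum.reindex_bij_witness[where i = "\<lambda>A. if c then insert j A else A" and j = "\<lambda>A. A - {j}"])
      fix A assume A: "A \<in> {A. A \<subseteq> {j..<E} \<and> (j \<in> A) = c}"
      then show "(if c then insert j (A - {j}) else A - {j}) = A" by auto
      have "i \<in> {Suc j..<E}" if "i \<in> A - {j}" for i using A that by (force simp: Suc_le_eq)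
      then show "A - {j} \<in> {A. A \<subseteq> {Suc j..<E}}" by blast
      show "?F (if c then insert j (A - {j}) else A - {j}) = ?F A"
        using A by (auto simp: insert_absorb)
    qed (use True in \<open>auto split: if_splits\<close>)
    also have "{A. A \<subseteq> {Suc j..<E}} = ?S True \<union> ?S False" by auto
    also have "(\<Sum>A\<in>?S True \<union> ?S False. ?F (if c then insert j A else A))
      = (\<Sum>A\<in>?S True. ?F (if c then insert j A else A)) + (\<Sum>A\<in>?S False. ?F (if c then insert j A else A))"
      by (rule sum.union_disjoint[OF fin fin]) auto
    also have "\<dots> = shuf p c (map H [j..<E]) \<Phi>"
    proof (cases c)
      case c: True
      have 1: "(\<Sum>A\<in>?S True. ?F (insert j A)) = (\<Sum>A\<in>?S True. blk_term p H (Suc j) E (\<lambda>x y. \<Phi> x (H j # y)) A)"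
        by (rule sum.cong) (auto simp: blk_term_Suc[OF True])
      have 2: "(\<Sum>A\<in>?S False. ?F (insert j A)) = (\<Sum>A\<in>?S False. blk_term p H (Suc j) E (\<lambda>x y. \<Phi> x (0 # y)) A)"
        by (rule sum.cong) (auto simp: blk_term_Suc[OF True])
      show ?thesis using c True Suc.prems unfolding upt_conv_Cons[OF Suc.prems]
        by (simp only: if_True 1 2 IH) (simp add: del: upt_Suc)
    next
      case c: False
      have 1: "(\<Sum>A\<in>?S False. ?F A) = (\<Sum>A\<in>?S False. blk_term p H (Suc j) E (\<lambda>x y. \<Phi> (H j # x) y) A)"
        by (rule sum.cong) (auto simp: blk_term_Suc[OF True])
      have 2: "(\<Sum>A\<in>?S True. ?F A) = (\<Sum>A\<in>?S True. p (H j) * blk_term p H (Suc j) E (\<lambda>x y. \<Phi> (0 # x) y) A)"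
        by (rule sum.cong) (auto simp: blk_term_Suc[OF True])
      show ?thesis using c True Suc.prems unfolding upt_conv_Cons[OF Suc.prems]
        by (simp only: if_False 1 2 IH sum_distrib_left[symmetric]) (simp add: del: upt_Suc)
    qed
    finally show ?thesis .
  qed
qed simp

lemma sum_blk_term_shsum:
  assumes "j \<le> E"
  shows "(\<Sum>A\<in>Pow {j..<E}. blk_term p H j E \<Phi> A) = shsum p (map H [j..<E]) \<Phi>"
proof (cases "j < E")
  case True
  have P: "Pow {j..<E} = {A. A \<subseteq> {j..<E} \<and> (j \<in> A) = True} \<union> {A. A \<subseteq> {j..<E} \<and> (j \<in> A) = False}" by auto
  have fin: "finite {A. A \<subseteq> {j..<E} \<and> (j \<in> A) = c}" for c by (rule finite_subset[of _ "Pow {j..<E}"]) auto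
  have "(\<Sum>A\<in>Pow {j..<E}. blk_term p H j E \<Phi> A)
    = (\<Sum>A\<in>{A. A \<subseteq> {j..<E} \<and> (j \<in> A) = True}. blk_term p H j E \<Phi> A)
    + (\<Sum>A\<in>{A. A \<subseteq> {j..<E} \<and> (j \<in> A) = False}. blk_term p H j E \<Phi> A)"
    unfolding P by (rule sum.union_disjoint[OF fin fin]) auto
  then show ?thesis using True by (simp only: sum_blk_term_shuf) (simp add: shsum_def)
next
  case False
  then show ?thesis using assms by (simp add: blk_term_def blk_wt_def shsum_def)
qed

section \<open>Points as words closed by a zero\<close>

definition dec :: "nat list \<Rightarrow> pt" where "dec l = (length l, butlast l)"

definition enc :: "pt \<Rightarrow> nat list" where "enc q = (if fst q = 0 then [] else snd q @ [0])"

lemma dec_Nil [simp]: "dec [] = (0, [])" by (simp add: dec_def)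
lemma enc_0 [simp]: "enc (0, g) = []" by (simp add: enc_def)

lemma dec_enc: "q \<in> pts \<nu> \<Longrightarrow> dec (enc q) = q"
  by (auto simp: dec_def enc_def pts_def Qn_def)

text \<open>\<open>gat\<close> returns 0 beyond the length N - 1 of \<open>g\<close>, so position N
  yields the appended 0.\<close>

lemma enc_eq_map_gat: "g \<in> Qn \<nu> N \<Longrightarrow> enc (N, g) = map (gat g) [1..<N + 1]"
  by (rule nth_equalityI) (auto simp: enc_def Qn_def gat_def nth_append simp del: upt_Suc)

lemma sorted_list_of_set_filter:
  assumes "A \<subseteq> {1..N}"
  shows "sorted_list_of_set A = filter (\<lambda>i. i \<in> A) [1..<N + 1]"
proof -
  have "A = set (filter (\<lambda>i. i \<in> A) [1..<N + 1])" using assms by auto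
  then have "sorted_list_of_set A = sorted_list_of_set (set (filter (\<lambda>i. i \<in> A) [1..<N + 1]))" by (rule arg_cong)
  also have "\<dots> = filter (\<lambda>i. i \<in> A) [1..<N + 1]"
    by (rule sorted_list_of_set.idem_if_sorted_distinct) (auto simp: sorted_wrt_filter simp del: upt_Suc)
  finally show ?thesis .
qed

text \<open>Applied to A and to its complement: the last position of either side is a change of side
  unless it is the last position of all.\<close>

lemma Suc_last_notin:
  assumes "xs = filter P [a..<b]" "xs \<noteq> []" "Suc (last xs) < b"
  shows "\<not> P (Suc (last xs))"
proof
  assume P: "P (Suc (last xs))"
  have "last xs \<in> set xs" using assms(2) by simp
  then have "Suc (last xs) \<in> set xs" using P assms(1,3) by auto
  then obtain i where i: "i < length xs" "xs ! i = Suc (last xs)" by (auto simp: in_set_conv_nth)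
  have "sorted xs" by (simp add: assms(1) sorted_wrt_filter del: upt_Suc)
  then have "xs ! i \<le> last xs" using i assms(2) sorted_nth_mono[of xs i "length xs - 1"]
    by (cases xs rule: rev_cases) (auto simp: less_Suc_eq_le)
  then show False using i by simp
qed

lemma gat_0: "g \<in> Qn \<nu> N \<Longrightarrow> gat g N = 0"
  by (auto simp: gat_def Qn_def)

lemma mA_eq_blk_term:
  assumes g: "g \<in> Qn \<nu> N" and A: "A \<subseteq> {1..N}"
  shows "mA \<nu> (N - card A) (card A) A \<Phi> g = blk_term (psiv \<nu>) (gat g) 1 (N + 1) (\<lambda>x y. \<Phi> (dec x, dec y)) A"
proof -
  have finA: "finite A" using A finite_subset by blast
  have cardA: "card A \<le> N" using card_mono[OF _ A] by simp
  have decg: "dec (map (gat g) [1..<N + 1]) = (N, g)"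
    using dec_enc[of "(N, g)" \<nu>] g enc_eq_map_gat[OF g] by (simp add: pts_def)
  have wt: "(\<Prod>i\<in>c2 N A. psiv \<nu> (gat g i)) = blk_wt (psiv \<nu>) (gat g) 1 (N + 1) A"
    unfolding blk_wt_def c2_eq[OF A] by (rule prod.cong) auto
  let ?g = "\<lambda>i. if i \<in> cc N A then 0 else gat g i"
  have res: "map (blk_res (gat g) (N + 1) A) (filter P [1..<N + 1]) = map ?g (filter P [1..<N + 1])" for P
    by (rule map_cong) (auto simp: blk_res_def cc_eq[OF A] simp del: upt_Suc)
  \<comment> \<open>\<open>mA\<close> treats m = 0 and n = 0 apart and tests m = 0 first, so N = 0
    belongs to the first case. In these cases there is no change of side, and the general formula
    returns the value prescribed by the definition.\<close>
  consider "card A = N" | "card A = 0" "N \<noteq> 0" | "0 < card A" "card A < N" using cardA by linarith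
  then show ?thesis
  proof cases
    case 1
    have AN: "A = {1..N}" using card_subset_eq[OF _ A] 1 by simp
    have "blk_wt (psiv \<nu>) (gat g) 1 (N + 1) A = 1" unfolding AN blk_wt_def by (rule prod.neutral) auto
    moreover have "filter (\<lambda>i. i \<notin> A) [1..<N + 1] = []" "filter (\<lambda>i. i \<in> A) [1..<N + 1] = [1..<N + 1]"
      unfolding AN by (auto simp: filter_empty_conv simp del: upt_Suc)
    moreover have "cc N A = {}" by (subst cc_eq[OF A]) (auto simp: AN)
    then have "dec (map ?g [1..<N + 1]) = (N, g)" using decg by (simp del: upt_Suc)
    ultimately show ?thesis using 1 unfolding blk_term_def res by (simp add: mA_def del: upt_Suc)
  next
    case 2
    have AN: "A = {}" using finA 2 by simp
    have "blk_wt (psiv \<nu>) (gat g) 1 (N + 1) A = 1" unfolding AN blk_wt_def by (rule prod.neutral) auto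
    moreover have "filter (\<lambda>i. i \<in> A) [1..<N + 1] = []" "filter (\<lambda>i. i \<notin> A) [1..<N + 1] = [1..<N + 1]"
      unfolding AN by (auto simp: filter_empty_conv simp del: upt_Suc)
    moreover have "cc N A = {}" by (subst cc_eq[OF A]) (auto simp: AN)
    then have "dec (map ?g [1..<N + 1]) = (N, g)" using decg by (simp del: upt_Suc)
    ultimately show ?thesis using 2 unfolding blk_term_def res by (simp add: mA_def del: upt_Suc)
  next
    case 3
    let ?as = "filter (\<lambda>i. i \<notin> A) [1..<N + 1]" and ?bs = "filter (\<lambda>i. i \<in> A) [1..<N + 1]"
    have bs: "sorted_list_of_set A = ?bs" by (rule sorted_list_of_set_filter[OF A])
    have "sorted_list_of_set ({1..N} - A) = filter (\<lambda>i. i \<in> {1..N} - A) [1..<N + 1]"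
      by (rule sorted_list_of_set_filter) auto
    also have "\<dots> = ?as" by (rule filter_cong) auto
    finally have as: "sorted_list_of_set ({1..N} - A) = ?as" .
    have lb: "length ?bs = card A" using bs by (metis length_sorted_list_of_set)
    have la: "length ?as = N - card A" using as card_Diff_subset[OF finA A]
      by (metis length_sorted_list_of_set card_atLeastAtMost diff_Suc_1)
    have as0: "?as \<noteq> []" using la 3 by (metis list.size(3) less_numeral_extra(3) zero_less_diff)
    have bs0: "?bs \<noteq> []" using lb 3 by (metis list.size(3) less_numeral_extra(3))
    \<comment> \<open>Either a position of A follows and the entry is cleared, or this is position
      N, where \<open>gat\<close> is 0.\<close>
    have l1: "?g (last ?as) = 0"
    proof (cases "Suc (last ?as) < N + 1")
      case True
      have "last ?as \<in> set ?as" using as0 by (rule last_in_set)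
      then show ?thesis using Suc_last_notin[OF refl as0 True] True by (auto simp: cc_eq[OF A] simp del: upt_Suc)
    next
      case False
      have "last ?as \<in> set ?as" using as0 by (rule last_in_set)
      then have "last ?as = N" using False by (auto simp del: upt_Suc)
      then show ?thesis using gat_0[OF g] by simp
    qed
    have l2: "?g (last ?bs) = 0"
    proof (cases "Suc (last ?bs) < N + 1")
      case True
      have "last ?bs \<in> set ?bs" using bs0 by (rule last_in_set)
      then show ?thesis using Suc_last_notin[OF refl bs0 True] True by (auto simp: cc_eq[OF A] simp del: upt_Suc)
    next
      case False
      have "last ?bs \<in> set ?bs" using bs0 by (rule last_in_set)
      then have "last ?bs = N" using False by (auto simp del: upt_Suc)
      then show ?thesis using gat_0[OF g] by simp
    qed
    have N: "N - card A + card A = N" using cardA by simp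
    have d: "dec (map ?g ?as) = (N - card A, map ?g (butlast ?as))"
      "dec (map ?g ?bs) = (card A, map ?g (butlast ?bs))"
      unfolding dec_def map_butlast[symmetric] length_map la lb by simp_all
    have "mA \<nu> (N - card A) (card A) A \<Phi> g = (\<Prod>i\<in>c2 N A. psiv \<nu> (gat g i)) *
        (\<Phi> ((N - card A, map ?g (butlast ?as)), (card A, map ?g (butlast ?bs))) *
          psiv \<nu> (?g (last ?as)) * psiv \<nu> (?g (last ?bs)))"
      unfolding mA_def Let_def N as bs using 3 by (simp del: upt_Suc)
    also have "\<dots> = blk_term (psiv \<nu>) (gat g) 1 (N + 1) (\<lambda>x y. \<Phi> (dec x, dec y)) A"
      unfolding blk_term_def res d wt l1 l2 by (simp add: psiv_def)
    finally show ?thesis .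
  qed
qed

lemma multT_eq:
  "multT \<nu> \<Phi> q = (if q \<in> pts \<nu> then shsum (psiv \<nu>) (enc q) (\<lambda>x y. \<Phi> (dec x, dec y)) else 0)"
proof -
  obtain N g where q: "q = (N, g)" by fastforce
  show ?thesis
  proof (cases "g \<in> Qn \<nu> N")
    case True
    have "multT \<nu> \<Phi> q = (\<Sum>n\<in>{0..N}. \<Sum>A\<in>{A. A \<subseteq> {1..N} \<and> card A = n}. mA \<nu> (N - card A) (card A) A \<Phi> g)"
      using True by (auto simp: q multT_def)
    also have "\<dots> = (\<Sum>n\<in>{0..N}. \<Sum>A\<in>{A \<in> Pow {1..N}. card A = n}. mA \<nu> (N - card A) (card A) A \<Phi> g)"
      by simp
    \<comment> \<open>The degree of the second factor is the cardinality of A, so the double sum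
      meets every subset once.\<close>
    also have "\<dots> = (\<Sum>A\<in>Pow {1..N}. mA \<nu> (N - card A) (card A) A \<Phi> g)"
    proof (rule sum.group)
      show "card ` Pow {1..N} \<subseteq> {0..N}" using card_mono[of "{1..N}"] by fastforce
    qed auto
    also have "\<dots> = (\<Sum>A\<in>Pow {1..<N + 1}. blk_term (psiv \<nu>) (gat g) 1 (N + 1) (\<lambda>x y. \<Phi> (dec x, dec y)) A)"
      by (rule sum.cong) (auto simp: mA_eq_blk_term[OF True, simplified] atLeastLessThanSuc_atLeastAtMost)
    also have "\<dots> = shsum (psiv \<nu>) (enc q) (\<lambda>x y. \<Phi> (dec x, dec y))"
      unfolding q enc_eq_map_gat[OF True] by (rule sum_blk_term_shsum) simp
    finally show ?thesis using True by (simp add: q pts_def)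
  qed (simp add: q multT_def pts_def)
qed

section \<open>The Hopf algebra\<close>

definition words :: "nat \<Rightarrow> nat list set" where
  "words \<nu> = {l. lz l \<and> (\<forall>x\<in>set l. x < \<nu>)}"

definition sim :: "nat \<Rightarrow> nat \<Rightarrow> bool" where "sim a b \<longleftrightarrow> (a = 0 \<longleftrightarrow> b = 0)"

lemma words_Nil [simp]: "[] \<in> words \<nu>" by (simp add: words_def lz_def)

lemma words_append: "u \<in> words \<nu> \<Longrightarrow> v \<in> words \<nu> \<Longrightarrow> u @ v \<in> words \<nu>"
  by (auto simp: words_def lz_append)

lemma enc_dec: "l \<in> words \<nu> \<Longrightarrow> enc (dec l) = l"
  by (auto simp: words_def enc_def dec_def lz_def) (metis append_butlast_last_id)

lemma dec_in_pts: "l \<in> words \<nu> \<Longrightarrow> dec l \<in> pts \<nu>"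
  by (auto simp: words_def dec_def pts_def Qn_def dest: in_set_butlastD)

lemma enc_in_words: "\<nu> > 0 \<Longrightarrow> q \<in> pts \<nu> \<Longrightarrow> enc q \<in> words \<nu>"
  by (auto simp: words_def enc_def pts_def Qn_def lz_def)

lemma length_enc: "q \<in> pts \<nu> \<Longrightarrow> length (enc q) = fst q"
  by (auto simp: enc_def pts_def Qn_def)

lemma dec_eq_0_iff [simp]: "dec l = (0, []) \<longleftrightarrow> l = []"
  by (auto simp: dec_def)

lemma fst_dec [simp]: "fst (dec l) = length l"
  by (simp add: dec_def)

lemma psiv_0 [simp]: "psiv \<nu> 0 = 1" by (simp add: psiv_def)

lemma psiv_sim: "sim a b \<Longrightarrow> psiv \<nu> a = psiv \<nu> b" by (simp add: psiv_def sim_def)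

lemma lz_sim: "list_all2 sim u v \<Longrightarrow> lz u \<Longrightarrow> lz v"
  by (cases "u = []"; cases "v = []") (auto simp: lz_def last_conv_nth list_all2_conv_all_nth sim_def)

text \<open>The 0 that closes \<open>enc q\<close> is the entry that \<open>comult\<close> inserts
  between a and b, and a factor of degree 0 is the empty word. This merges the three cases.\<close>

lemma comult_eq:
  "comult \<nu> F (q, r) = (if q \<in> pts \<nu> \<and> r \<in> pts \<nu> then F (dec (enc q @ enc r)) else 0)"
proof (cases "q \<in> pts \<nu> \<and> r \<in> pts \<nu>")
  case True
  then show ?thesis
    by (cases q; cases r) (auto simp: comult_def enc_def dec_def pts_def Qn_def butlast_append)
next
  case False
  then show ?thesis by (cases q; cases r) (auto simp: comult_def)
qed

lemma comult_dec:
  "u \<in> words \<nu> \<Longrightarrow> v \<in> words \<nu> \<Longrightarrow> comult \<nu> F (dec u, dec v) = F (dec (u @ v))"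
  by (simp add: comult_eq dec_in_pts enc_dec)

lemma multT_dec:
  "l \<in> words \<nu> \<Longrightarrow> multT \<nu> \<Phi> (dec l) = shsum (psiv \<nu>) l (\<lambda>x y. \<Phi> (dec x, dec y))"
  by (simp add: multT_eq dec_in_pts enc_dec)

section \<open>Membership in the space of superclass functions\<close>

lemma list_all2_sim_iff:
  "list_all2 sim xs ys \<longleftrightarrow> length xs = length ys \<and> suppl xs = suppl ys"
proof (cases "length xs = length ys")
  case True
  have "suppl xs = suppl ys \<longleftrightarrow> (\<forall>i<length xs. (xs ! i = 0) = (ys ! i = 0))"
  proof
    assume eq: "suppl xs = suppl ys"
    show "\<forall>i<length xs. (xs ! i = 0) = (ys ! i = 0)"
    proof (intro allI impI)
      fix i assume "i < length xs"
      have "Suc i \<in> suppl xs \<longleftrightarrow> Suc i \<in> suppl ys" using eq by simp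
      then show "(xs ! i = 0) = (ys ! i = 0)" using \<open>i < length xs\<close> True by (auto simp: suppl_def)
    qed
  next
    assume eq: "\<forall>i<length xs. (xs ! i = 0) = (ys ! i = 0)"
    have *: "(xs ! (i - 1) = 0) = (ys ! (i - 1) = 0)" if "1 \<le> i" "i \<le> length xs" for i
      using eq that by simp
    show "suppl xs = suppl ys" unfolding suppl_def True[symmetric]
      by (intro Collect_cong conj_cong refl) (simp only: *)
  qed
  then show ?thesis using True by (auto simp: list_all2_conv_all_nth sim_def)
qed (auto dest: list_all2_lengthD)

lemma finite_pts_bounded: "finite {q \<in> pts \<nu>. fst q < D}"
proof (rule finite_subset)
  show "{q \<in> pts \<nu>. fst q < D} \<subseteq> (SIGMA n:{..<D}. {xs. set xs \<subseteq> {..<\<nu>} \<and> length xs = n - 1})"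
    by (auto simp: pts_def Qn_def)
  show "finite (SIGMA n:{..<D}. {xs. set xs \<subseteq> {..<\<nu>} \<and> length xs = n - 1})"
    by (intro finite_SigmaI finite_lists_length_eq) auto
qed

text \<open>The bound \<open>D\<close> on the degree gives finite support because every Q_n is
  finite, and invariance under \<open>sim\<close> says that only the support of an argument
  matters.\<close>

lemma scfVI:
  assumes "\<nu> > 0" "\<And>q. F q \<noteq> 0 \<Longrightarrow> q \<in> pts \<nu>"
    "\<And>l. l \<in> words \<nu> \<Longrightarrow> D \<le> length l \<Longrightarrow> F (dec l) = 0"
    "\<And>l l'. l \<in> words \<nu> \<Longrightarrow> l' \<in> words \<nu> \<Longrightarrow> list_all2 sim l l' \<Longrightarrow> F (dec l) = F (dec l')"
  shows "F \<in> scfV \<nu>"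
  unfolding scfV_def
proof (intro CollectI conjI allI impI)
  have "fst q < D" if "F q \<noteq> 0" for q
  proof (rule ccontr)
    assume "\<not> fst q < D"
    moreover have q: "q \<in> pts \<nu>" using assms(2) that by blast
    ultimately have "F (dec (enc q)) = 0"
      by (intro assms(3)) (auto simp: enc_in_words[OF assms(1)] length_enc)
    then show False using that q by (simp add: dec_enc)
  qed
  then show "finite {q. F q \<noteq> 0}"
    by (intro finite_subset[OF _ finite_pts_bounded[of \<nu> D]]) (use assms(2) in auto)
  show "F q \<noteq> 0 \<Longrightarrow> q \<in> pts \<nu>" for q by (rule assms(2))
  fix n xs ys
  assume *: "xs \<in> Qn \<nu> n" "ys \<in> Qn \<nu> n" "suppl xs = suppl ys"
  then have p: "(n, xs) \<in> pts \<nu>" "(n, ys) \<in> pts \<nu>" by (auto simp: pts_def)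
  have "list_all2 sim xs ys" using * by (auto simp: list_all2_sim_iff Qn_def)
  then have "list_all2 sim (enc (n, xs)) (enc (n, ys))"
    by (auto simp: enc_def sim_def intro!: list_all2_appendI)
  then have "F (dec (enc (n, xs))) = F (dec (enc (n, ys)))"
    by (intro assms(4)) (auto simp: enc_in_words[OF assms(1)] p)
  then show "F (n, xs) = F (n, ys)" using p by (simp add: dec_enc)
qed

lemma scfV_pts: "F \<in> scfV \<nu> \<Longrightarrow> q \<notin> pts \<nu> \<Longrightarrow> F q = 0"
  unfolding scfV_def by blast

lemma scfV_bounded:
  assumes "F \<in> scfV \<nu>"
  obtains D where "\<And>q. D \<le> fst q \<Longrightarrow> F q = 0"
proof -
  have "finite (fst ` {q. F q \<noteq> 0})" using assms by (simp add: scfV_def)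
  then obtain D where "\<forall>n\<in>fst ` {q. F q \<noteq> 0}. n < D" unfolding finite_nat_set_iff_bounded by blast
  then have "D \<le> fst q \<Longrightarrow> F q = 0" for q
    by (metis (mono_tags, lifting) image_eqI mem_Collect_eq not_le)
  then show thesis using that by blast
qed

lemma list_all2_butlastI: "list_all2 P u v \<Longrightarrow> list_all2 P (butlast u) (butlast v)"
  by (simp add: list_all2_conv_all_nth nth_butlast)

lemma scfV_sim:
  assumes "F \<in> scfV \<nu>" "l \<in> words \<nu>" "l' \<in> words \<nu>" "list_all2 sim l l'"
  shows "F (dec l) = F (dec l')"
proof -
  have n: "length l = length l'" using assms(4) by (rule list_all2_lengthD)
  have "suppl (butlast l) = suppl (butlast l')"
    using list_all2_butlastI[OF assms(4)] by (simp add: list_all2_sim_iff)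
  moreover have "butlast l \<in> Qn \<nu> (length l)" "butlast l' \<in> Qn \<nu> (length l)"
    using dec_in_pts assms n by (fastforce simp: pts_def dec_def)+
  moreover have "xs \<in> Qn \<nu> n \<Longrightarrow> ys \<in> Qn \<nu> n \<Longrightarrow> suppl xs = suppl ys \<Longrightarrow> F (n, xs) = F (n, ys)" for n xs ys
    using assms(1) unfolding scfV_def by blast
  ultimately have "F (length l, butlast l) = F (length l, butlast l')" by blast
  then show ?thesis using n by (simp add: dec_def)
qed

text \<open>The bound on the letters is built into the relation so that the parts produced by
  \<open>shsum_rel\<close> and \<open>antip_rel\<close> are again words over C_nu.\<close>

definition wsim :: "nat \<Rightarrow> nat \<Rightarrow> nat \<Rightarrow> bool" where
  "wsim \<nu> a b \<longleftrightarrow> sim a b \<and> a < \<nu> \<and> b < \<nu>"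

lemma wsim_words:
  assumes "list_all2 (wsim \<nu>) u v" "lz u"
  shows "u \<in> words \<nu>" "v \<in> words \<nu>" "list_all2 sim u v"
proof -
  show s: "list_all2 sim u v" using assms(1) by (rule list_all2_mono) (simp add: wsim_def)
  have "\<forall>x\<in>set u. x < \<nu>" "\<forall>x\<in>set v. x < \<nu>"
    using assms(1) by (auto simp: list_all2_conv_all_nth wsim_def in_set_conv_nth)
  then show "u \<in> words \<nu>" "v \<in> words \<nu>" using assms(2) lz_sim[OF s] by (auto simp: words_def)
qed

lemma wsimI: "u \<in> words \<nu> \<Longrightarrow> v \<in> words \<nu> \<Longrightarrow> list_all2 sim u v \<Longrightarrow> list_all2 (wsim \<nu>) u v"
  by (auto simp: list_all2_conv_all_nth wsim_def words_def)

text \<open>Parts of an encoded point are encoded points: clearing adds only the letter 0,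
  admissible since \<nu> > 0, and each part keeps a closing 0.\<close>

lemma shsum_words_cong:
  assumes "\<nu> > 0" "h \<in> words \<nu>"
    "\<And>u v. u \<in> words \<nu> \<Longrightarrow> v \<in> words \<nu> \<Longrightarrow> length u + length v = length h \<Longrightarrow> \<Phi> u v = \<Psi> u v"
  shows "shsum p h \<Phi> = shsum p h \<Psi>"
  by (rule shsum_cong, rule assms(3)) (use assms(1,2) in \<open>auto simp: words_def subset_iff\<close>)

lemma antip_words_cong:
  assumes "\<nu> > 0" "h \<in> words \<nu>"
    "\<And>u. u \<in> words \<nu> \<Longrightarrow> length u = length h \<Longrightarrow> f u = f' u"
  shows "antip p h f = antip p h f'"
proof -
  let ?R = "\<lambda>a b. a = b \<and> a < \<nu>"
  have R: "list_all2 ?R u u' \<longleftrightarrow> u = u' \<and> (\<forall>x\<in>set u. x < \<nu>)" for u u'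
    by (induction u arbitrary: u') (auto simp: list_all2_Cons1)
  have "lz h" "\<forall>x\<in>set h. x < \<nu>" using assms(2) by (auto simp: words_def)
  then show ?thesis
    by (intro antip_rel[of ?R]) (use assms(1,3) in \<open>auto simp: R words_def\<close>)
qed

section \<open>Algebra axioms\<close>

lemma mult_dec:
  "l \<in> words \<nu> \<Longrightarrow> mult \<nu> x y (dec l) = shsum (psiv \<nu>) l (\<lambda>a b. x (dec a) * y (dec b))"
  by (simp add: mult_def multT_dec)

lemma mult_pts: "q \<notin> pts \<nu> \<Longrightarrow> mult \<nu> x y q = 0"
  by (simp add: mult_def multT_eq)

lemma eq_pts_words:
  assumes "\<nu> > 0" "\<And>q. q \<notin> pts \<nu> \<Longrightarrow> F q = G q" "\<And>l. l \<in> words \<nu> \<Longrightarrow> F (dec l) = G (dec l)"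
  shows "F = G"
proof
  fix q show "F q = G q"
    using assms(2)[of q] assms(3)[of "enc q"] enc_in_words[OF assms(1), of q] dec_enc[of q \<nu>] by metis
qed

lemma mult_in_scfV:
  assumes "\<nu> > 0" "x \<in> scfV \<nu>" "y \<in> scfV \<nu>"
  shows "mult \<nu> x y \<in> scfV \<nu>"
proof -
  obtain D1 where D1: "\<And>q. D1 \<le> fst q \<Longrightarrow> x q = 0" using scfV_bounded assms(2) by blast
  obtain D2 where D2: "\<And>q. D2 \<le> fst q \<Longrightarrow> y q = 0" using scfV_bounded assms(3) by blast
  show ?thesis
  proof (rule scfVI[where D = "D1 + D2"])
    show "mult \<nu> x y q \<noteq> 0 \<Longrightarrow> q \<in> pts \<nu>" for q using mult_pts by blast
  next
    fix l assume l: "l \<in> words \<nu>" "D1 + D2 \<le> length l"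
    have "shsum (psiv \<nu>) l (\<lambda>a b. x (dec a) * y (dec b)) = shsum (psiv \<nu>) l (\<lambda>a b. 0)"
    proof (rule shsum_cong)
      fix a b :: "nat list" assume "length a + length b = length l"
      then have "D1 \<le> length a \<or> D2 \<le> length b" using l by linarith
      then show "x (dec a) * y (dec b) = 0" using D1[of "dec a"] D2[of "dec b"] by auto
    qed
    then show "mult \<nu> x y (dec l) = 0" by (simp add: mult_dec[OF l(1)])
  next
    fix l l' assume l: "l \<in> words \<nu>" "l' \<in> words \<nu>" "list_all2 sim l l'"
    have lzl: "lz l" using l by (simp add: words_def)
    show "mult \<nu> x y (dec l) = mult \<nu> x y (dec l')"
      unfolding mult_dec[OF l(1)] mult_dec[OF l(2)]
    proof (rule shsum_rel[of "wsim \<nu>"])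
      fix u v u' v' assume *: "list_all2 (wsim \<nu>) u u'" "list_all2 (wsim \<nu>) v v'" "lz l \<Longrightarrow> lz u \<and> lz v"
      then have "x (dec u) = x (dec u')" "y (dec v) = y (dec v')"
        using lzl wsim_words[OF *(1)] wsim_words[OF *(2)] scfV_sim[OF assms(2)] scfV_sim[OF assms(3)] by blast+
      then show "x (dec u) * y (dec v) = x (dec u') * y (dec v')" by simp
    qed (use wsimI[OF l] assms(1) in \<open>auto simp: wsim_def sim_def psiv_def\<close>)
  qed (rule assms(1))
qed

lemma unitV_dec: "unitV (dec l) = (if l = [] then 1 else 0)"
  by (simp add: unitV_def)

lemma unitV_in_scfV: "\<nu> > 0 \<Longrightarrow> unitV \<in> scfV \<nu>"
  by (rule scfVI[where D = 1])
    (auto simp: unitV_dec unitV_def pts_def Qn_def split: if_splits)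

lemma mult_assoc:
  assumes "\<nu> > 0"
  shows "mult \<nu> (mult \<nu> x y) z = mult \<nu> x (mult \<nu> y z)"
proof (rule eq_pts_words[OF assms])
  fix l assume l: "l \<in> words \<nu>"
  let ?p = "psiv \<nu>"
  have "mult \<nu> (mult \<nu> x y) z (dec l)
    = shsum ?p l (\<lambda>a b. shsum ?p a (\<lambda>u v. x (dec u) * y (dec v) * z (dec b)))"
    unfolding mult_dec[OF l]
    by (rule shsum_words_cong[OF assms l]) (simp add: mult_dec shsum_cmult_right)
  also have "\<dots> = shsum ?p l (\<lambda>a b. shsum ?p b (\<lambda>u v. x (dec a) * y (dec u) * z (dec v)))"
    by (rule shsum_assoc[where \<Psi> = "\<lambda>u v b. x (dec u) * y (dec v) * z (dec b)"]) simp
  also have "\<dots> = mult \<nu> x (mult \<nu> y z) (dec l)"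
    unfolding mult_dec[OF l]
    by (rule shsum_words_cong[OF assms l]) (simp add: mult_dec shsum_cmult mult.assoc)
  finally show "mult \<nu> (mult \<nu> x y) z (dec l) = mult \<nu> x (mult \<nu> y z) (dec l)" .
qed (simp add: mult_pts)

lemma mult_unit_left:
  assumes "\<nu> > 0" "x \<in> scfV \<nu>"
  shows "mult \<nu> unitV x = x"
proof (rule eq_pts_words[OF assms(1)])
  fix l assume l: "l \<in> words \<nu>"
  have "(\<lambda>a b. unitV (dec a) * x (dec b)) = (\<lambda>a b. if a = [] then x (dec b) else 0)"
    by (intro ext) (simp add: unitV_dec)
  then show "mult \<nu> unitV x (dec l) = x (dec l)" by (simp add: mult_dec[OF l] shsum_unit_left)
qed (use assms in \<open>simp add: mult_pts scfV_pts\<close>)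

lemma mult_unit_right:
  assumes "\<nu> > 0" "x \<in> scfV \<nu>"
  shows "mult \<nu> x unitV = x"
proof (rule eq_pts_words[OF assms(1)])
  fix l assume l: "l \<in> words \<nu>"
  have "(\<lambda>a b. x (dec a) * unitV (dec b)) = (\<lambda>a b. if b = [] then x (dec a) else 0)"
    by (intro ext) (simp add: unitV_dec)
  then show "mult \<nu> x unitV (dec l) = x (dec l)" by (simp add: mult_dec[OF l] shsum_unit_right)
qed (use assms in \<open>simp add: mult_pts scfV_pts\<close>)

section \<open>Coalgebra axioms and compatibility\<close>

lemma comult_coassoc:
  assumes "\<nu> > 0"
  shows "comult \<nu> (\<lambda>a'. comult \<nu> x (a', c)) (a, b) = comult \<nu> (\<lambda>b'. comult \<nu> x (a, b')) (b, c)"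
proof (cases "a \<in> pts \<nu> \<and> b \<in> pts \<nu> \<and> c \<in> pts \<nu>")
  case True
  then show ?thesis
    by (simp add: comult_eq dec_in_pts enc_dec[of _ \<nu>] words_append enc_in_words[OF assms])
qed (auto simp: comult_eq)

text \<open>Supplies the right tensor factors in \<open>comult_in_scfVV\<close>, and later allows
  \<open>ch\<close> to be evaluated in the second variable of a coproduct.\<close>

lemma comult_slice_left:
  assumes "\<nu> > 0" "x \<in> scfV \<nu>"
  shows "(\<lambda>r. comult \<nu> x (q, r)) \<in> scfV \<nu>"
proof -
  obtain D where D: "\<And>q. D \<le> fst q \<Longrightarrow> x q = 0" using scfV_bounded assms(2) by blast
  show ?thesis
  proof (rule scfVI[OF assms(1), where D = D])
    show "comult \<nu> x (q, r) \<noteq> 0 \<Longrightarrow> r \<in> pts \<nu>" for r by (auto simp: comult_eq split: if_splits)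
    show "comult \<nu> x (q, dec l) = 0" if "l \<in> words \<nu>" "D \<le> length l" for l
      using that D[of "dec (enc q @ l)"] by (simp add: comult_eq enc_dec)
    fix l l' assume l: "l \<in> words \<nu>" "l' \<in> words \<nu>" "list_all2 sim l l'"
    have "x (dec (enc q @ l)) = x (dec (enc q @ l'))" if "q \<in> pts \<nu>"
      by (rule scfV_sim[OF assms(2)])
        (use l that assms(1) in \<open>auto intro!: words_append enc_in_words list_all2_appendI list_all2_refl simp: sim_def\<close>)
    then show "comult \<nu> x (q, dec l) = comult \<nu> x (q, dec l')"
      using l by (simp add: comult_eq enc_dec dec_in_pts)
  qed
qed

text \<open>Expansion of the left tensor factor in indicator functions of the support classes, each
  represented by its 0/1 vector.\<close>

lemma comult_in_scfVV:
  assumes "\<nu> > 1" "x \<in> scfV \<nu>"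
  shows "comult \<nu> x \<in> scfVV \<nu>"
proof -
  have \<nu>: "\<nu> > 0" using assms by simp
  obtain D where D: "\<And>q. D \<le> fst q \<Longrightarrow> x q = 0" using scfV_bounded assms(2) by blast
  \<comment> \<open>The representative of the support class of q; it is a point because 1 <
    \<nu>.\<close>
  define nz where "nz q = (fst q, map (\<lambda>x. if x = 0 then 0 else (1::nat)) (snd q))" for q :: pt
  define d where "d b = (\<lambda>q. if q \<in> pts \<nu> \<and> nz q = b then 1 else (0::complex))" for b
  define B where "B = nz ` {q \<in> pts \<nu>. fst q < D}"
  have finB: "finite B" unfolding B_def by (intro finite_imageI finite_pts_bounded)
  have nz: "nz q \<in> pts \<nu>" "list_all2 sim (enc q) (enc (nz q))" if "q \<in> pts \<nu>" for q
    using that assms(1)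
    by (auto simp: nz_def pts_def Qn_def enc_def sim_def list_all2_map2 intro!: list_all2_appendI list_all2_refl)
  have nz_dec: "nz (dec l) = nz (dec l')" if "list_all2 sim l l'" for l l'
  proof -
    have "list_all2 sim (butlast l) (butlast l')" using that by (rule list_all2_butlastI)
    then have "map (\<lambda>x. if x = 0 then 0 else (1::nat)) (butlast l) = map (\<lambda>x. if x = 0 then 0 else 1) (butlast l')"
      by (auto simp: list_all2_conv_all_nth sim_def intro!: nth_equalityI)
    then show ?thesis using list_all2_lengthD[OF that] by (simp add: nz_def dec_def)
  qed
  have d: "d b \<in> scfV \<nu>" for b
  proof (rule scfVI[OF \<nu>, where D = "Suc (fst b)"])
    show "d b (dec l) = d b (dec l')" if "l \<in> words \<nu>" "l' \<in> words \<nu>" "list_all2 sim l l'" for l l'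
      using that nz_dec[of l l'] by (simp add: d_def dec_in_pts)
  qed (auto simp: d_def nz_def split: if_splits)
  obtain bs where bs: "set bs = B" "distinct bs" using finite_distinct_list[OF finB] by blast
  have "comult \<nu> x (q, r) = (\<Sum>b\<in>B. d b q * comult \<nu> x (b, r))" for q r
  proof (cases "q \<in> pts \<nu>")
    case q: True
    have eq: "comult \<nu> x (q, r) = comult \<nu> x (nz q, r)"
    proof (cases "r \<in> pts \<nu>")
      case True
      have "x (dec (enc q @ enc r)) = x (dec (enc (nz q) @ enc r))"
        by (rule scfV_sim[OF assms(2)])
          (use nz[OF q] q True \<nu> in \<open>auto intro!: words_append enc_in_words list_all2_appendI list_all2_refl simp: sim_def\<close>)
      then show ?thesis using nz[OF q] q by (simp add: comult_eq)
    qed (simp add: comult_eq)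
    have "(\<Sum>b\<in>B. d b q * comult \<nu> x (b, r)) = (\<Sum>b\<in>B. if b = nz q then comult \<nu> x (nz q, r) else 0)"
      using q by (intro sum.cong) (auto simp: d_def)
    also have "\<dots> = (if nz q \<in> B then comult \<nu> x (nz q, r) else 0)" using finB by simp
    also have "\<dots> = comult \<nu> x (nz q, r)"
    proof (cases "nz q \<in> B")
      case False
      \<comment> \<open>A class outside \<open>B\<close> has degree at least \<open>D\<close>, so x
        vanishes on every concatenation that starts with \<open>enc q\<close>.\<close>
      then have "D \<le> fst q" using q by (auto simp: B_def)
      then have "D \<le> length (enc q @ enc r)" using q by (simp add: length_enc)
      then have "comult \<nu> x (q, r) = 0" using D by (simp add: comult_eq)
      then show ?thesis using eq False by simp
    qed simp
    finally show ?thesis using eq by simp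
  qed (auto simp: comult_eq d_def)
  also have "(\<Sum>b\<in>B. d b q * comult \<nu> x (b, r)) = (\<Sum>(f, g)\<leftarrow>map (\<lambda>b. (d b, \<lambda>r. comult \<nu> x (b, r))) bs. f q * g r)" for q r
    using bs by (simp add: comp_def sum_list_distinct_conv_sum_set)
  finally have eq: "comult \<nu> x = (\<lambda>(q, r). \<Sum>(f, g)\<leftarrow>map (\<lambda>b. (d b, \<lambda>r. comult \<nu> x (b, r))) bs. f q * g r)"
    by (intro ext) (simp only: split_paired_all prod.case)
  have sub: "set (map (\<lambda>b. (d b, \<lambda>r. comult \<nu> x (b, r))) bs) \<subseteq> scfV \<nu> \<times> scfV \<nu>"
    using d comult_slice_left[OF \<nu> assms(2)] by auto
  show ?thesis unfolding scfVV_def by (rule CollectI, rule exI, rule conjI[OF sub eq])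
qed

lemma counit_comult:
  assumes "\<nu> > 0" "x \<in> scfV \<nu>"
  shows "counitV (\<lambda>a. comult \<nu> x (a, q)) = x q" "counitV (\<lambda>a. comult \<nu> x (q, a)) = x q"
proof -
  have "(0, []) \<in> pts \<nu>" by (simp add: pts_def Qn_def)
  then show "counitV (\<lambda>a. comult \<nu> x (a, q)) = x q" "counitV (\<lambda>a. comult \<nu> x (q, a)) = x q"
    using scfV_pts[OF assms(2), of q] dec_enc[of q \<nu>] by (auto simp: counitV_def comult_eq)
qed

text \<open>The coproduct evaluates the product at \<open>u @ v\<close>, and the sum is cut after
  \<open>u\<close>. The parts a, c of \<open>u\<close> and b, d of \<open>v\<close> are then joined
  crosswise: x sees \<open>a @ b\<close> and y sees \<open>c @ d\<close>. This is the interchange of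
  the middle factors in \<open>mm_twist\<close>.\<close>

lemma comult_mult:
  assumes "\<nu> > 0"
  shows "comult \<nu> (mult \<nu> x y) (q, r) = mm_twist \<nu> (comult \<nu> x) (comult \<nu> y) (q, r)"
proof (cases "q \<in> pts \<nu> \<and> r \<in> pts \<nu>")
  case True
  let ?p = "psiv \<nu>"
  define u where "u = enc q"
  define v where "v = enc r"
  have w: "u \<in> words \<nu>" "v \<in> words \<nu>" using True by (auto simp: u_def v_def enc_in_words[OF assms])
  have qr: "q = dec u" "r = dec v" using True by (auto simp: u_def v_def dec_enc)
  have "comult \<nu> (mult \<nu> x y) (q, r) = shsum ?p (u @ v) (\<lambda>a b. x (dec a) * y (dec b))"
    unfolding qr by (simp add: comult_dec w mult_dec words_append)
  also have "\<dots> = shsum ?p u (\<lambda>a c. shsum ?p v (\<lambda>b d. x (dec (a @ b)) * y (dec (c @ d))))"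
    by (rule shsum_append) (use w in \<open>auto simp: words_def\<close>)
  also have "\<dots> = shsum ?p u (\<lambda>a c. shsum ?p v (\<lambda>b d. comult \<nu> x (dec a, dec b) * comult \<nu> y (dec c, dec d)))"
    by (intro shsum_words_cong[OF assms w(1)] shsum_words_cong[OF assms w(2)]) (simp add: comult_dec)
  also have "\<dots> = mm_twist \<nu> (comult \<nu> x) (comult \<nu> y) (q, r)"
    unfolding qr mm_twist_def by (simp add: multT_dec w)
  finally show ?thesis .
qed (auto simp: comult_eq mm_twist_def multT_eq)

section \<open>The antipode\<close>

definition scf_antipode :: "nat \<Rightarrow> (pt \<Rightarrow> complex) \<Rightarrow> pt \<Rightarrow> complex" where
  "scf_antipode \<nu> F q = (if q \<in> pts \<nu> then antip (psiv \<nu>) (enc q) (\<lambda>l. F (dec l)) else 0)"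

lemma lin_on_scf_antipode: "lin_on \<nu> (scf_antipode \<nu>)"
  using op_lin_antip[of "psiv \<nu>"] by (auto simp: lin_on_def scf_antipode_def op_lin_def fun_eq_iff)

lemma scf_antipode_dec:
  "l \<in> words \<nu> \<Longrightarrow> scf_antipode \<nu> F (dec l) = antip (psiv \<nu>) l (\<lambda>l. F (dec l))"
  by (simp add: scf_antipode_def dec_in_pts enc_dec)

lemma scf_antipode_in_scfV:
  assumes "\<nu> > 0" "x \<in> scfV \<nu>"
  shows "scf_antipode \<nu> x \<in> scfV \<nu>"
proof -
  obtain D where D: "\<And>q. D \<le> fst q \<Longrightarrow> x q = 0" using scfV_bounded assms(2) by blast
  show ?thesis
  proof (rule scfVI[OF assms(1), where D = D])
    show "scf_antipode \<nu> x q \<noteq> 0 \<Longrightarrow> q \<in> pts \<nu>" for q by (auto simp: scf_antipode_def split: if_splits)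
  next
    fix l assume l: "l \<in> words \<nu>" "D \<le> length l"
    have "antip (psiv \<nu>) l (\<lambda>l. x (dec l)) = antip (psiv \<nu>) l (\<lambda>l. 0)"
      by (rule antip_words_cong[OF assms(1) l(1)]) (use D l in auto)
    then show "scf_antipode \<nu> x (dec l) = 0"
      by (simp add: scf_antipode_dec l op_lin_0[OF op_lin_antip])
  next
    fix l l' assume l: "l \<in> words \<nu>" "l' \<in> words \<nu>" "list_all2 sim l l'"
    have lzl: "lz l" using l by (simp add: words_def)
    show "scf_antipode \<nu> x (dec l) = scf_antipode \<nu> x (dec l')"
      unfolding scf_antipode_dec[OF l(1)] scf_antipode_dec[OF l(2)]
    proof (rule antip_rel[of "wsim \<nu>"])
      fix u u' assume *: "list_all2 (wsim \<nu>) u u'" "lz l \<Longrightarrow> lz u"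
      then show "x (dec u) = x (dec u')"
        using lzl wsim_words[OF *(1)] scfV_sim[OF assms(2)] by blast
    qed (use wsimI[OF l] assms(1) in \<open>auto simp: wsim_def sim_def psiv_def\<close>)
  qed
qed

text \<open>On words this is \<open>convol_antip_left\<close>. The congruence rules enter because
  \<open>comult\<close> is concatenation only on elements of \<open>words\<close>, a property that
  all parts inherit.\<close>

lemma scf_antipode_left:
  assumes "\<nu> > 0"
  shows "multT \<nu> (tens_left (scf_antipode \<nu>) (comult \<nu> x)) = (\<lambda>q. counitV x * unitV q)"
proof (rule eq_pts_words[OF assms])
  fix l assume l: "l \<in> words \<nu>"
  have "multT \<nu> (tens_left (scf_antipode \<nu>) (comult \<nu> x)) (dec l)
    = shsum (psiv \<nu>) l (\<lambda>a b. antip (psiv \<nu>) a (\<lambda>u. x (dec (u @ b))))"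
    unfolding multT_dec[OF l] tens_left_def prod.case
    by (intro shsum_words_cong[OF assms l])
      (auto simp: scf_antipode_dec comult_dec intro!: antip_words_cong[OF assms])
  also have "\<dots> = convol (psiv \<nu>) (antip (psiv \<nu>)) op_eval l (\<lambda>l. x (dec l))"
    by (simp add: convol_def op_eval_def)
  also have "\<dots> = counitV x * unitV (dec l)"
    by (simp add: convol_antip_left op_eps_def unitV_dec counitV_def)
  finally show "multT \<nu> (tens_left (scf_antipode \<nu>) (comult \<nu> x)) (dec l) = counitV x * unitV (dec l)" .
qed (auto simp: multT_eq unitV_def pts_def Qn_def)

lemma scf_antipode_right:
  assumes "\<nu> > 0"
  shows "multT \<nu> (tens_right (scf_antipode \<nu>) (comult \<nu> x)) = (\<lambda>q. counitV x * unitV q)"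
proof (rule eq_pts_words[OF assms])
  fix l assume l: "l \<in> words \<nu>"
  have "multT \<nu> (tens_right (scf_antipode \<nu>) (comult \<nu> x)) (dec l)
    = shsum (psiv \<nu>) l (\<lambda>a b. antip (psiv \<nu>) b (\<lambda>u. x (dec (a @ u))))"
    unfolding multT_dec[OF l] tens_right_def prod.case
    by (intro shsum_words_cong[OF assms l])
      (auto simp: scf_antipode_dec comult_dec intro!: antip_words_cong[OF assms])
  also have "\<dots> = convol (psiv \<nu>) op_eval (antip (psiv \<nu>)) l (\<lambda>l. x (dec l))"
    by (simp add: convol_def op_eval_def)
  also have "\<dots> = counitV x * unitV (dec l)"
    by (simp add: convol_antip_right op_eps_def unitV_dec counitV_def)
  finally show "multT \<nu> (tens_right (scf_antipode \<nu>) (comult \<nu> x)) (dec l) = counitV x * unitV (dec l)" .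
qed (auto simp: multT_eq unitV_def pts_def Qn_def)

lemma comult_unitV: "\<nu> > 0 \<Longrightarrow> comult \<nu> unitV = (\<lambda>(a, b). unitV a * unitV b)"
  by (auto simp: fun_eq_iff comult_eq unitV_def pts_def Qn_def enc_def)

lemma counitV_mult: "counitV (mult \<nu> x y) = counitV x * counitV y"
  using mult_dec[of "[]" \<nu> x y] by (simp add: counitV_def shsum_def)

lemma hopf_scf_holds:
  assumes "\<nu> > 1"
  shows "hopf_scf \<nu>"
proof -
  have \<nu>: "\<nu> > 0" using assms by simp
  have S: "lin_on \<nu> (scf_antipode \<nu>) \<and> (\<forall>x\<in>scfV \<nu>. scf_antipode \<nu> x \<in> scfV \<nu>) \<and>
       (\<forall>x\<in>scfV \<nu>.
          multT \<nu> (tens_left (scf_antipode \<nu>) (comult \<nu> x)) = (\<lambda>p. counitV x * unitV p) \<and>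
          multT \<nu> (tens_right (scf_antipode \<nu>) (comult \<nu> x)) = (\<lambda>p. counitV x * unitV p))"
    by (simp add: lin_on_scf_antipode scf_antipode_in_scfV[OF \<nu>] scf_antipode_left[OF \<nu>] scf_antipode_right[OF \<nu>])
  have counit: "counitV unitV = 1" by (simp add: counitV_def unitV_def)
  have bialg: "comult \<nu> (mult \<nu> x y) = mm_twist \<nu> (comult \<nu> x) (comult \<nu> y)" for x y
    by (rule ext) (simp only: split_paired_all comult_mult[OF \<nu>])
  have coassoc: "(\<lambda>(a, b, c). comult \<nu> (\<lambda>a'. comult \<nu> x (a', c)) (a, b))
      = (\<lambda>(a, b, c). comult \<nu> (\<lambda>b'. comult \<nu> x (a, b')) (b, c))" for x
    by (simp only: comult_coassoc[OF \<nu>])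
  have counits: "(\<lambda>q. counitV (\<lambda>a. comult \<nu> x (a, q))) = x" "(\<lambda>q. counitV (\<lambda>a. comult \<nu> x (q, a))) = x"
    if "x \<in> scfV \<nu>" for x
    using counit_comult[OF \<nu> that] by auto
  show ?thesis unfolding hopf_scf_def
    by (intro conjI ballI exI[of _ "scf_antipode \<nu>"] S[THEN conjunct1] S[THEN conjunct2, THEN conjunct1, rule_format]
      S[THEN conjunct2, THEN conjunct2, rule_format, THEN conjunct1]
      S[THEN conjunct2, THEN conjunct2, rule_format, THEN conjunct2]
      unitV_in_scfV[OF \<nu>] mult_in_scfV[OF \<nu>] comult_in_scfVV[OF assms] mult_assoc[OF \<nu>]
      mult_unit_left[OF \<nu>] mult_unit_right[OF \<nu>] coassoc counits bialg comult_unitV[OF \<nu>] counitV_mult counit)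
qed

section \<open>Coefficients of monomial quasisymmetric functions\<close>

text \<open>A mask entry \<open>True\<close> marks a partial sum of the composition. Inserting the
  letters 0 and 1 is enough, since a superclass function does not distinguish nonzero
  letters.\<close>

primrec mcoef :: "complex \<Rightarrow> bool list \<Rightarrow> (nat list \<Rightarrow> complex) \<Rightarrow> complex" where
  "mcoef q [] f = f []"
| "mcoef q (b # m) f = (if b then mcoef q m (\<lambda>g. f (0 # g))
     else (mcoef q m (\<lambda>g. f (0 # g)) - mcoef q m (\<lambda>g. f (1 # g))) / (1 - q))"

lemma mcoef_add: "mcoef q m (\<lambda>g. f g + f' g) = mcoef q m f + mcoef q m f'"
  by (induction m arbitrary: f f') (auto simp: diff_divide_distrib add_divide_distrib)

lemma mcoef_cmult: "mcoef q m (\<lambda>g. c * f g) = c * mcoef q m f"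
  by (induction m arbitrary: f) (auto simp: algebra_simps)

lemma mcoef_cmult_right: "mcoef q m (\<lambda>g. f g * c) = mcoef q m f * c"
  using mcoef_cmult[of q m c f] by (simp add: mult.commute)

lemma mcoef_0 [simp]: "mcoef q m (\<lambda>g. 0) = 0"
  using mcoef_cmult[of q m 0] by simp

lemma mcoef_sum: "mcoef q m (\<lambda>g. \<Sum>i\<in>I. f i g) = (\<Sum>i\<in>I. mcoef q m (f i))"
  by (induction I rule: infinite_finite_induct) (simp_all add: mcoef_add)

lemma op_lin_mcoef: "op_lin (\<lambda>_. mcoef q m)"
  by (simp add: op_lin_def mcoef_add mcoef_cmult)

lemma mcoef_shsum: "mcoef q m (\<lambda>h. shsum p k (\<Phi> h)) = shsum p k (\<lambda>x y. mcoef q m (\<lambda>h. \<Phi> h x y))"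
  using op_lin_shsum[OF op_lin_mcoef] .

lemma mcoef_append: "mcoef q (m @ k) f = mcoef q m (\<lambda>u. mcoef q k (\<lambda>v. f (u @ v)))"
  by (induction m arbitrary: f) simp_all

lemma mcoef_swap: "mcoef q m (\<lambda>g. mcoef q k (\<Phi> g)) = mcoef q k (\<lambda>h. mcoef q m (\<lambda>g. \<Phi> g h))"
proof (induction m arbitrary: \<Phi>)
  case (Cons b m)
  have "mcoef q k (\<lambda>h. (f h - f' h) / (1 - q)) = (mcoef q k f - mcoef q k f') / (1 - q)" for f f'
    using mcoef_add[of q k "\<lambda>h. f h / (1 - q)" "\<lambda>h. - f' h / (1 - q)"]
      mcoef_cmult[of q k "1 / (1 - q)" f] mcoef_cmult[of q k "- 1 / (1 - q)" f']
    by (simp add: diff_divide_distrib)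
  then show ?case using Cons.IH by simp
qed simp

text \<open>A final \<open>True\<close> evaluates the last letter at 0, so only words with a closing
  0 have to be compared.\<close>

lemma mcoef_cong:
  assumes "\<And>g. length g = length m \<Longrightarrow> (\<forall>x\<in>set g. x \<le> 1) \<Longrightarrow> (m = [] \<or> last m \<Longrightarrow> lz g) \<Longrightarrow> f g = f' g"
  shows "mcoef q m f = mcoef q m f'"
  using assms
proof (induction m arbitrary: f f')
  case Nil
  then show ?case by (simp add: lz_def)
next
  case (Cons b m)
  have lzc: "lz (a # g) \<longleftrightarrow> lz g" if "length g = length m" "m \<noteq> []" for a g
    using that by (auto simp: lz_def)
  have 0: "mcoef q m (\<lambda>g. f (0 # g)) = mcoef q m (\<lambda>g. f' (0 # g))"
    by (rule Cons.IH, rule Cons.prems) (auto simp: lzc lz_def split: if_splits)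
  have 1: "mcoef q m (\<lambda>g. f (1 # g)) = mcoef q m (\<lambda>g. f' (1 # g))" if "\<not> b"
    by (rule Cons.IH, rule Cons.prems) (use that in \<open>auto simp: lzc lz_def split: if_splits\<close>)
  show ?case using 0 1 by simp
qed

section \<open>Masks of compositions and shuffle sums over a block\<close>

definition bmask :: "nat \<Rightarrow> bool list" where
  "bmask a = (if a = 0 then [] else replicate (a - 1) False @ [True])"

definition dmask :: "nat list \<Rightarrow> bool list" where
  "dmask \<alpha> = concat (map bmask \<alpha>)"

lemma dmask_simps [simp]: "dmask [] = []" "dmask (a # \<alpha>) = bmask a @ dmask \<alpha>"
  by (simp_all add: dmask_def)

lemma dmask_append: "dmask (\<alpha> @ \<beta>) = dmask \<alpha> @ dmask \<beta>"
  by (simp add: dmask_def)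

lemma bmask_0 [simp]: "bmask 0 = []" by (simp add: bmask_def)

lemma bmask_1: "bmask (Suc 0) = [True]" by (simp add: bmask_def)

lemma bmask_Suc: "a > 0 \<Longrightarrow> bmask (Suc a) = False # bmask a"
  by (cases a) (simp_all add: bmask_def)

lemma length_bmask [simp]: "length (bmask a) = a" by (simp add: bmask_def)

lemma length_dmask: "length (dmask \<alpha>) = sum_list \<alpha>"
  by (induction \<alpha>) simp_all

lemma dmask_filter: "dmask (filter (\<lambda>a. a \<noteq> 0) \<alpha>) = dmask \<alpha>"
  by (induction \<alpha>) simp_all

lemma last_dmask: "dmask \<alpha> = [] \<or> last (dmask \<alpha>)"
  by (induction \<alpha>) (auto simp: bmask_def)

text \<open>Changes out of A are killed, so a word starting in A stays there and any other word
  enters A at most once. Let b count the positions before A. The last of them is cleared on entering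
  A, or evaluated at 0 by the end of the block if b = a; in both cases the functional left on these
  positions is that of \<open>bmask b\<close>, and the rest of the block has mask
  \<open>bmask (a - b)\<close>.\<close>

lemma mcoef_bmask_shuf:
  assumes p: "p 0 = 1" "p 1 = q" "q \<noteq> 1" and "a > 0"
  shows "mcoef q (bmask a) (\<lambda>h. shuf p True h \<Phi>) = mcoef q (bmask a) (\<Phi> [])"
    and "mcoef q (bmask a) (\<lambda>h. shuf p False h \<Phi>) =
      (\<Sum>b\<in>{1..a}. mcoef q (bmask b) (\<lambda>u. mcoef q (bmask (a - b)) (\<Phi> u)))"
proof -
  have "mcoef q (bmask a) (\<lambda>h. shuf p True h \<Phi>) = mcoef q (bmask a) (\<Phi> []) \<and>
    mcoef q (bmask a) (\<lambda>h. shuf p False h \<Phi>) =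
      (\<Sum>b\<in>{1..a}. mcoef q (bmask b) (\<lambda>u. mcoef q (bmask (a - b)) (\<Phi> u)))"
    using \<open>a > 0\<close>
  proof (induction a arbitrary: \<Phi> rule: nat_induct_non_zero)
    case 1
    then show ?case by (simp add: bmask_1)
  next
    case (Suc a)
    have T: "mcoef q (bmask a) (\<lambda>g. shuf p True (h # g) \<Phi>)
        = mcoef q (bmask a) (\<lambda>v. \<Phi> [] (h # v)) + mcoef q (bmask a) (\<lambda>g. shuf p False g (\<lambda>x y. \<Phi> x (0 # y)))" for h
    proof -
      have "mcoef q (bmask a) (\<lambda>g. shuf p True (h # g) \<Phi>)
        = mcoef q (bmask a) (\<lambda>g. shuf p True g (\<lambda>x y. \<Phi> x (h # y)) + shuf p False g (\<lambda>x y. \<Phi> x (0 # y)))"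
        by (rule mcoef_cong) (use Suc.hyps in auto)
      then show ?thesis using Suc.IH[of "\<lambda>x y. \<Phi> x (h # y)"] by (simp add: mcoef_add)
    qed
    have F: "mcoef q (bmask a) (\<lambda>g. shuf p False (h # g) \<Phi>)
        = (\<Sum>b\<in>{1..a}. mcoef q (bmask b) (\<lambda>u. mcoef q (bmask (a - b)) (\<Phi> (h # u)))) + p h * mcoef q (bmask a) (\<Phi> [0])" for h
    proof -
      have "mcoef q (bmask a) (\<lambda>g. shuf p False (h # g) \<Phi>)
        = mcoef q (bmask a) (\<lambda>g. shuf p False g (\<lambda>x y. \<Phi> (h # x) y) + p h * shuf p True g (\<lambda>x y. \<Phi> (0 # x) y))"
        by (rule mcoef_cong) (use Suc.hyps in auto)
      then show ?thesis using Suc.IH[of "\<lambda>x y. \<Phi> (h # x) y"] Suc.IH[of "\<lambda>x y. \<Phi> (0 # x) y"]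
        by (simp add: mcoef_add mcoef_cmult)
    qed
    have q: "1 - q \<noteq> 0" using p by simp
    \<comment> \<open>The second summand of \<open>T\<close> does not contain \<open>h\<close> and
      cancels in the difference of the values at 0 and 1.\<close>
    have "mcoef q (bmask (Suc a)) (\<lambda>h. shuf p True h \<Phi>) = mcoef q (bmask (Suc a)) (\<Phi> [])"
      unfolding bmask_Suc[OF Suc.hyps] mcoef.simps T by simp
    moreover have "mcoef q (bmask (Suc a)) (\<lambda>h. shuf p False h \<Phi>)
      = (\<Sum>b\<in>{1..a}. mcoef q (bmask (Suc b)) (\<lambda>u. mcoef q (bmask (a - b)) (\<Phi> u))) + mcoef q (bmask a) (\<Phi> [0])"
    proof -
      let ?A = "\<lambda>h. \<Sum>b\<in>{1..a}. mcoef q (bmask b) (\<lambda>u. mcoef q (bmask (a - b)) (\<Phi> (h # u)))"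
      have "(\<Sum>b\<in>{1..a}. mcoef q (bmask (Suc b)) (\<lambda>u. mcoef q (bmask (a - b)) (\<Phi> u))) = (?A 0 - ?A 1) / (1 - q)"
        unfolding sum_subtractf[symmetric] sum_divide_distrib
        by (rule sum.cong) (simp_all add: bmask_Suc)
      moreover have "mcoef q (bmask (Suc a)) (\<lambda>h. shuf p False h \<Phi>)
        = ((?A 0 + mcoef q (bmask a) (\<Phi> [0])) - (?A 1 + q * mcoef q (bmask a) (\<Phi> [0]))) / (1 - q)"
        unfolding bmask_Suc[OF Suc.hyps] mcoef.simps F p by simp
      \<comment> \<open>Here z belongs to the word that enters A right after the first position. Its
        weights 1 and q leave z - q z, which the divisor turns into z.\<close>
      moreover have "((c + z) - (d + q * z)) / (1 - q) = (c - d) / (1 - q) + z" for c d z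
        using q by (simp add: field_simps)
      ultimately show ?thesis by presburger
    qed
    \<comment> \<open>The term b = 1 is the word with only the first position outside A; for the
      other terms b is shifted by one.\<close>
    moreover have "(\<Sum>b\<in>{1..Suc a}. mcoef q (bmask b) (\<lambda>u. mcoef q (bmask (Suc a - b)) (\<Phi> u)))
      = mcoef q (bmask a) (\<Phi> [0]) + (\<Sum>b\<in>{1..a}. mcoef q (bmask (Suc b)) (\<lambda>u. mcoef q (bmask (a - b)) (\<Phi> u)))"
    proof -
      have "sum f {1..Suc a} = f 1 + (\<Sum>b\<in>{1..a}. f (Suc b))" for f :: "nat \<Rightarrow> complex"
        using sum.atLeast_Suc_atMost[of 1 "Suc a" f] by (simp add: sum.shift_bounds_cl_Suc_ivl del: sum.cl_ivl_Suc)
      then show ?thesis by (simp add: bmask_1 del: sum.cl_ivl_Suc)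
    qed
    ultimately show ?case by simp
  qed
  then show "mcoef q (bmask a) (\<lambda>h. shuf p True h \<Phi>) = mcoef q (bmask a) (\<Phi> [])"
    "mcoef q (bmask a) (\<lambda>h. shuf p False h \<Phi>) =
      (\<Sum>b\<in>{1..a}. mcoef q (bmask b) (\<lambda>u. mcoef q (bmask (a - b)) (\<Phi> u)))" by auto
qed

text \<open>The summand b = 0 is the word that lies entirely in A; the others start outside
  A.\<close>

lemma mcoef_bmask_shsum:
  assumes p: "p 0 = 1" "p 1 = q" "q \<noteq> 1"
  shows "mcoef q (bmask a) (\<lambda>h. shsum p h \<Phi>) =
      (\<Sum>b\<le>a. mcoef q (bmask b) (\<lambda>u. mcoef q (bmask (a - b)) (\<Phi> u)))"
proof (cases "a = 0")
  case True
  then show ?thesis by (simp add: shsum_def)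
next
  case False
  have "mcoef q (bmask a) (\<lambda>h. shsum p h \<Phi>) = mcoef q (bmask a) (\<lambda>h. shuf p True h \<Phi> + shuf p False h \<Phi>)"
    by (rule mcoef_cong) (use False in \<open>auto simp: shsum_def\<close>)
  moreover have "{..a} = insert 0 {1..a}" by auto
  ultimately show ?thesis using False mcoef_bmask_shuf[of p q a, OF p] by (simp add: mcoef_add)
qed

text \<open>Zero entries are harmless in the sum below: it is applied to functions that depend on the
  lists only through dmask, which ignores them.\<close>

primrec lconv :: "nat list \<Rightarrow> (nat list \<Rightarrow> nat list \<Rightarrow> complex) \<Rightarrow> complex" where
  "lconv [] G = G [] []"
| "lconv (a # \<alpha>) G = (\<Sum>b\<le>a. lconv \<alpha> (\<lambda>\<beta> \<gamma>. G (b # \<beta>) ((a - b) # \<gamma>)))"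

lemma mcoef_lconv: "mcoef q m (\<lambda>u. lconv \<alpha> (G u)) = lconv \<alpha> (\<lambda>\<beta> \<gamma>. mcoef q m (\<lambda>u. G u \<beta> \<gamma>))"
  by (induction \<alpha> arbitrary: G) (simp_all add: mcoef_sum)

text \<open>Each block ends with an evaluation at 0, so \<open>shsum_append\<close> splits it off,
  and a block of size a contributes its splittings into b and a - b.\<close>

lemma mcoef_dmask_shsum:
  assumes p: "p 0 = 1" "p 1 = q" "q \<noteq> 1"
  shows "mcoef q (dmask \<alpha>) (\<lambda>h. shsum p h \<Phi>) =
    lconv \<alpha> (\<lambda>\<beta> \<gamma>. mcoef q (dmask \<beta>) (\<lambda>u. mcoef q (dmask \<gamma>) (\<Phi> u)))"
proof (induction \<alpha> arbitrary: \<Phi>)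
  case Nil
  then show ?case by (simp add: shsum_def)
next
  case (Cons a \<alpha>)
  let ?\<Psi> = "\<lambda>u v. lconv \<alpha> (\<lambda>\<beta> \<gamma>. mcoef q (dmask \<beta>) (\<lambda>u'. mcoef q (dmask \<gamma>) (\<lambda>v'. \<Phi> (u @ u') (v @ v'))))"
  have lz: "lz h" if "length h = length (bmask a)" "bmask a = [] \<or> last (bmask a) \<Longrightarrow> lz h" for h
    using that(2) by (auto simp: bmask_def split: if_splits)
  have "mcoef q (dmask (a # \<alpha>)) (\<lambda>h. shsum p h \<Phi>)
    = mcoef q (bmask a) (\<lambda>h. mcoef q (dmask \<alpha>) (\<lambda>k. shsum p (h @ k) \<Phi>))"
    by (simp add: mcoef_append)
  also have "\<dots> = mcoef q (bmask a) (\<lambda>h. shsum p h ?\<Psi>)"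
  proof (rule mcoef_cong)
    fix h assume "length h = length (bmask a)" "bmask a = [] \<or> last (bmask a) \<Longrightarrow> lz h"
    then have "lz h" using lz by blast
    then show "mcoef q (dmask \<alpha>) (\<lambda>k. shsum p (h @ k) \<Phi>) = shsum p h ?\<Psi>"
      by (simp add: shsum_append[of p, OF p(1)] mcoef_shsum Cons.IH)
  qed
  also have "\<dots> = (\<Sum>b\<le>a. mcoef q (bmask b) (\<lambda>u. mcoef q (bmask (a - b)) (?\<Psi> u)))"
    by (rule mcoef_bmask_shsum[of p, OF p])
  also have "\<dots> = (\<Sum>b\<le>a. lconv \<alpha> (\<lambda>\<beta> \<gamma>. mcoef q (bmask b) (\<lambda>u. mcoef q (bmask (a - b)) (\<lambda>v.
      mcoef q (dmask \<beta>) (\<lambda>u'. mcoef q (dmask \<gamma>) (\<lambda>v'. \<Phi> (u @ u') (v @ v')))))))"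
    by (simp add: mcoef_lconv)
  also have "\<dots> = lconv (a # \<alpha>) (\<lambda>\<beta> \<gamma>. mcoef q (dmask \<beta>) (\<lambda>u. mcoef q (dmask \<gamma>) (\<Phi> u)))"
  proof -
    \<comment> \<open>The functionals act on separate variables; the interchange brings those for
      the first factor next to each other.\<close>
    have "mcoef q (bmask c) (\<lambda>v. mcoef q (dmask \<beta>) (\<lambda>u'. mcoef q (dmask \<gamma>) (\<lambda>v'. \<Phi> (u @ u') (v @ v'))))
      = mcoef q (dmask \<beta>) (\<lambda>u'. mcoef q (bmask c) (\<lambda>v. mcoef q (dmask \<gamma>) (\<lambda>v'. \<Phi> (u @ u') (v @ v'))))" for c \<beta> \<gamma> u
      by (rule mcoef_swap)
    then show ?thesis by (simp add: mcoef_append)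
  qed
  finally show ?case .
qed

section \<open>Products of power series as splittings of exponents\<close>

lemma compof_filter:
  assumes "sorted s" "distinct s" "{i. e i \<noteq> 0} \<subseteq> set s"
  shows "compof e = filter (\<lambda>a. a \<noteq> 0) (map e s)"
proof -
  have "{i. e i \<noteq> 0} = set (filter (\<lambda>i. e i \<noteq> 0) s)" using assms(3) by auto
  then have "sorted_list_of_set {i. e i \<noteq> 0} = sorted_list_of_set (set (filter (\<lambda>i. e i \<noteq> 0) s))" by (rule arg_cong)
  also have "\<dots> = filter (\<lambda>i. e i \<noteq> 0) s"
    by (rule sorted_list_of_set.idem_if_sorted_distinct) (use assms in \<open>auto simp: sorted_wrt_filter\<close>)
  finally show ?thesis by (simp add: compof_def filter_map comp_def)
qed

text \<open>The index set of \<open>qmult\<close>, listed along the support of \<open>e\<close>,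
  consists of the componentwise splittings over which \<open>lconv\<close> sums. Induction separates
  the exponent of the first variable, which ranges over 0, ..., \<open>e j\<close>.\<close>

lemma sum_below_lconv:
  assumes "distinct s" "{i. e i \<noteq> 0} \<subseteq> set s"
  shows "finite {e1. \<forall>i. e1 i \<le> e i} \<and>
    (\<Sum>e1\<in>{e1. \<forall>i. e1 i \<le> (e i :: nat)}. G (map e1 s) (map (\<lambda>i. e i - e1 i) s)) = lconv (map e s) G"
  using assms
proof (induction s arbitrary: e G)
  case Nil
  then have "{e1. \<forall>i. e1 i \<le> e i} = {\<lambda>_. 0}" by auto
  then show ?case by simp
next
  case (Cons j s)
  define e' where "e' = e(j := 0)"
  have "{i. e' i \<noteq> 0} \<subseteq> set s" using Cons.prems by (auto simp: e'_def)
  note IH = Cons.IH[OF _ this]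
  let ?B = "{e1. \<forall>i. e1 i \<le> e' i}"
  have ds: "distinct s" "j \<notin> set s" using Cons.prems by auto
  have finB: "finite ?B" using IH ds by blast
  have bij: "bij_betw (\<lambda>(b, e1). e1(j := b)) ({..e j} \<times> ?B) {e1. \<forall>i. e1 i \<le> e i}"
  proof (rule bij_betw_byWitness[where f' = "\<lambda>e1. (e1 j, e1(j := 0))"])
    show "\<forall>a\<in>{..e j} \<times> ?B. (\<lambda>e1. (e1 j, e1(j := 0))) ((\<lambda>(b, e1). e1(j := b)) a) = a"
    proof (clarsimp simp: e'_def)
      fix b e1 assume "\<forall>i. (i = j \<longrightarrow> e1 j = 0) \<and> (i \<noteq> j \<longrightarrow> e1 i \<le> e i)"
      then show "e1(j := 0) = e1" by auto
    qed
  qed (auto simp: e'_def)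
  have fin: "finite {e1. \<forall>i. e1 i \<le> e i}" using bij_betw_finite[OF bij] finB by simp
  have "(\<Sum>e1\<in>{e1. \<forall>i. e1 i \<le> e i}. G (map e1 (j # s)) (map (\<lambda>i. e i - e1 i) (j # s)))
    = (\<Sum>(b, e1)\<in>{..e j} \<times> ?B. G (map (e1(j := b)) (j # s)) (map (\<lambda>i. e i - (e1(j := b)) i) (j # s)))"
    unfolding sum.reindex_bij_betw[OF bij, symmetric] by (simp add: split_beta)
  also have "\<dots> = (\<Sum>(b, e1)\<in>{..e j} \<times> ?B. G (b # map e1 s) ((e j - b) # map (\<lambda>i. e' i - e1 i) s))"
  proof (rule sum.cong)
    fix z assume "z \<in> {..e j} \<times> ?B"
    have *: "map (e1(j := b)) s = map e1 s" "map (\<lambda>i. e i - (e1(j := b)) i) s = map (\<lambda>i. e' i - e1 i) s" for b e1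
      using ds by (auto simp: e'_def)
    then show "(case z of (b, e1) \<Rightarrow> G (map (e1(j := b)) (j # s)) (map (\<lambda>i. e i - (e1(j := b)) i) (j # s)))
       = (case z of (b, e1) \<Rightarrow> G (b # map e1 s) ((e j - b) # map (\<lambda>i. e' i - e1 i) s))"
      by (cases z) (simp only: prod.case list.map fun_upd_same *)
  qed simp
  also have "\<dots> = (\<Sum>b\<le>e j. \<Sum>e1\<in>?B. G (b # map e1 s) ((e j - b) # map (\<lambda>i. e' i - e1 i) s))"
    by (simp add: sum.cartesian_product)
  also have "\<dots> = (\<Sum>b\<le>e j. lconv (map e' s) (\<lambda>\<beta> \<gamma>. G (b # \<beta>) ((e j - b) # \<gamma>)))"
  proof (rule sum.cong)
    fix b
    show "(\<Sum>e1\<in>?B. G (b # map e1 s) ((e j - b) # map (\<lambda>i. e' i - e1 i) s))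
      = lconv (map e' s) (\<lambda>\<beta> \<gamma>. G (b # \<beta>) ((e j - b) # \<gamma>))"
      using IH[OF ds(1), of "\<lambda>\<beta> \<gamma>. G (b # \<beta>) ((e j - b) # \<gamma>)"] by simp
  qed simp
  also have "map e' s = map e s" using ds by (auto simp: e'_def)
  finally show ?case using fin by simp
qed

section \<open>The characteristic map\<close>

lemma bmask_nth: "i < a \<Longrightarrow> bmask a ! i \<longleftrightarrow> Suc i = a"
  by (cases "i < a - 1") (auto simp: bmask_def nth_append)

text \<open>An arbitrary starting point \<open>a\<close> is needed for the induction: the
  differences of the tail start at the first element of the list instead of 0.\<close>

lemma is_comp_diffs:
  assumes "sorted_wrt (<) s" "\<And>x. x \<in> set s \<Longrightarrow> a < x \<and> x < n" "a < n"
  shows "is_comp (map2 (\<lambda>a b. b - a) (a # s) (s @ [n])) \<and>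
    dmask (map2 (\<lambda>a b. b - a) (a # s) (s @ [n])) = map (\<lambda>i. i \<in> set s \<or> i = n) [Suc a..<Suc n]"
  using assms
proof (induction s arbitrary: a)
  case Nil
  then show ?case
    by (auto simp: is_comp_def bmask_nth simp del: upt_Suc intro!: nth_equalityI)
next
  case (Cons x s)
  have x: "a < x" "x < n" using Cons.prems by auto
  have IH: "is_comp (map2 (\<lambda>a b. b - a) (x # s) (s @ [n]))"
    "dmask (map2 (\<lambda>a b. b - a) (x # s) (s @ [n])) = map (\<lambda>i. i \<in> set s \<or> i = n) [Suc x..<Suc n]"
    using Cons.IH[of x] Cons.prems by auto
  have "[Suc a..<Suc n] = [Suc a..<Suc x] @ [Suc x..<Suc n]"
    using upt_add_eq_append[of "Suc a" "Suc x" "n - x"] x by simp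
  moreover have "map (\<lambda>i. i \<in> set (x # s) \<or> i = n) [Suc a..<Suc x] = bmask (x - a)"
  proof -
    have "(j \<in> set (x # s) \<or> j = n) \<longleftrightarrow> j = x" if "j \<le> x" for j
      using x Cons.prems(1) that by auto
    then have "map (\<lambda>i. i \<in> set (x # s) \<or> i = n) [Suc a..<Suc x] = map (\<lambda>i. i = x) [Suc a..<Suc x]"
      by (intro map_cong) (auto simp del: upt_Suc)
    also have "\<dots> = bmask (x - a)"
      using x by (auto simp: bmask_nth simp del: upt_Suc intro!: nth_equalityI)
    finally show ?thesis .
  qed
  moreover have "map (\<lambda>i. i \<in> set (x # s) \<or> i = n) [Suc x..<Suc n] = map (\<lambda>i. i \<in> set s \<or> i = n) [Suc x..<Suc n]"
    by (rule map_cong) auto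
  ultimately show ?case using IH x by (simp add: is_comp_def del: upt_Suc)
qed

lemma replicate_False_True_eq:
  "replicate k False @ True # x = replicate l False @ True # y \<Longrightarrow> k = l \<and> x = y"
proof (induction k arbitrary: l)
  case 0
  then show ?case by (cases l) auto
next
  case (Suc k)
  then show ?case by (cases l) auto
qed

text \<open>The parts are the distances between consecutive \<open>True\<close> entries; positivity
  excludes parts that leave no trace in the mask.\<close>

lemma dmask_inject: "is_comp \<alpha> \<Longrightarrow> is_comp \<beta> \<Longrightarrow> dmask \<alpha> = dmask \<beta> \<Longrightarrow> \<alpha> = \<beta>"
proof (induction \<alpha> arbitrary: \<beta>)
  case Nil
  then show ?case by (cases \<beta>) (auto simp: is_comp_def bmask_def)
next
  case (Cons a \<alpha>)
  then obtain b \<beta>' where \<beta>: "\<beta> = b # \<beta>'"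
    by (cases \<beta>) (auto simp: is_comp_def bmask_def)
  have "replicate (a - 1) False @ True # dmask \<alpha> = replicate (b - 1) False @ True # dmask \<beta>'"
    using Cons.prems by (auto simp: \<beta> is_comp_def bmask_def)
  then have "a - 1 = b - 1" "dmask \<alpha> = dmask \<beta>'" using replicate_False_True_eq by blast+
  then show ?case using Cons.IH[of \<beta>'] Cons.prems by (auto simp: \<beta> is_comp_def)
qed

lemma compI_mask:
  assumes "n > 0" "J \<subseteq> {1..n - 1}"
  shows "is_comp (compI n J)" "dmask (compI n J) = map (\<lambda>i. i \<in> J \<or> i = n) [1..<Suc n]"
proof -
  have fin: "finite J" using assms(2) finite_subset by blast
  have "\<And>x. x \<in> J \<Longrightarrow> 0 < x \<and> x < n" using assms by fastforce
  then show "is_comp (compI n J)" "dmask (compI n J) = map (\<lambda>i. i \<in> J \<or> i = n) [1..<Suc n]"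
    using is_comp_diffs[of "sorted_list_of_set J" 0 n] assms(1) fin
    by (simp_all add: compI_def Let_def del: upt_Suc)
qed

lemma compI_eq_iff:
  assumes "n > 0" "J \<subseteq> {1..n - 1}" "is_comp \<alpha>"
  shows "compI n J = \<alpha> \<longleftrightarrow> dmask \<alpha> = map (\<lambda>i. i \<in> J \<or> i = n) [1..<Suc n]"
  using compI_mask[OF assms(1,2)] dmask_inject[OF _ assms(3)] by metis

lemma is_comp_compof: "fsupp e \<Longrightarrow> is_comp (compof e)"
  by (auto simp: is_comp_def compof_def fsupp_def)

lemma is_comp_sum_0: "is_comp \<alpha> \<Longrightarrow> sum_list \<alpha> = 0 \<Longrightarrow> \<alpha> = []"
  by (cases \<alpha>) (auto simp: is_comp_def)

lemma last_nth_dmask: "n > 0 \<Longrightarrow> length (dmask \<alpha>) = n \<Longrightarrow> dmask \<alpha> ! (n - 1)"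
  using last_dmask[of \<alpha>] by (auto simp: last_conv_nth)

text \<open>A composition of n comes from exactly one subset of 1, ..., n - 1, so at most one
  summand of L survives at \<open>e\<close>, and it occurs if this subset contains
  \<open>I\<close>.\<close>

lemma Lfun_eq:
  assumes e: "fsupp e" and I: "I \<subseteq> {1..n - 1}"
  shows "Lfun n I e = (if length (dmask (compof e)) = n \<and> (\<forall>i\<in>I. dmask (compof e) ! (i - 1)) then 1 else 0)"
proof (cases "n = 0")
  case True
  have "{J. I \<subseteq> J \<and> J \<subseteq> {1..n - 1}} = {{}}" using I True by auto
  moreover have "compof e = [] \<longleftrightarrow> sum_list (compof e) = 0"
    using is_comp_sum_0[OF is_comp_compof[OF e]] by auto
  moreover have "I = {}" using I True by auto
  ultimately show ?thesis using e True by (simp add: Lfun_def Mfun_def compI_def length_dmask)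
next
  case False
  let ?\<alpha> = "compof e"
  have n: "n > 0" using False by simp
  \<comment> \<open>The partial sums below n of the composition; position i has list index i -
    1.\<close>
  define J0 where "J0 = {i \<in> {1..n - 1}. dmask ?\<alpha> ! (i - 1)}"
  have eq: "compI n J = ?\<alpha> \<longleftrightarrow> length (dmask ?\<alpha>) = n \<and> J = J0" if J: "J \<subseteq> {1..n - 1}" for J
  proof -
    have "dmask ?\<alpha> = map (\<lambda>i. i \<in> J \<or> i = n) [1..<Suc n] \<longleftrightarrow> length (dmask ?\<alpha>) = n \<and> J = J0"
    proof
      assume d: "dmask ?\<alpha> = map (\<lambda>i. i \<in> J \<or> i = n) [1..<Suc n]"
      have "i \<in> J \<longleftrightarrow> i \<in> J0" for i
      proof (cases "i \<in> {1..n - 1}")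
        case True
        then show ?thesis unfolding J0_def d by (auto simp del: upt_Suc)
      next
        case False
        then show ?thesis using J by (auto simp: J0_def)
      qed
      then show "length (dmask ?\<alpha>) = n \<and> J = J0" using d by (auto simp del: upt_Suc)
    next
      assume *: "length (dmask ?\<alpha>) = n \<and> J = J0"
      show "dmask ?\<alpha> = map (\<lambda>i. i \<in> J \<or> i = n) [1..<Suc n]"
      proof (rule nth_equalityI)
        fix i assume i: "i < length (dmask ?\<alpha>)"
        show "dmask ?\<alpha> ! i = map (\<lambda>i. i \<in> J \<or> i = n) [1..<Suc n] ! i"
        proof (cases "Suc i = n")
          case True
          then show ?thesis using last_nth_dmask[OF n, of ?\<alpha>] * by (auto simp del: upt_Suc)
        next
          case False
          then have "Suc i \<in> {1..n - 1}" using i * by auto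
          then show ?thesis using i * False by (auto simp: J0_def simp del: upt_Suc)
        qed
      qed (use * in auto)
    qed
    then show ?thesis using compI_eq_iff[OF n J is_comp_compof[OF e]] by simp
  qed
  have "Lfun n I e = (\<Sum>J\<in>{J. I \<subseteq> J \<and> J \<subseteq> {1..n - 1}}. if J = J0 then (if length (dmask ?\<alpha>) = n then 1 else 0) else 0)"
    unfolding Lfun_def
  proof (rule sum.cong)
    fix J assume "J \<in> {J. I \<subseteq> J \<and> J \<subseteq> {1..n - 1}}"
    then have J: "J \<subseteq> {1..n - 1}" by simp
    have M: "Mfun (compI n J) e = (if compI n J = ?\<alpha> then 1 else 0)" using e by (auto simp: Mfun_def)
    show "Mfun (compI n J) e = (if J = J0 then (if length (dmask ?\<alpha>) = n then 1 else 0) else 0)"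
      unfolding M eq[OF J] by simp
  qed simp
  moreover have "finite {J. I \<subseteq> J \<and> J \<subseteq> {1..n - 1}}" by (rule finite_subset[of _ "Pow {1..n - 1}"]) auto
  moreover have "J0 \<subseteq> {1..n - 1}" "I \<subseteq> J0 \<longleftrightarrow> (\<forall>i\<in>I. dmask ?\<alpha> ! (i - 1))"
    using I by (auto simp: J0_def)
  ultimately show ?thesis by simp
qed

section \<open>Products of psi values and their dual basis\<close>

definition xprod :: "(nat \<Rightarrow> complex) \<Rightarrow> bool list \<Rightarrow> nat list \<Rightarrow> complex" where
  "xprod p m g = (\<Prod>i<length m. if m ! i then 1 else p (g ! i))"

lemma xprod_Nil [simp]: "xprod p [] g = 1" by (simp add: xprod_def)

lemma xprod_Cons [simp]: "xprod p (b # m) (x # g) = (if b then 1 else p x) * xprod p m g"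
  by (simp add: xprod_def prod.lessThan_Suc_shift del: prod.lessThan_Suc cong: if_cong)

text \<open>Position by position, evaluation at 0 gives 1 on both kinds of factor, while the
  difference quotient gives 1 on p and 0 on the constant 1. With m' the mask of I and m that of J
  the result is the condition I \<subseteq> J in the expansion of L into the M basis.\<close>

lemma mcoef_xprod:
  assumes p: "p 0 = 1" "p 1 = q" "q \<noteq> 1" and "length m = length m'"
  shows "mcoef q m (xprod p m') = (if \<forall>i<length m. m' ! i \<longrightarrow> m ! i then 1 else 0)"
  using assms(4)
proof (induction m m' rule: list_induct2)
  case (Cons b m b' m')
  then show ?case using p by (auto simp: mcoef_cmult All_less_Suc2 field_simps)
qed simp

text \<open>The dual basis of the products xprod.\<close>

primrec kcoef :: "complex \<Rightarrow> bool list \<Rightarrow> (nat list \<Rightarrow> complex) \<Rightarrow> complex" where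
  "kcoef q [] f = f []"
| "kcoef q (b # m) f = (if b then kcoef q m (\<lambda>g. f (1 # g)) - q * kcoef q m (\<lambda>g. f (0 # g))
     else kcoef q m (\<lambda>g. f (0 # g)) - kcoef q m (\<lambda>g. f (1 # g))) / (1 - q)"

lemma kcoef_add: "kcoef q m (\<lambda>g. f g + f' g) = kcoef q m f + kcoef q m f'"
  by (induction m arbitrary: f f') (auto simp: diff_divide_distrib add_divide_distrib algebra_simps)

lemma kcoef_cmult: "kcoef q m (\<lambda>g. c * f g) = c * kcoef q m f"
  by (induction m arbitrary: f) (auto simp: algebra_simps)

lemma kcoef_0 [simp]: "kcoef q m (\<lambda>g. 0) = 0"
  using kcoef_cmult[of q m 0] by simp

lemma kcoef_sum: "kcoef q m (\<lambda>g. \<Sum>i\<in>I. f i g) = (\<Sum>i\<in>I. kcoef q m (f i))"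
  by (induction I rule: infinite_finite_induct) (simp_all add: kcoef_add)

lemma kcoef_cong:
  assumes "\<And>g. length g = length m \<Longrightarrow> (\<forall>x\<in>set g. x \<le> 1) \<Longrightarrow> f g = f' g"
  shows "kcoef q m f = kcoef q m f'"
  using assms
proof (induction m arbitrary: f f')
  case (Cons b m)
  have "kcoef q m (\<lambda>g. f (c # g)) = kcoef q m (\<lambda>g. f' (c # g))" if "c \<le> 1" for c
    by (rule Cons.IH, rule Cons.prems) (use that in auto)
  from this[of 0] this[of 1] show ?case by simp
qed simp

lemma kcoef_xprod:
  assumes p: "p 0 = 1" "p 1 = q" "q \<noteq> 1" and "length m = length m'"
  shows "kcoef q m (xprod p m') = (if m = m' then 1 else 0)"
  using assms(4)
proof (induction m m' rule: list_induct2)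
  case (Cons b m b' m')
  then show ?case using p by (auto simp: kcoef_cmult field_simps)
qed simp

lemma finite_bool_lists: "finite {m :: bool list. length m = k}"
  using finite_lists_length_eq[of "UNIV :: bool set" k] by simp

lemma sum_bool_lists_Suc:
  "(\<Sum>m\<in>{m. length m = Suc k}. F m) = (\<Sum>m\<in>{m. length m = k}. F (True # m) + F (False # m) :: complex)"
proof -
  have "{m. length m = Suc k} = Cons True ` {m. length m = k} \<union> Cons False ` {m. length m = k}"
  proof (intro equalityI subsetI)
    fix m :: "bool list" assume "m \<in> {m. length m = Suc k}"
    then obtain b m' where "m = b # m'" "length m' = k" by (auto simp: length_Suc_conv)
    then show "m \<in> Cons True ` {m. length m = k} \<union> Cons False ` {m. length m = k}" by (cases b) auto
  qed auto
  then have "(\<Sum>m\<in>{m. length m = Suc k}. F m) = (\<Sum>m\<in>Cons True ` {m. length m = k} \<union> Cons False ` {m. length m = k}. F m)"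
    by (rule arg_cong)
  also have "\<dots> = (\<Sum>m\<in>Cons True ` {m. length m = k}. F m) + (\<Sum>m\<in>Cons False ` {m. length m = k}. F m)"
    by (rule sum.union_disjoint) (auto intro: finite_bool_lists)
  also have "\<dots> = (\<Sum>m\<in>{m. length m = k}. F (True # m)) + (\<Sum>m\<in>{m. length m = k}. F (False # m))"
    by (simp add: sum.reindex)
  finally show ?thesis by (simp add: sum.distrib)
qed

text \<open>For one letter, f = A + B p at 0 and 1 is solved by A = (f 1 - q f 0) / (1 - q) and B =
  (f 0 - f 1) / (1 - q), the two clauses of \<open>kcoef\<close>.\<close>

lemma kcoef_expansion:
  assumes p: "p 0 = 1" "p 1 = q" "q \<noteq> 1" and "\<forall>x\<in>set g. x \<le> 1"
  shows "f g = (\<Sum>m\<in>{m. length m = length g}. kcoef q m f * xprod p m g)"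
  using assms(4)
proof (induction g arbitrary: f)
  case (Cons x g)
  have q: "1 - q \<noteq> 0" using p by simp
  have x: "x = 0 \<or> x = 1" using Cons.prems by auto
  have "kcoef q (True # m) f * xprod p (True # m) (x # g) + kcoef q (False # m) f * xprod p (False # m) (x # g)
    = kcoef q m (\<lambda>g. f (x # g)) * xprod p m g" for m
  proof -
    have 1: "(b - q * a) / (1 - q) + (a - b) / (1 - q) = a" for a b
    proof -
      have "(b - q * a) / (1 - q) + (a - b) / (1 - q) = (1 - q) * a / (1 - q)"
        unfolding add_divide_distrib[symmetric] by (simp add: algebra_simps)
      then show ?thesis using q by simp
    qed
    have 2: "(b - q * a) / (1 - q) + (a - b) / (1 - q) * q = b" for a b
    proof -
      have "(b - q * a) / (1 - q) + (a - b) / (1 - q) * q = (1 - q) * b / (1 - q)"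
        unfolding times_divide_eq_left add_divide_distrib[symmetric] by (simp add: algebra_simps)
      then show ?thesis using q by simp
    qed
    have "kcoef q (True # m) f * xprod p (True # m) (x # g) + kcoef q (False # m) f * xprod p (False # m) (x # g)
      = (kcoef q (True # m) f + kcoef q (False # m) f * p x) * xprod p m g"
      by (simp add: algebra_simps)
    also have "kcoef q (True # m) f + kcoef q (False # m) f * p x = kcoef q m (\<lambda>g. f (x # g))"
      using x p 1 2 by auto
    finally show ?thesis .
  qed
  then show ?case using Cons.IH[of "\<lambda>g. f (x # g)"] Cons.prems by (simp add: sum_bool_lists_Suc)
qed simp

text \<open>One entry shorter than the mask of a composition of n, which has a closing
  \<open>True\<close> for the position n.\<close>

definition imask :: "nat \<Rightarrow> nat set \<Rightarrow> bool list" where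
  "imask n I = map (\<lambda>i. i \<in> I) [1..<n]"

lemma length_imask [simp]: "length (imask n I) = n - 1" by (simp add: imask_def)

lemma imask_nth: "i < n - 1 \<Longrightarrow> imask n I ! i \<longleftrightarrow> Suc i \<in> I" by (simp add: imask_def)

lemma imask_inject: "I \<subseteq> {1..n - 1} \<Longrightarrow> J \<subseteq> {1..n - 1} \<Longrightarrow> imask n I = imask n J \<Longrightarrow> I = J"
proof -
  assume *: "I \<subseteq> {1..n - 1}" "J \<subseteq> {1..n - 1}" "imask n I = imask n J"
  have "i \<in> I \<longleftrightarrow> i \<in> J" for i
  proof (cases "i \<in> {1..n - 1}")
    case True
    then have "i - 1 < n - 1" "Suc (i - 1) = i" by auto
    then show ?thesis using imask_nth[of "i - 1" n I] imask_nth[of "i - 1" n J] *(3) by simp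
  next
    case False
    then show ?thesis using * by blast
  qed
  then show ?thesis by blast
qed

lemma chi_xprod:
  assumes "xs \<in> Qn \<nu> n"
  shows "chi \<nu> n I (n, xs) = xprod (psiv \<nu>) (imask n I) xs"
proof -
  have "chi \<nu> n I (n, xs) = (\<Prod>i\<in>{1..n - 1} - I. psiv \<nu> (xs ! (i - 1)))"
    using assms by (simp add: chi_def)
  also have "\<dots> = (\<Prod>i\<in>{1..n - 1}. if i \<in> I then 1 else psiv \<nu> (xs ! (i - 1)))"
    by (rule prod.mono_neutral_cong_left) auto
  also have "{1..n - 1} = Suc ` {..<n - 1}"
    using image_Suc_lessThan by simp
  also have "(\<Prod>i\<in>Suc ` {..<n - 1}. if i \<in> I then 1 else psiv \<nu> (xs ! (i - 1)))
      = (\<Prod>i<n - 1. if Suc i \<in> I then 1 else psiv \<nu> (xs ! i))"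
    by (simp add: prod.reindex cong: if_cong)
  also have "\<dots> = xprod (psiv \<nu>) (imask n I) xs"
    unfolding xprod_def length_imask by (rule prod.cong) (auto simp: imask_nth)
  finally show ?thesis .
qed

text \<open>The equation - 1 / (\<nu> - 1) = 1 would force \<nu> = 0. This makes the divisor 1 - q
  legitimate.\<close>

lemma psiv_1_neq: "psiv \<nu> 1 \<noteq> 1" if "\<nu> > 1"
proof
  assume *: "psiv \<nu> 1 = 1"
  have "of_nat \<nu> \<noteq> (1 :: complex)" using that by simp
  then have "of_nat \<nu> = (0 :: complex)" using * by (simp add: psiv_def field_simps)
  then show False using that by simp
qed

lemma binary_Qn: "\<nu> > 1 \<Longrightarrow> length g = n - 1 \<Longrightarrow> \<forall>x\<in>set g. x \<le> 1 \<Longrightarrow> g \<in> Qn \<nu> n"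
  by (fastforce simp: Qn_def)

lemma mcoef_chi:
  assumes \<nu>: "\<nu> > 1" and e: "fsupp e" and I: "I \<subseteq> {1..n - 1}"
  shows "mcoef (psiv \<nu> 1) (dmask (compof e)) (\<lambda>l. chi \<nu> n I (dec l)) = Lfun n I e"
proof -
  let ?m = "dmask (compof e)"
  let ?q = "psiv \<nu> 1"
  consider "length ?m \<noteq> n" | "length ?m = n" "n = 0" | "length ?m = n" "n > 0" by linarith
  then show ?thesis
  proof cases
    case 1
    have "mcoef ?q ?m (\<lambda>l. chi \<nu> n I (dec l)) = mcoef ?q ?m (\<lambda>l. 0)"
      by (rule mcoef_cong) (use 1 in \<open>auto simp: chi_def dec_def\<close>)
    then show ?thesis using 1 by (simp add: Lfun_eq[OF e I])
  next
    case 2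
    then show ?thesis using I Lfun_eq[OF e, of "{}" 0] by (auto simp: chi_def Qn_def)
  next
    case 3
    \<comment> \<open>The closing \<open>True\<close> evaluates the appended letter at 0; the
      remaining n - 1 mask entries act on the variables of chi.\<close>
    define m where "m = butlast ?m"
    have m: "?m = m @ [True]" using last_dmask[of "compof e"] 3 unfolding m_def
      by (metis append_butlast_last_id length_0_conv less_numeral_extra(3))
    have lm: "length m = n - 1" using 3 m by simp
    have "mcoef ?q ?m (\<lambda>l. chi \<nu> n I (dec l)) = mcoef ?q m (\<lambda>u. chi \<nu> n I (dec (u @ [0])))"
      unfolding m by (simp add: mcoef_append)
    also have "\<dots> = mcoef ?q m (xprod (psiv \<nu>) (imask n I))"
    proof (rule mcoef_cong)
      fix u :: "nat list" assume u: "length u = length m" "\<forall>x\<in>set u. x \<le> 1"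
      have "dec (u @ [0]) = (n, u)" using u lm 3 by (simp add: dec_def)
      then show "chi \<nu> n I (dec (u @ [0])) = xprod (psiv \<nu>) (imask n I) u"
        using chi_xprod binary_Qn[OF \<nu>, of u n] u lm by simp
    qed
    also have "\<dots> = (if \<forall>i<length m. imask n I ! i \<longrightarrow> m ! i then 1 else 0)"
      by (rule mcoef_xprod) (use lm psiv_1_neq[OF \<nu>] in auto)
    also have "(\<forall>i<length m. imask n I ! i \<longrightarrow> m ! i) \<longleftrightarrow> (\<forall>i\<in>I. ?m ! (i - 1))"
    proof -
      have "(\<forall>i<length m. imask n I ! i \<longrightarrow> m ! i) \<longleftrightarrow> (\<forall>i<n - 1. Suc i \<in> I \<longrightarrow> ?m ! i)"
        using lm by (simp add: imask_nth m nth_append)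
      also have "\<dots> \<longleftrightarrow> (\<forall>i\<in>I. ?m ! (i - 1))"
      proof
        assume *: "\<forall>i<n - 1. Suc i \<in> I \<longrightarrow> ?m ! i"
        show "\<forall>i\<in>I. ?m ! (i - 1)"
        proof
          fix i assume i: "i \<in> I"
          then have "i - 1 < n - 1" "Suc (i - 1) = i" using I by fastforce+
          then show "?m ! (i - 1)" using * i by metis
        qed
      qed auto
      finally show ?thesis .
    qed
    finally show ?thesis using 3 by (simp add: Lfun_eq[OF e I])
  qed
qed

section \<open>Coordinates in the supercharacter basis\<close>

definition is_chi_coef :: "nat \<Rightarrow> (pt \<Rightarrow> complex) \<Rightarrow> (nat \<times> nat set \<Rightarrow> complex) \<Rightarrow> bool" where
  "is_chi_coef \<nu> F c \<longleftrightarrow> (\<forall>q. c q \<noteq> 0 \<longrightarrow> q \<in> chidx) \<and> finite {q. c q \<noteq> 0} \<and>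
      F = (\<lambda>p. \<Sum>q\<in>{q. c q \<noteq> 0}. c q * chi \<nu> (fst q) (snd q) p)"

text \<open>Explicit coordinates, by which the definite description in \<open>chcoef\<close> is
  shown to denote.\<close>

definition chi_coef :: "nat \<Rightarrow> (pt \<Rightarrow> complex) \<Rightarrow> nat \<times> nat set \<Rightarrow> complex" where
  "chi_coef \<nu> F = (\<lambda>(n, I). if (n, I) \<in> chidx then kcoef (psiv \<nu> 1) (imask n I) (\<lambda>g. F (n, g)) else 0)"

lemma is_chi_coef_unique:
  assumes \<nu>: "\<nu> > 1" and c: "is_chi_coef \<nu> F c"
  shows "c = chi_coef \<nu> F"
proof
  fix r :: "nat \<times> nat set"
  obtain n I where r: "r = (n, I)" by fastforce
  let ?q = "psiv \<nu> 1"
  let ?S = "{q. c q \<noteq> 0}"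
  have fin: "finite ?S" and idx: "\<And>q. c q \<noteq> 0 \<Longrightarrow> q \<in> chidx"
    and F: "F = (\<lambda>p. \<Sum>q\<in>?S. c q * chi \<nu> (fst q) (snd q) p)" using c by (auto simp: is_chi_coef_def)
  show "c r = chi_coef \<nu> F r"
  proof (cases "r \<in> chidx")
    case False
    then show ?thesis using idx by (auto simp: chi_coef_def r)
  next
    case True
    then have I: "I \<subseteq> {1..n - 1}" by (simp add: chidx_def r)
    have "kcoef ?q (imask n I) (\<lambda>g. chi \<nu> (fst s) (snd s) (n, g)) = (if s = r then 1 else 0)" if s: "s \<in> ?S" for s
    proof (cases "fst s = n")
      case True
      then have sI: "snd s \<subseteq> {1..n - 1}" using idx[of s] s by (cases s) (auto simp: chidx_def)
      have "kcoef ?q (imask n I) (\<lambda>g. chi \<nu> (fst s) (snd s) (n, g)) = kcoef ?q (imask n I) (xprod (psiv \<nu>) (imask n (snd s)))"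
        by (rule kcoef_cong) (use True chi_xprod binary_Qn[OF \<nu>] in simp)
      also have "\<dots> = (if imask n I = imask n (snd s) then 1 else 0)"
        by (rule kcoef_xprod) (use psiv_1_neq[OF \<nu>] in auto)
      also have "imask n I = imask n (snd s) \<longleftrightarrow> s = r"
        using imask_inject[OF I sI] True by (cases s) (auto simp: r)
      finally show ?thesis .
    next
      case False
      then show ?thesis by (auto simp: chi_def r)
    qed
    then have "chi_coef \<nu> F r = (\<Sum>s\<in>?S. c s * (if s = r then 1 else 0))"
      using True by (simp add: chi_coef_def r F kcoef_sum kcoef_cmult)
    also have "\<dots> = c r" using fin by (simp add: if_distrib cong: if_cong)
    finally show ?thesis by simp
  qed
qed

lemma is_chi_coef_exists:
  assumes \<nu>: "\<nu> > 1" and F: "F \<in> scfV \<nu>"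
  shows "is_chi_coef \<nu> F (chi_coef \<nu> F)"
proof -
  let ?c = "chi_coef \<nu> F"
  let ?q = "psiv \<nu> 1"
  let ?S = "{q. ?c q \<noteq> 0}"
  obtain D where D: "\<And>q. D \<le> fst q \<Longrightarrow> F q = 0" using scfV_bounded F by blast
  have idx: "?c q \<noteq> 0 \<Longrightarrow> q \<in> chidx" for q by (auto simp: chi_coef_def split: if_splits prod.splits)
  have "?S \<subseteq> (SIGMA n:{..<D}. Pow {1..n - 1})"
  proof
    fix r assume r: "r \<in> ?S"
    obtain n I where nI: "r = (n, I)" by fastforce
    have "n < D"
    proof (rule ccontr)
      assume "\<not> n < D"
      then have "(\<lambda>g. F (n, g)) = (\<lambda>g. 0)" using D by auto
      then show False using r by (simp add: nI chi_coef_def split: if_splits)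
    qed
    then show "r \<in> (SIGMA n:{..<D}. Pow {1..n - 1})" using idx[of r] r by (auto simp: nI chidx_def)
  qed
  then have fin: "finite ?S" by (rule finite_subset) (intro finite_SigmaI; simp)
  have "F p = (\<Sum>q\<in>?S. ?c q * chi \<nu> (fst q) (snd q) p)" for p
  proof (cases "p \<in> pts \<nu>")
    case False
    then have "chi \<nu> n I p = 0" for n I by (cases p) (auto simp: chi_def pts_def)
    then show ?thesis using scfV_pts[OF F False] by simp
  next
    case True
    obtain n xs where p: "p = (n, xs)" by fastforce
    have xs: "xs \<in> Qn \<nu> n" using True by (simp add: pts_def p)
    \<comment> \<open>Replacing nonzero letters by 1 changes neither F nor any psi value, and makes
      \<open>kcoef_expansion\<close> applicable.\<close>
    define ys where "ys = map (\<lambda>x. if x = 0 then 0 else (1::nat)) xs"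
    have ys: "ys \<in> Qn \<nu> n" "\<forall>x\<in>set ys. x \<le> 1" using xs \<nu> by (auto simp: ys_def Qn_def)
    have nth: "ys ! i = 0 \<longleftrightarrow> xs ! i = 0" if "i < n - 1" for i using that xs by (simp add: ys_def Qn_def)
    have "suppl xs = suppl ys" by (auto simp: suppl_def ys_def split: if_splits)
    then have Fy: "F (n, xs) = F (n, ys)" using F xs ys(1) unfolding scfV_def by blast
    have xp: "xprod (psiv \<nu>) m ys = xprod (psiv \<nu>) m xs" if "length m = n - 1" for m
      unfolding xprod_def using that nth by (intro prod.cong) (auto simp: psiv_def)
    have "F (n, ys) = (\<Sum>m\<in>{m. length m = n - 1}. kcoef ?q m (\<lambda>g. F (n, g)) * xprod (psiv \<nu>) m ys)"
      using kcoef_expansion[of "psiv \<nu>" ?q ys "\<lambda>g. F (n, g)"] ys psiv_1_neq[OF \<nu>] by (simp add: Qn_def)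
    also have "\<dots> = (\<Sum>I\<in>Pow {1..n - 1}. ?c (n, I) * chi \<nu> n I (n, xs))"
    proof (rule sum.reindex_bij_witness[where i = "imask n" and j = "\<lambda>m. {i \<in> {1..n - 1}. m ! (i - 1)}"])
      fix m :: "bool list" assume "m \<in> {m. length m = n - 1}"
      then have lm: "length m = n - 1" by simp
      show m: "imask n {i \<in> {1..n - 1}. m ! (i - 1)} = m"
        by (rule nth_equalityI) (auto simp: lm imask_nth)
      have "(n, {i \<in> {1..n - 1}. m ! (i - 1)}) \<in> chidx" by (auto simp: chidx_def)
      then have c: "?c (n, {i \<in> {1..n - 1}. m ! (i - 1)}) = kcoef ?q m (\<lambda>g. F (n, g))"
        by (simp only: chi_coef_def prod.case if_True m)
      show "?c (n, {i \<in> {1..n - 1}. m ! (i - 1)}) * chi \<nu> n {i \<in> {1..n - 1}. m ! (i - 1)} (n, xs)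
          = kcoef ?q m (\<lambda>g. F (n, g)) * xprod (psiv \<nu>) m ys"
        unfolding chi_xprod[OF xs] m xp[OF lm] c ..
    next
      fix I assume I: "I \<in> Pow {1..n - 1}"
      have "i \<in> {i \<in> {1..n - 1}. imask n I ! (i - 1)} \<longleftrightarrow> i \<in> I" for i
      proof (cases "i \<in> {1..n - 1}")
        case True
        then have "i - 1 < n - 1" "Suc (i - 1) = i" by auto
        then show ?thesis using imask_nth[of "i - 1" n I] True by simp
      qed (use I in auto)
      then show "{i \<in> {1..n - 1}. imask n I ! (i - 1)} = I" by blast
    qed auto
    also have "\<dots> = (\<Sum>q\<in>Pair n ` Pow {1..n - 1}. ?c q * chi \<nu> (fst q) (snd q) (n, xs))"
      by (simp add: sum.reindex inj_on_def)
    also have "\<dots> = (\<Sum>q\<in>?S. ?c q * chi \<nu> (fst q) (snd q) (n, xs))"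
    proof (rule sum.mono_neutral_cong)
      fix q assume "q \<in> ?S - Pair n ` Pow {1..n - 1}"
      then have "fst q \<noteq> n" using idx[of q] by (cases q) (auto simp: chidx_def)
      then show "?c q * chi \<nu> (fst q) (snd q) (n, xs) = 0" by (auto simp: chi_def)
    qed (use fin in auto)
    finally show ?thesis using Fy by (simp add: p)
  qed
  then show ?thesis unfolding is_chi_coef_def using idx fin by blast
qed

lemma chcoef_eq:
  assumes "\<nu> > 1" "F \<in> scfV \<nu>"
  shows "chcoef \<nu> F = chi_coef \<nu> F"
proof -
  have "chcoef \<nu> F = (THE c. is_chi_coef \<nu> F c)" by (simp only: chcoef_def is_chi_coef_def)
  also have "\<dots> = chi_coef \<nu> F"
    by (rule the_equality[where P = "is_chi_coef \<nu> F", OF is_chi_coef_exists[OF assms]])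
      (rule is_chi_coef_unique[OF assms(1)])
  finally show ?thesis .
qed

text \<open>Expanding F in the supercharacters reduces this to \<open>mcoef_chi\<close>. It trades
  the definition by coordinates for a functional evaluated on F itself, the form in which
  \<open>ch\<close> meets products and coproducts.\<close>

lemma ch_eq:
  assumes \<nu>: "\<nu> > 1" and F: "F \<in> scfV \<nu>"
  shows "ch \<nu> F e = (if fsupp e then mcoef (psiv \<nu> 1) (dmask (compof e)) (\<lambda>l. F (dec l)) else 0)"
proof -
  let ?c = "chi_coef \<nu> F"
  have c: "is_chi_coef \<nu> F ?c" by (rule is_chi_coef_exists[OF assms])
  have ch: "ch \<nu> F e = (\<Sum>q\<in>{q. ?c q \<noteq> 0}. ?c q * Lfun (fst q) (snd q) e)"
    by (simp add: ch_def chcoef_eq[OF assms])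
  have F_eq: "F p = (\<Sum>q\<in>{q. ?c q \<noteq> 0}. ?c q * chi \<nu> (fst q) (snd q) p)" for p
    using c unfolding is_chi_coef_def by metis
  show ?thesis
  proof (cases "fsupp e")
    case True
    have "mcoef (psiv \<nu> 1) (dmask (compof e)) (\<lambda>l. F (dec l))
      = mcoef (psiv \<nu> 1) (dmask (compof e)) (\<lambda>l. \<Sum>q\<in>{q. ?c q \<noteq> 0}. ?c q * chi \<nu> (fst q) (snd q) (dec l))"
      by (rule mcoef_cong) (rule F_eq)
    also have "\<dots> = (\<Sum>q\<in>{q. ?c q \<noteq> 0}. ?c q * Lfun (fst q) (snd q) e)"
      unfolding mcoef_sum mcoef_cmult
    proof (rule sum.cong)
      fix q assume "q \<in> {q. ?c q \<noteq> 0}"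
      then have "snd q \<subseteq> {1..fst q - 1}" using c by (cases q) (auto simp: is_chi_coef_def chidx_def)
      then show "?c q * mcoef (psiv \<nu> 1) (dmask (compof e)) (\<lambda>l. chi \<nu> (fst q) (snd q) (dec l))
          = ?c q * Lfun (fst q) (snd q) e"
        by (simp only: mcoef_chi[OF \<nu> True])
    qed simp
    finally show ?thesis using ch True by simp
  next
    case False
    then show ?thesis using ch by (simp add: Lfun_def Mfun_def)
  qed
qed

lemma scfV_add:
  assumes "\<nu> > 0" "x \<in> scfV \<nu>" "y \<in> scfV \<nu>"
  shows "(\<lambda>p. x p + y p) \<in> scfV \<nu>"
proof -
  obtain D1 where D1: "\<And>q. D1 \<le> fst q \<Longrightarrow> x q = 0" using scfV_bounded assms(2) by blast
  obtain D2 where D2: "\<And>q. D2 \<le> fst q \<Longrightarrow> y q = 0" using scfV_bounded assms(3) by blast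
  show ?thesis
  proof (rule scfVI[OF assms(1), where D = "max D1 D2"])
    show "x q + y q \<noteq> 0 \<Longrightarrow> q \<in> pts \<nu>" for q
      using scfV_pts[OF assms(2), of q] scfV_pts[OF assms(3), of q] by (cases "q \<in> pts \<nu>") auto
    show "x (dec l) + y (dec l) = 0" if "max D1 D2 \<le> length l" for l
      using D1[of "dec l"] D2[of "dec l"] that by simp
    show "x (dec l) + y (dec l) = x (dec l') + y (dec l')"
      if "l \<in> words \<nu>" "l' \<in> words \<nu>" "list_all2 sim l l'" for l l'
      using scfV_sim[OF assms(2) that] scfV_sim[OF assms(3) that] by simp
  qed
qed

lemma scfV_cmult:
  assumes "\<nu> > 0" "x \<in> scfV \<nu>"
  shows "(\<lambda>p. c * x p) \<in> scfV \<nu>"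
proof -
  obtain D where D: "\<And>q. D \<le> fst q \<Longrightarrow> x q = 0" using scfV_bounded assms(2) by blast
  show ?thesis
  proof (rule scfVI[OF assms(1), where D = D])
    show "c * x q \<noteq> 0 \<Longrightarrow> q \<in> pts \<nu>" for q
      using scfV_pts[OF assms(2), of q] by (cases "q \<in> pts \<nu>") auto
    show "c * x (dec l) = 0" if "D \<le> length l" for l
      using D[of "dec l"] that by simp
    show "c * x (dec l) = c * x (dec l')"
      if "l \<in> words \<nu>" "l' \<in> words \<nu>" "list_all2 sim l l'" for l l'
      using scfV_sim[OF assms(2) that] by simp
  qed
qed

lemma chi_in_scfV:
  assumes "\<nu> > 0"
  shows "chi \<nu> n I \<in> scfV \<nu>"
proof (rule scfVI[OF assms, where D = "Suc n"])
  show "chi \<nu> n I q \<noteq> 0 \<Longrightarrow> q \<in> pts \<nu>" for q by (cases q) (auto simp: chi_def pts_def split: if_splits)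
  show "chi \<nu> n I (dec l) = 0" if "Suc n \<le> length l" for l using that by (simp add: chi_def dec_def)
  fix l l' assume l: "l \<in> words \<nu>" "l' \<in> words \<nu>" "list_all2 sim l l'"
  have len: "length l = length l'" using l by (auto dest: list_all2_lengthD)
  show "chi \<nu> n I (dec l) = chi \<nu> n I (dec l')"
  proof (cases "length l = n")
    case True
    have Q: "butlast l \<in> Qn \<nu> n" "butlast l' \<in> Qn \<nu> n"
      using dec_in_pts[OF l(1)] dec_in_pts[OF l(2)] True len by (auto simp: pts_def dec_def)
    have "psiv \<nu> (butlast l ! i) = psiv \<nu> (butlast l' ! i)" if "i < n - 1" for i
      using list_all2_butlastI[OF l(3)] that True by (intro psiv_sim) (simp add: list_all2_conv_all_nth)
    then have "xprod (psiv \<nu>) (imask n I) (butlast l) = xprod (psiv \<nu>) (imask n I) (butlast l')"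
      unfolding xprod_def by (intro prod.cong) auto
    then show ?thesis using chi_xprod[OF Q(1)] chi_xprod[OF Q(2)] True len by (simp add: dec_def)
  qed (use len in \<open>simp add: chi_def dec_def\<close>)
qed

section \<open>Compatibility with the Hopf algebra operations\<close>

lemma lin_on_ch:
  assumes "\<nu> > 1"
  shows "lin_on \<nu> (ch \<nu>)"
  using assms by (auto simp: lin_on_def fun_eq_iff ch_eq scfV_add scfV_cmult mcoef_add mcoef_cmult)

lemma ch_chi:
  assumes "\<nu> > 1" "I \<subseteq> {1..n - 1}"
  shows "ch \<nu> (chi \<nu> n I) = Lfun n I"
proof
  fix e
  show "ch \<nu> (chi \<nu> n I) e = Lfun n I e"
  proof (cases "fsupp e")
    case True
    then show ?thesis using mcoef_chi[OF assms(1) True assms(2)] assms by (simp add: ch_eq chi_in_scfV)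
  next
    case False
    then show ?thesis using assms by (simp add: ch_eq chi_in_scfV Lfun_def Mfun_def)
  qed
qed

text \<open>Exponent vectors below \<open>e\<close> are read along the support of \<open>e\<close>;
  the zeros found there do not affect the mask.\<close>

lemma dmask_compof:
  assumes "sorted s" "distinct s" "{i. e i \<noteq> 0} \<subseteq> set s"
  shows "dmask (compof e) = dmask (map e s)"
  by (simp only: compof_filter[OF assms] dmask_filter)

lemma fsupp_le: "fsupp e \<Longrightarrow> (\<And>i. e1 i \<le> e i) \<Longrightarrow> fsupp e1"
  unfolding fsupp_def by (erule finite_subset[rotated]) (auto simp: Collect_mono_iff, metis le_zero_eq not_gr_zero)

lemma ch_mult:
  assumes \<nu>: "\<nu> > 1" and x: "x \<in> scfV \<nu>" and y: "y \<in> scfV \<nu>"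
  shows "ch \<nu> (mult \<nu> x y) = qmult (ch \<nu> x) (ch \<nu> y)"
proof
  fix e :: "nat \<Rightarrow> nat"
  let ?q = "psiv \<nu> 1"
  have \<nu>0: "\<nu> > 0" using \<nu> by simp
  have m: "mult \<nu> x y \<in> scfV \<nu>" by (rule mult_in_scfV[OF \<nu>0 x y])
  show "ch \<nu> (mult \<nu> x y) e = qmult (ch \<nu> x) (ch \<nu> y) e"
  proof (cases "fsupp e")
    case False
    \<comment> \<open>If \<open>e\<close> has infinite support, so has one of the two parts of every
      splitting, and the corresponding factor has coefficient 0.\<close>
    have "ch \<nu> x e1 * ch \<nu> y (\<lambda>i. e i - e1 i) = 0" if le: "\<forall>i. e1 i \<le> e i" for e1
    proof -
      have "\<not> (fsupp e1 \<and> fsupp (\<lambda>i. e i - e1 i))"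
      proof
        assume "fsupp e1 \<and> fsupp (\<lambda>i. e i - e1 i)"
        then have "finite ({i. e1 i \<noteq> 0} \<union> {i. e i - e1 i \<noteq> 0})" by (simp add: fsupp_def)
        moreover have "{i. e i \<noteq> 0} \<subseteq> {i. e1 i \<noteq> 0} \<union> {i. e i - e1 i \<noteq> 0}" by auto
        ultimately show False using False finite_subset unfolding fsupp_def by blast
      qed
      then show ?thesis using ch_eq[OF \<nu> x] ch_eq[OF \<nu> y] by auto
    qed
    then have "qmult (ch \<nu> x) (ch \<nu> y) e = 0" unfolding qmult_def by (intro sum.neutral) blast
    then show ?thesis using False by (simp add: ch_eq[OF \<nu> m])
  next
    case True
    define s where "s = sorted_list_of_set {i. e i \<noteq> 0}"
    have s: "sorted s" "distinct s" "set s = {i. e i \<noteq> 0}" using True by (auto simp: s_def fsupp_def)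
    have "ch \<nu> (mult \<nu> x y) e = mcoef ?q (dmask (map e s)) (\<lambda>l. mult \<nu> x y (dec l))"
      using True by (simp add: ch_eq[OF \<nu> m] dmask_compof[OF s(1,2)] s(3))
    also have "\<dots> = mcoef ?q (dmask (map e s)) (\<lambda>l. shsum (psiv \<nu>) l (\<lambda>a b. x (dec a) * y (dec b)))"
    proof (rule mcoef_cong)
      fix g :: "nat list" assume g: "\<forall>x\<in>set g. x \<le> 1" "dmask (map e s) = [] \<or> last (dmask (map e s)) \<Longrightarrow> lz g"
      then have "g \<in> words \<nu>" using last_dmask[of "map e s"] \<nu> by (fastforce simp: words_def)
      then show "mult \<nu> x y (dec g) = shsum (psiv \<nu>) g (\<lambda>a b. x (dec a) * y (dec b))" by (rule mult_dec)
    qed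
    also have "\<dots> = lconv (map e s) (\<lambda>\<beta> \<gamma>. mcoef ?q (dmask \<beta>) (\<lambda>u. mcoef ?q (dmask \<gamma>) (\<lambda>v. x (dec u) * y (dec v))))"
      by (rule mcoef_dmask_shsum) (use psiv_1_neq[OF \<nu>] in auto)
    also have "\<dots> = lconv (map e s) (\<lambda>\<beta> \<gamma>. mcoef ?q (dmask \<beta>) (\<lambda>u. x (dec u)) * mcoef ?q (dmask \<gamma>) (\<lambda>v. y (dec v)))"
      by (simp add: mcoef_cmult mcoef_cmult_right)
    also have "\<dots> = (\<Sum>e1\<in>{e1. \<forall>i. e1 i \<le> e i}. mcoef ?q (dmask (map e1 s)) (\<lambda>u. x (dec u))
        * mcoef ?q (dmask (map (\<lambda>i. e i - e1 i) s)) (\<lambda>v. y (dec v)))"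
      using sum_below_lconv[of s e "\<lambda>\<beta> \<gamma>. mcoef ?q (dmask \<beta>) (\<lambda>u. x (dec u)) * mcoef ?q (dmask \<gamma>) (\<lambda>v. y (dec v))"] s
      by simp
    also have "\<dots> = qmult (ch \<nu> x) (ch \<nu> y) e"
      unfolding qmult_def
    proof (rule sum.cong)
      fix e1 assume "e1 \<in> {e1. \<forall>i. e1 i \<le> e i}"
      then have le: "\<And>i. e1 i \<le> e i" by simp
      have sub: "{i. e1 i \<noteq> 0} \<subseteq> set s" "{i. e i - e1 i \<noteq> 0} \<subseteq> set s"
        using le s(3) by (auto intro: gr0I dest: le_zero_eq[THEN iffD1]) (metis le_zero_eq not_gr_zero)
      have "fsupp e1" "fsupp (\<lambda>i. e i - e1 i)" using True le by (auto intro: fsupp_le)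
      then show "mcoef ?q (dmask (map e1 s)) (\<lambda>u. x (dec u)) * mcoef ?q (dmask (map (\<lambda>i. e i - e1 i) s)) (\<lambda>v. y (dec v))
          = ch \<nu> x e1 * ch \<nu> y (\<lambda>i. e i - e1 i)"
        by (simp only: ch_eq[OF \<nu> x] ch_eq[OF \<nu> y] dmask_compof[OF s(1,2) sub(1)] dmask_compof[OF s(1,2) sub(2)] if_True)
    qed simp
    finally show ?thesis .
  qed
qed

lemma fsupp_mono: "fsupp (mono \<alpha>)"
  unfolding fsupp_def by (rule finite_subset[of _ "{..<length \<alpha>}"]) (auto simp: mono_def)

lemma compof_mono: "is_comp \<alpha> \<Longrightarrow> compof (mono \<alpha>) = \<alpha>"
proof -
  assume \<alpha>: "is_comp \<alpha>"
  have "map (mono \<alpha>) [0..<length \<alpha>] = \<alpha>" by (rule nth_equalityI) (auto simp: mono_def)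
  moreover have "compof (mono \<alpha>) = filter (\<lambda>a. a \<noteq> 0) (map (mono \<alpha>) [0..<length \<alpha>])"
    by (rule compof_filter) (auto simp: mono_def)
  moreover have "filter (\<lambda>a. a \<noteq> 0) \<alpha> = \<alpha>" using \<alpha> by (auto simp: is_comp_def filter_id_conv)
  ultimately show ?thesis by simp
qed

lemma ch_mono:
  assumes "\<nu> > 1" "F \<in> scfV \<nu>" "is_comp \<alpha>"
  shows "ch \<nu> F (mono \<alpha>) = mcoef (psiv \<nu> 1) (dmask \<alpha>) (\<lambda>l. F (dec l))"
  using assms by (simp add: ch_eq fsupp_mono compof_mono)

lemma mcoef_words_cong:
  assumes "\<nu> > 1" "\<And>g. g \<in> words \<nu> \<Longrightarrow> length g = length (dmask \<alpha>) \<Longrightarrow> f g = f' g"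
  shows "mcoef q (dmask \<alpha>) f = mcoef q (dmask \<alpha>) f'"
proof (rule mcoef_cong)
  fix g :: "nat list" assume g: "length g = length (dmask \<alpha>)" "\<forall>x\<in>set g. x \<le> 1"
    "dmask \<alpha> = [] \<or> last (dmask \<alpha>) \<Longrightarrow> lz g"
  then have "g \<in> words \<nu>" using last_dmask[of \<alpha>] assms(1) by (fastforce simp: words_def)
  then show "f g = f' g" using assms(2) g by blast
qed

text \<open>\<open>chT\<close> applies \<open>ch\<close> to a function that arises from
  \<open>ch\<close> in the other variable; the formula \<open>ch_eq\<close> requires this function
  to lie in \<open>scfV\<close>.\<close>

lemma mcoef_slice_in_scfV:
  assumes \<nu>: "\<nu> > 1" and x: "x \<in> scfV \<nu>"
  shows "(\<lambda>r. mcoef q (dmask \<gamma>) (\<lambda>v. comult \<nu> x (r, dec v))) \<in> scfV \<nu>"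
proof -
  have \<nu>0: "\<nu> > 0" using \<nu> by simp
  obtain D where D: "\<And>q. D \<le> fst q \<Longrightarrow> x q = 0" using scfV_bounded x by blast
  show ?thesis
  proof (rule scfVI[OF \<nu>0, where D = D])
    show "r \<in> pts \<nu>" if "mcoef q (dmask \<gamma>) (\<lambda>v. comult \<nu> x (r, dec v)) \<noteq> 0" for r
    proof (rule ccontr)
      assume "r \<notin> pts \<nu>"
      then show False using that by (simp add: comult_eq)
    qed
  next
    fix l assume l: "l \<in> words \<nu>" "D \<le> length l"
    have "mcoef q (dmask \<gamma>) (\<lambda>v. comult \<nu> x (dec l, dec v)) = mcoef q (dmask \<gamma>) (\<lambda>v. 0)"
      by (rule mcoef_words_cong[OF \<nu>]) (use l D in \<open>simp add: comult_dec\<close>)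
    then show "mcoef q (dmask \<gamma>) (\<lambda>v. comult \<nu> x (dec l, dec v)) = 0" by simp
  next
    fix l l' assume l: "l \<in> words \<nu>" "l' \<in> words \<nu>" "list_all2 sim l l'"
    show "mcoef q (dmask \<gamma>) (\<lambda>v. comult \<nu> x (dec l, dec v)) = mcoef q (dmask \<gamma>) (\<lambda>v. comult \<nu> x (dec l', dec v))"
    proof (rule mcoef_words_cong[OF \<nu>])
      fix g assume g: "g \<in> words \<nu>"
      have "x (dec (l @ g)) = x (dec (l' @ g))"
        by (rule scfV_sim[OF x])
          (use l g in \<open>auto intro!: words_append list_all2_appendI list_all2_refl simp: sim_def\<close>)
      then show "comult \<nu> x (dec l, dec g) = comult \<nu> x (dec l', dec g)" using l g by (simp add: comult_dec)
    qed
  qed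
qed

text \<open>The mask of \<open>\<beta> @ \<gamma>\<close> is the concatenation of the two masks and
  the coproduct evaluates at concatenated words, so the nested functionals combine into the one for
  \<open>\<beta> @ \<gamma>\<close>.\<close>

lemma chT_comult:
  assumes \<nu>: "\<nu> > 1" and x: "x \<in> scfV \<nu>"
  shows "chT \<nu> (comult \<nu> x) = qcomult (ch \<nu> x)"
proof
  fix z :: "nat list \<times> nat list"
  obtain \<beta> \<gamma> where z: "z = (\<beta>, \<gamma>)" by fastforce
  let ?q = "psiv \<nu> 1"
  have \<nu>0: "\<nu> > 0" using \<nu> by simp
  show "chT \<nu> (comult \<nu> x) z = qcomult (ch \<nu> x) z"
  proof (cases "is_comp \<beta> \<and> is_comp \<gamma>")
    case True
    then have comp: "is_comp (\<beta> @ \<gamma>)" by (auto simp: is_comp_def)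
    have "chT \<nu> (comult \<nu> x) z = ch \<nu> (\<lambda>r. mcoef ?q (dmask \<gamma>) (\<lambda>v. comult \<nu> x (r, dec v))) (mono \<beta>)"
      using True by (simp add: z chT_def ch_mono[OF \<nu> comult_slice_left[OF \<nu>0 x]])
    also have "\<dots> = mcoef ?q (dmask \<beta>) (\<lambda>u. mcoef ?q (dmask \<gamma>) (\<lambda>v. comult \<nu> x (dec u, dec v)))"
      using True by (simp add: ch_mono[OF \<nu> mcoef_slice_in_scfV[OF \<nu> x]])
    also have "\<dots> = mcoef ?q (dmask \<beta>) (\<lambda>u. mcoef ?q (dmask \<gamma>) (\<lambda>v. x (dec (u @ v))))"
      by (intro mcoef_words_cong[OF \<nu>]) (simp add: comult_dec)
    also have "\<dots> = ch \<nu> x (mono (\<beta> @ \<gamma>))"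
      by (simp add: ch_mono[OF \<nu> x comp] dmask_append mcoef_append)
    finally show ?thesis using True by (simp add: z qcomult_def)
  qed (auto simp: z chT_def qcomult_def)
qed

lemma ch_unitV:
  assumes "\<nu> > 1"
  shows "ch \<nu> unitV = qunit"
proof
  fix e :: "nat \<Rightarrow> nat"
  have \<nu>0: "\<nu> > 0" using assms by simp
  have U: "unitV \<in> scfV \<nu>" by (rule unitV_in_scfV[OF \<nu>0])
  show "ch \<nu> unitV e = qunit e"
  proof (cases "fsupp e")
    case True
    have e0: "dmask (compof e) = [] \<longleftrightarrow> e = (\<lambda>_. 0)"
    proof -
      have "dmask (compof e) = [] \<longleftrightarrow> compof e = []"
        using dmask_inject[OF is_comp_compof[OF True], of "[]"] by (auto simp: is_comp_def)
      also have "\<dots> \<longleftrightarrow> e = (\<lambda>_. 0)" using True by (auto simp: compof_def fsupp_def)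
      finally show ?thesis .
    qed
    show ?thesis
    proof (cases "e = (\<lambda>_. 0)")
      case True
      then have "ch \<nu> unitV e = unitV (0, [])" using e0 \<open>fsupp e\<close> by (simp add: ch_eq[OF assms U])
      then show ?thesis using True by (simp add: qunit_def unitV_def)
    next
      case False
      have "mcoef (psiv \<nu> 1) (dmask (compof e)) (\<lambda>l. unitV (dec l)) = mcoef (psiv \<nu> 1) (dmask (compof e)) (\<lambda>l. 0)"
        by (rule mcoef_cong) (use False e0 in \<open>auto simp: unitV_dec\<close>)
      then show ?thesis using False by (simp add: ch_eq[OF assms U] qunit_def)
    qed
  next
    case False
    then have "e \<noteq> (\<lambda>_. 0)" by (auto simp: fsupp_def)
    then show ?thesis using False by (simp add: ch_eq[OF assms U] qunit_def)
  qed
qed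

lemma qcounit_ch:
  assumes "\<nu> > 1" "x \<in> scfV \<nu>"
  shows "qcounit (ch \<nu> x) = counitV x"
proof -
  have "mono [] = (\<lambda>_. 0)" by (auto simp: mono_def)
  then show ?thesis using ch_mono[OF assms, of "[]"] by (simp add: qcounit_def counitV_def is_comp_def)
qed

section \<open>Bijectivity\<close>

lemma dmask_surj: "\<exists>\<alpha>. is_comp \<alpha> \<and> dmask \<alpha> = m @ [True]"
proof (induction m)
  case Nil
  show ?case by (rule exI[of _ "[1]"]) (simp add: is_comp_def bmask_1)
next
  case (Cons b m)
  then obtain \<alpha> where \<alpha>: "is_comp \<alpha>" "dmask \<alpha> = m @ [True]" by blast
  show ?case
  \<comment> \<open>A leading \<open>True\<close> is a new part 1; a leading \<open>False\<close>
    lengthens the first part by 1.\<close>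
  proof (cases b)
    case True
    then show ?thesis using \<alpha> by (intro exI[of _ "1 # \<alpha>"]) (simp add: is_comp_def bmask_1)
  next
    case False
    obtain a \<alpha>' where a: "\<alpha> = a # \<alpha>'" using \<alpha> by (cases \<alpha>) auto
    then have "a > 0" using \<alpha> by (simp add: is_comp_def)
    then show ?thesis using \<alpha> False by (intro exI[of _ "Suc a # \<alpha>'"]) (simp add: a is_comp_def bmask_Suc)
  qed
qed

text \<open>A leading \<open>True\<close> recovers the values with first letter 0, and then a
  leading \<open>False\<close> those with first letter 1.\<close>

lemma mcoef_inject:
  assumes "q \<noteq> 1" "\<And>m. length m = length g \<Longrightarrow> mcoef q m f = mcoef q m f'" "\<forall>x\<in>set g. x \<le> 1"
  shows "f g = f' g"
  using assms(2,3)
proof (induction g arbitrary: f f')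
  case Nil
  then show ?case using Nil(1)[of "[]"] by simp
next
  case (Cons x g)
  have 0: "mcoef q m (\<lambda>g. f (0 # g)) = mcoef q m (\<lambda>g. f' (0 # g))" if "length m = length g" for m
    using Cons.prems(1)[of "True # m"] that by simp
  have 1: "mcoef q m (\<lambda>g. f (1 # g)) = mcoef q m (\<lambda>g. f' (1 # g))" if "length m = length g" for m
    using Cons.prems(1)[of "False # m"] that 0[OF that] assms(1) by simp
  have "x = 0 \<or> x = 1" using Cons.prems by auto
  then show ?case
    using Cons.IH[of "\<lambda>g. f (0 # g)" "\<lambda>g. f' (0 # g)", OF 0] Cons.IH[of "\<lambda>g. f (1 # g)" "\<lambda>g. f' (1 # g)", OF 1] Cons.prems
    by auto
qed

lemma inj_on_ch:
  assumes \<nu>: "\<nu> > 1"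
  shows "inj_on (ch \<nu>) (scfV \<nu>)"
proof (rule inj_onI)
  fix F G assume F: "F \<in> scfV \<nu>" and G: "G \<in> scfV \<nu>" and eq: "ch \<nu> F = ch \<nu> G"
  let ?q = "psiv \<nu> 1"
  have \<nu>0: "\<nu> > 0" using \<nu> by simp
  have E: "mcoef ?q (dmask \<alpha>) (\<lambda>l. F (dec l)) = mcoef ?q (dmask \<alpha>) (\<lambda>l. G (dec l))" if "is_comp \<alpha>" for \<alpha>
    using ch_mono[OF \<nu> F that] ch_mono[OF \<nu> G that] eq by simp
  show "F = G"
  proof (rule eq_pts_words[OF \<nu>0])
    show "q \<notin> pts \<nu> \<Longrightarrow> F q = G q" for q using scfV_pts[OF F] scfV_pts[OF G] by simp
    fix l assume l: "l \<in> words \<nu>"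
    show "F (dec l) = G (dec l)"
    proof (cases "l = []")
      case True
      then show ?thesis using E[of "[]"] by (simp add: is_comp_def)
    next
      case False
      moreover have "lz l" using l by (simp add: words_def)
      ultimately obtain g where g: "l = g @ [0]" by (metis append_butlast_last_id lz_def)
      \<comment> \<open>The functionals reach only the letters 0 and 1; replacing the nonzero
        letters of \<open>g\<close> by 1 changes the value of neither function.\<close>
      define g' where "g' = map (\<lambda>x. if x = 0 then 0 else (1::nat)) g"
      have w: "g' @ [0] \<in> words \<nu>" using \<nu> by (auto simp: g'_def words_def lz_def)
      have s: "list_all2 sim l (g' @ [0])"
        by (auto simp: g g'_def sim_def list_all2_map2 intro!: list_all2_appendI list_all2_refl)
      have "F (dec (g' @ [0])) = G (dec (g' @ [0]))"
      proof (rule mcoef_inject[OF psiv_1_neq[OF \<nu>], where f = "\<lambda>g. F (dec (g @ [0]))" and f' = "\<lambda>g. G (dec (g @ [0]))"])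
        fix m :: "bool list"
        obtain \<alpha> where "is_comp \<alpha>" "dmask \<alpha> = m @ [True]" using dmask_surj by blast
        then show "mcoef ?q m (\<lambda>g. F (dec (g @ [0]))) = mcoef ?q m (\<lambda>g. G (dec (g @ [0])))"
          using E[of \<alpha>] by (simp add: mcoef_append)
      qed (auto simp: g'_def)
      then show ?thesis using scfV_sim[OF F l w s] scfV_sim[OF G l w s] by simp
    qed
  qed
qed

text \<open>Solves the equations of \<open>mcoef\<close> letter by letter: f 0 is the datum for
  \<open>True\<close>, and f 1 is f 0 minus 1 - q times the datum for \<open>False\<close>. All
  nonzero letters are treated like 1, so the solution depends on the support alone.\<close>

primrec mcoef_inv :: "complex \<Rightarrow> (bool list \<Rightarrow> complex) \<Rightarrow> nat list \<Rightarrow> complex" where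
  "mcoef_inv q \<phi> [] = \<phi> []"
| "mcoef_inv q \<phi> (h # g) = (if h = 0 then mcoef_inv q (\<lambda>m. \<phi> (True # m)) g
     else mcoef_inv q (\<lambda>m. \<phi> (True # m)) g - (1 - q) * mcoef_inv q (\<lambda>m. \<phi> (False # m)) g)"

lemma mcoef_mcoef_inv: "q \<noteq> 1 \<Longrightarrow> mcoef q m (mcoef_inv q \<phi>) = \<phi> m"
proof (induction m arbitrary: \<phi>)
  case (Cons b m)
  have "mcoef q m (\<lambda>g. f g - c * f' g) = mcoef q m f - c * mcoef q m f'" for f f' c
    using mcoef_add[of q m f "\<lambda>g. - c * f' g"] mcoef_cmult[of q m "- c" f'] by simp
  then show ?case using Cons by simp
qed simp

lemma mcoef_inv_0: "(\<And>m. length m = length g \<Longrightarrow> \<phi> m = 0) \<Longrightarrow> mcoef_inv q \<phi> g = 0"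
  by (induction g arbitrary: \<phi>) auto

lemma mcoef_inv_sim: "list_all2 sim g g' \<Longrightarrow> mcoef_inv q \<phi> g = mcoef_inv q \<phi> g'"
  by (induction g g' arbitrary: \<phi> rule: list_all2_induct) (auto simp: sim_def)

lemma sum_exponents_compof:
  assumes "fsupp e"
  shows "(\<Sum>i\<in>{i. e i \<noteq> 0}. e i) = length (dmask (compof e))"
proof -
  have "length (dmask (compof e)) = sum_list (map e (sorted_list_of_set {i. e i \<noteq> 0}))"
    by (simp add: length_dmask compof_def)
  also have "\<dots> = (\<Sum>i\<in>set (sorted_list_of_set {i. e i \<noteq> 0}). e i)"
    by (rule sum_list_distinct_conv_sum_set) simp
  finally show ?thesis using assms by (simp add: fsupp_def)
qed

lemma ch_in_QSym:
  assumes \<nu>: "\<nu> > 1" and F: "F \<in> scfV \<nu>"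
  shows "ch \<nu> F \<in> QSym"
proof -
  obtain D where D: "\<And>q. D \<le> fst q \<Longrightarrow> F q = 0" using scfV_bounded F by blast
  have "(\<Sum>i\<in>{i. e i \<noteq> 0}. e i) \<le> D" if "ch \<nu> F e \<noteq> 0" for e
  proof (rule ccontr)
    assume "\<not> (\<Sum>i\<in>{i. e i \<noteq> 0}. e i) \<le> D"
    moreover have fs: "fsupp e" using that by (simp add: ch_eq[OF \<nu> F] split: if_splits)
    ultimately have "D \<le> length (dmask (compof e))" using sum_exponents_compof[OF fs] by simp
    then have "mcoef (psiv \<nu> 1) (dmask (compof e)) (\<lambda>l. F (dec l)) = mcoef (psiv \<nu> 1) (dmask (compof e)) (\<lambda>l. 0)"
      by (intro mcoef_cong) (simp add: D)
    then show False using that fs by (simp add: ch_eq[OF \<nu> F])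
  qed
  moreover have "ch \<nu> F e \<noteq> 0 \<Longrightarrow> fsupp e" for e by (simp add: ch_eq[OF \<nu> F] split: if_splits)
  moreover have "ch \<nu> F e = ch \<nu> F e'" if "fsupp e" "fsupp e'" "compof e = compof e'" for e e'
    using that by (simp add: ch_eq[OF \<nu> F])
  ultimately show ?thesis unfolding QSym_def by blast
qed

lemma ch_surj:
  assumes \<nu>: "\<nu> > 1" and f: "f \<in> QSym"
  shows "\<exists>F\<in>scfV \<nu>. ch \<nu> F = f"
proof -
  let ?q = "psiv \<nu> 1"
  have \<nu>0: "\<nu> > 0" using \<nu> by simp
  have q: "?q \<noteq> 1" by (rule psiv_1_neq[OF \<nu>])
  obtain d where d: "\<And>e. f e \<noteq> 0 \<Longrightarrow> (\<Sum>i\<in>{i. e i \<noteq> 0}. e i) \<le> d" using f unfolding QSym_def by blast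
  have fsup: "\<And>e. f e \<noteq> 0 \<Longrightarrow> fsupp e" using f unfolding QSym_def by blast
  have fq: "\<And>e e'. fsupp e \<Longrightarrow> fsupp e' \<Longrightarrow> compof e = compof e' \<Longrightarrow> f e = f e'"
    using f unfolding QSym_def by blast
  define cm where "cm m = (SOME \<alpha>. is_comp \<alpha> \<and> dmask \<alpha> = m @ [True])" for m
  have cm: "is_comp (cm m)" "dmask (cm m) = m @ [True]" for m
    using someI_ex[OF dmask_surj[of m]] by (auto simp: cm_def)
  \<comment> \<open>Masks of length n - 1 stand for the compositions of n > 0. Degree 0 is set apart
    because the empty composition has no closing \<open>True\<close>.\<close>
  define F where "F p = (if p \<in> pts \<nu> then if fst p = 0 then f (mono [])
     else mcoef_inv ?q (\<lambda>m. f (mono (cm m))) (snd p) else 0)" for p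
  have FV: "F \<in> scfV \<nu>"
  proof (rule scfVI[OF \<nu>0, where D = "Suc d"])
    show "F p \<noteq> 0 \<Longrightarrow> p \<in> pts \<nu>" for p by (simp add: F_def split: if_splits)
  next
    fix l assume l: "l \<in> words \<nu>" "Suc d \<le> length l"
    \<comment> \<open>With the closing \<open>True\<close> the mask has as many entries as
      \<open>l\<close>, so \<open>cm m\<close> has size above \<open>d\<close>, beyond the degree of
      f.\<close>
    have "f (mono (cm m)) = 0" if "length m = length (butlast l)" for m
    proof (rule ccontr)
      assume "f (mono (cm m)) \<noteq> 0"
      then have "length (dmask (cm m)) \<le> d"
        using d[of "mono (cm m)"] sum_exponents_compof[OF fsupp_mono, of "cm m"] by (simp add: compof_mono cm)
      then show False using that l by (simp add: cm)
    qed
    then show "F (dec l) = 0" using l by (auto simp: F_def dec_def intro: mcoef_inv_0)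
  next
    fix l l' assume l: "l \<in> words \<nu>" "l' \<in> words \<nu>" "list_all2 sim l l'"
    have "length l = length l'" using l by (auto dest: list_all2_lengthD)
    then show "F (dec l) = F (dec l')"
      using mcoef_inv_sim[OF list_all2_butlastI[OF l(3)]] dec_in_pts[OF l(1)] dec_in_pts[OF l(2)]
      by (simp add: F_def dec_def)
  qed
  have "ch \<nu> F e = f e" for e
  proof (cases "fsupp e")
    case False
    then show ?thesis using fsup[of e] by (auto simp: ch_eq[OF \<nu> FV])
  next
    case True
    have fe: "f e = f (mono (compof e))"
      by (rule fq[OF True fsupp_mono]) (simp add: compof_mono is_comp_compof[OF True])
    have che: "ch \<nu> F e = mcoef ?q (dmask (compof e)) (\<lambda>l. F (dec l))"
      using True by (simp add: ch_eq[OF \<nu> FV])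
    show ?thesis
    proof (cases "compof e = []")
      case True
      then show ?thesis using fe che by (simp add: F_def pts_def Qn_def)
    next
      case False
      then have "dmask (compof e) \<noteq> []"
        using dmask_inject[OF is_comp_compof[OF True], of "[]"] by (auto simp: is_comp_def)
      then obtain m where m: "dmask (compof e) = m @ [True]"
        using last_dmask[of "compof e"] by (metis append_butlast_last_id)
      have "cm m = compof e" by (rule dmask_inject[OF cm(1) is_comp_compof[OF True]]) (simp add: cm m)
      have "mcoef ?q (dmask (compof e)) (\<lambda>l. F (dec l)) = mcoef ?q m (\<lambda>g. F (dec (g @ [0])))"
        by (simp add: m mcoef_append)
      also have "\<dots> = mcoef ?q m (mcoef_inv ?q (\<lambda>m. f (mono (cm m))))"
      proof (rule mcoef_cong)
        fix g :: "nat list" assume "length g = length m" "\<forall>x\<in>set g. x \<le> 1"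
        then have "g @ [0] \<in> words \<nu>" using \<nu> by (fastforce simp: words_def lz_def)
        from dec_in_pts[OF this]
        show "F (dec (g @ [0])) = mcoef_inv ?q (\<lambda>m. f (mono (cm m))) g"
          by (simp add: F_def dec_def)
      qed
      also have "\<dots> = f (mono (cm m))" by (rule mcoef_mcoef_inv[OF q])
      finally show ?thesis using fe che \<open>cm m = compof e\<close> by simp
    qed
  qed
  then show ?thesis using FV by blast
qed

text \<open>An antipode is determined by the bialgebra structure, so a bijective linear map that
  respects products, units, coproducts and counits is an isomorphism of Hopf algebras.\<close>

theorem theorem3p12:
  fixes \<nu> :: nat
  assumes "\<nu> > 1"
  shows "hopf_scf \<nu> \<and>
    (bij_betw (ch \<nu>) (scfV \<nu>) QSym \<and>
     lin_on \<nu> (ch \<nu>) \<and>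
     (\<forall>n I. I \<subseteq> {1..n-1} \<longrightarrow> ch \<nu> (chi \<nu> n I) = Lfun n I) \<and>
     (\<forall>x\<in>scfV \<nu>. \<forall>y\<in>scfV \<nu>. ch \<nu> (mult \<nu> x y) = qmult (ch \<nu> x) (ch \<nu> y)) \<and>
     ch \<nu> unitV = qunit \<and>
     (\<forall>x\<in>scfV \<nu>. chT \<nu> (comult \<nu> x) = qcomult (ch \<nu> x)) \<and>
     (\<forall>x\<in>scfV \<nu>. qcounit (ch \<nu> x) = counitV x))"
proof -
  have "ch \<nu> ` scfV \<nu> = QSym"
    using ch_in_QSym[OF assms] ch_surj[OF assms] by blast
  then have "bij_betw (ch \<nu>) (scfV \<nu>) QSym"
    using inj_on_ch[OF assms] by (simp add: bij_betw_def)
  then show ?thesis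
    using hopf_scf_holds[OF assms] lin_on_ch[OF assms] ch_chi[OF assms] ch_mult[OF assms] ch_unitV[OF assms]
      chT_comult[OF assms] qcounit_ch[OF assms] by blast
qed

end
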